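(* Let $k,d\ge 1$ be integers and let $V\subset\mathbb{R}^p$ be a non-degenerate $d$-dimensional irreducible real algebraic variety with a smooth real point. If $V\setminus U$ is weakly $k$-neighborly for some proper closed subvariety $U$ of $V$, then $p\ge 2k+d-1$.
   Context: An (affine real) algebraic variety is a set $V=V(\mathbb{C})\cap\mathbb{R}^p$, where $V(\mathbb{C})\subset\mathbb{C}^p$ is the common zero set of finitely many polynomials in $\mathbb{R}[x_1,\dots,x_p]$; the varieties considered contain smooth real points and $V(\mathbb{C})$ is the smallest complex variety containing $V$. The dimension of $V$ is the dimension of $V(\mathbb{C})$. $V$ is irreducible if it is not the union of two proper algebraic subvarieties, and non-degenerate if it is not contained in any hyperplane of $\mathbb{R}^p$. A smooth point is a point where the Jacobian matrix of generators of the ideal of $V(\mathbb{C})$ has maximal rank. A set $S\subseteq\mathbb{R}^p$ is weakly $k$-neighborly if for any set $T$ of $k$ points from $S$ there exists a closed halfspace $H$ with boundary $\operatorname{bd}(H)$ such that $S\subset H$ and $T\subset\operatorname{bd}(H)$. *)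

theory Defs
  imports "HOL-Analysis.Analysis" "HOL-Library.Poly_Mapping" "HOL-Library.Extended_Nat"
begin

section \<open>Polynomials over the complex numbers in variables indexed by a finite type\<close>

text \<open>
  A monomial is its exponent vector \<open>'n \<Rightarrow>\<^sub>0 nat\<close>, and a polynomial maps monomials to coefficients.
  Multiplication of such finitely supported functions is convolution, so this is the polynomial
  ring over \<open>complex\<close> in the variables indexed by \<open>'n\<close>.
\<close>

type_synonym 'n cpoly = "('n \<Rightarrow>\<^sub>0 nat) \<Rightarrow>\<^sub>0 complex"

definition eval_cpoly :: "'n cpoly \<Rightarrow> complex ^ 'n \<Rightarrow> complex" where
  "eval_cpoly f z =
     (\<Sum>m\<in>Poly_Mapping.keys f.
        Poly_Mapping.lookup f m * (\<Prod>i\<in>UNIV. (z $ i) ^ Poly_Mapping.lookup m i))"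

text \<open>
  The formal partial derivative. Subtraction of exponents is truncated, but the terms affected
  by this have coefficient zero.
\<close>

definition partial_deriv :: "'n \<Rightarrow> 'n cpoly \<Rightarrow> 'n cpoly" where
  "partial_deriv i f =
     (\<Sum>m\<in>Poly_Mapping.keys f.
        Poly_Mapping.single (m - Poly_Mapping.single i 1)
          (of_nat (Poly_Mapping.lookup m i) * Poly_Mapping.lookup f m))"

definition real_coeffs :: "'n cpoly \<Rightarrow> bool" where
  "real_coeffs f \<longleftrightarrow> (\<forall>m. Poly_Mapping.lookup f m \<in> \<real>)"

definition zero_set :: "('n cpoly) set \<Rightarrow> (complex ^ 'n) set" where
  "zero_set F = {z. \<forall>f\<in>F. eval_cpoly f z = 0}"


section \<open>Complex and real affine varieties\<close>

definition complex_variety :: "(complex ^ 'n) set \<Rightarrow> bool" where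
  "complex_variety W \<longleftrightarrow> (\<exists>F. finite F \<and> W = zero_set F)"

definition complex_point :: "real ^ 'n \<Rightarrow> complex ^ 'n" where
  "complex_point x = (\<chi> i. complex_of_real (x $ i))"

definition complexification :: "(real ^ 'n) set \<Rightarrow> (complex ^ 'n) set" where
  "complexification V = \<Inter>{W. complex_variety W \<and> complex_point ` V \<subseteq> W}"

text \<open>
  \<open>zero_set F\<close> is the complex variety \<open>V(\<complex>)\<close>; the last conjunct says that it is the smallest
  complex variety containing \<open>V\<close>.
\<close>

definition real_variety :: "(real ^ 'n) set \<Rightarrow> bool" where
  "real_variety V \<longleftrightarrow>
     (\<exists>F. finite F \<and> (\<forall>f\<in>F. real_coeffs f) \<and>
          V = {x. complex_point x \<in> zero_set F} \<and>
          zero_set F = complexification V)"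

definition irreducible_real_variety :: "(real ^ 'n) set \<Rightarrow> bool" where
  "irreducible_real_variety V \<longleftrightarrow>
     real_variety V \<and>
     \<not> (\<exists>A B. real_variety A \<and> real_variety B \<and> A \<subset> V \<and> B \<subset> V \<and> V = A \<union> B)"

definition irreducible_complex_variety :: "(complex ^ 'n) set \<Rightarrow> bool" where
  "irreducible_complex_variety W \<longleftrightarrow>
     complex_variety W \<and> W \<noteq> {} \<and>
     \<not> (\<exists>A B. complex_variety A \<and> complex_variety B \<and> A \<subset> W \<and> B \<subset> W \<and> W = A \<union> B)"

text \<open>
  Krull dimension: the supremum of the lengths \<open>n\<close> of chains
  \<open>X 0 \<subset> X 1 \<subset> \<dots> \<subset> X n\<close> of irreducible varieties contained in \<open>W\<close>.
\<close>

definition complex_variety_dim :: "(complex ^ 'n) set \<Rightarrow> enat" where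
  "complex_variety_dim W =
     Sup {enat n | n. \<exists>X. (\<forall>i\<le>n. irreducible_complex_variety (X i) \<and> X i \<subseteq> W) \<and>
                          (\<forall>i<n. X i \<subset> X (Suc i))}"

definition real_variety_dim :: "(real ^ 'n) set \<Rightarrow> enat" where
  "real_variety_dim V = complex_variety_dim (complexification V)"

definition nondegenerate :: "(real ^ 'n) set \<Rightarrow> bool" where
  "nondegenerate V \<longleftrightarrow> \<not> (\<exists>a b. a \<noteq> 0 \<and> V \<subseteq> {x. a \<bullet> x = b})"


section \<open>Smooth points\<close>

definition vanishing_ideal :: "(complex ^ 'n) set \<Rightarrow> ('n cpoly) set" where
  "vanishing_ideal W = {f. \<forall>z\<in>W. eval_cpoly f z = 0}"

text \<open>Over a commutative ring regarded as a module over itself, the span of a set is the ideal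
  it generates.\<close>

definition generates_ideal :: "('n cpoly) set \<Rightarrow> ('n cpoly) set \<Rightarrow> bool" where
  "generates_ideal G I \<longleftrightarrow> module.span (*) G = I"

text \<open>
  The rank at \<open>z\<close> of the Jacobian matrix with rows indexed by \<open>G\<close>, as the dimension of its row
  space; this is how \<^const>\<open>rank\<close> is defined for matrices with rows indexed by a type.
\<close>

definition jacobian_rank :: "('n cpoly) set \<Rightarrow> complex ^ 'n \<Rightarrow> nat" where
  "jacobian_rank G z = vec.dim {(\<chi> i. eval_cpoly (partial_deriv i g) z) | g. g \<in> G}"

text \<open>
  Maximality of the rank is among all points of \<open>V(\<complex>)\<close>. On points of \<open>V(\<complex>)\<close> the rank does not
  depend on the choice of generators \<open>G\<close>, and some finite \<open>G\<close> exists by Hilbert's basis theorem.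
\<close>

definition smooth_real_point :: "(real ^ 'n) set \<Rightarrow> real ^ 'n \<Rightarrow> bool" where
  "smooth_real_point V x \<longleftrightarrow>
     x \<in> V \<and>
     (\<exists>G. finite G \<and> generates_ideal G (vanishing_ideal (complexification V)) \<and>
          (\<forall>z\<in>complexification V. jacobian_rank G z \<le> jacobian_rank G (complex_point x)))"


section \<open>Weak neighborliness\<close>

definition closed_halfspace :: "(real ^ 'n) set \<Rightarrow> bool" where
  "closed_halfspace H \<longleftrightarrow> (\<exists>a b. a \<noteq> 0 \<and> H = {x. a \<bullet> x \<le> b})"

definition weakly_neighborly :: "nat \<Rightarrow> (real ^ 'n) set \<Rightarrow> bool" where
  "weakly_neighborly k S \<longleftrightarrow>
     (\<forall>T. T \<subseteq> S \<and> finite T \<and> card T = k \<longrightarrow>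
        (\<exists>H. closed_halfspace H \<and> S \<subseteq> H \<and> T \<subseteq> frontier H))"

end

theory Submission
  imports Defs
begin

text \<open>
  At a regular point \<open>x\<close> of \<open>V\<close>, a hyperplane supporting \<open>V - U\<close> contains the affine tangent space of
  \<open>V\<close>. Choose regular points \<open>x\<^sub>1, \<dots>, x\<^sub>k\<close> outside \<open>U\<close> one at a time, and let \<open>L\<^sub>j\<close> be the affine span of the
  tangent spaces at \<open>x\<^sub>1, \<dots>, x\<^sub>j\<close>. If \<open>dim L\<^sub>j \<le> dim L\<^sub>j\<^sub>-\<^sub>1 + 1\<close> for every choice of \<open>x\<^sub>j\<close>, then quotients of affine
  functions vanishing on \<open>L\<^sub>j\<^sub>-\<^sub>1\<close> are locally constant on \<open>V\<close>, which contradicts non-degeneracy unless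
  \<open>L\<^sub>j\<^sub>-\<^sub>1\<close> is a hyperplane; in that case it would support \<open>V\<close> at every further point and contain \<open>V\<close>. So the
  dimension can be made to grow by two in each step, from \<open>dim V\<close> to at most \<open>p - 1\<close>.

  Dimension theory enters only through one fact: functions that are algebraically independent on \<open>V\<close>
  stay so after adjoining polynomials that vanish on \<open>V\<close> and have independent gradients at one of its
  points, and \<open>p + 1\<close> polynomials on \<open>\<real>\<^sup>p\<close> are dependent. A chain of irreducible varieties yields
  independent functions, which bounds \<open>d\<close> by the dimension of the tangent spaces. Local coordinates
  at a regular point together with a polynomial that vanishes on \<open>V\<close> near this point, but not on all of
  \<open>V\<close>, would be too many independent functions, so that there is no such polynomial.
\<close>

section \<open>Algebraic independence of functions\<close>

text \<open>The two halves meet in one number c, called \<open>codim\<close>: the largest number of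
  independent gradients of vanishing polynomials at a point of V. Counting spans gives 2k \<le> c +
  1, counting independent functions gives d + c \<le> p.

  The obstacle is that a supporting hyperplane gives only first-order information at single points,
  whereas irreducibility and non-degeneracy concern V as a whole, which may fall into several real
  pieces. That V is a manifold near a point of rank c has to be proved: c vanishing polynomials cut
  out a manifold, and all generators vanish on it because they solve a linear differential equation
  with initial value zero.

  The growth by two has this source. Let l1, l2 be affine functions that vanish on the span reached
  so far, with linear parts a1, a2. At a point y of V with tangent vector v, the determinant l1(y)
  (a2 \<bullet> v) - l2(y) (a1 \<bullet> v) is the numerator of the derivative of l2 / l1 along v.
  Where it is nonzero, y and v are independent modulo the span; if it is always zero, l2 / l1 is
  locally constant.\<close>

definition alg_indep :: "nat \<Rightarrow> (nat \<Rightarrow> 'a \<Rightarrow> complex) \<Rightarrow> 'a set \<Rightarrow> bool" where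
  "alg_indep m u X \<longleftrightarrow>
     (\<forall>N c. (\<forall>x\<in>X. (\<Sum>\<gamma>\<in>PiE {..<m} (\<lambda>_. {..N}). c \<gamma> * (\<Prod>i<m. u i x ^ \<gamma> i)) = 0) \<longrightarrow>
            (\<forall>\<gamma>\<in>PiE {..<m} (\<lambda>_. {..N}). c \<gamma> = 0))"

lemma alg_indepD:
  assumes "alg_indep m u X"
    and "\<And>x. x \<in> X \<Longrightarrow> (\<Sum>\<gamma>\<in>PiE {..<m} (\<lambda>_. {..N}). c \<gamma> * (\<Prod>i<m. u i x ^ \<gamma> i)) = 0"
    and "\<gamma> \<in> PiE {..<m} (\<lambda>_. {..N})"
  shows "c \<gamma> = 0"
  using assms unfolding alg_indep_def by blast

lemma alg_indep_0: "X \<noteq> {} \<Longrightarrow> alg_indep 0 u X"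
  by (auto simp: alg_indep_def)

lemma alg_indep_mono: "alg_indep m u X \<Longrightarrow> X \<subseteq> Y \<Longrightarrow> alg_indep m u Y"
  unfolding alg_indep_def by (fast intro: subsetD)

lemma alg_indep_cong:
  assumes "\<And>i x. i < m \<Longrightarrow> x \<in> X \<Longrightarrow> u i x = v i x"
  shows "alg_indep m u X \<longleftrightarrow> alg_indep m v X"
proof -
  have "(\<Sum>\<gamma>\<in>PiE {..<m} (\<lambda>_. {..N}). c \<gamma> * (\<Prod>i<m. u i x ^ \<gamma> i)) =
        (\<Sum>\<gamma>\<in>PiE {..<m} (\<lambda>_. {..N}). c \<gamma> * (\<Prod>i<m. v i x ^ \<gamma> i))" if "x \<in> X" for x N c
    using assms that by (intro sum.cong refl arg_cong2[of _ _ _ _ "(*)"] prod.cong) auto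
  then show ?thesis
    unfolding alg_indep_def by simp
qed

text \<open>Allows a relation in \<open>Suc m\<close> functions to be read as a polynomial in the
  last one, with coefficients in the first \<open>m\<close>. Exponent vectors are extensional, so
  that setting the value at \<open>m\<close> is injective.\<close>

lemma sum_PiE_lessThan_Suc:
  fixes f :: "(nat \<Rightarrow> nat) \<Rightarrow> 'b::comm_monoid_add"
  shows "(\<Sum>\<gamma>\<in>PiE {..<Suc m} (\<lambda>_. {..N}). f \<gamma>) =
         (\<Sum>k\<le>N. \<Sum>\<delta>\<in>PiE {..<m} (\<lambda>_. {..N}). f (\<delta>(m := k)))"
proof -
  have inj: "inj_on (\<lambda>(k, \<delta>). \<delta>(m := k)) ({..N} \<times> PiE {..<m} (\<lambda>_. {..N}))"
    using inj_combinator[of m "{..<m}" "\<lambda>_. {..N}"] by simp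
  have "PiE {..<Suc m} (\<lambda>_. {..N}) = (\<lambda>(k, \<delta>). \<delta>(m := k)) ` ({..N} \<times> PiE {..<m} (\<lambda>_. {..N}))"
    unfolding lessThan_Suc PiE_insert_eq ..
  then have "(\<Sum>\<gamma>\<in>PiE {..<Suc m} (\<lambda>_. {..N}). f \<gamma>) =
      (\<Sum>(k, \<delta>)\<in>{..N} \<times> PiE {..<m} (\<lambda>_. {..N}). f (\<delta>(m := k)))"
    using sum.reindex[OF inj, of f] by (simp only: comp_def case_prod_unfold)
  then show ?thesis
    by (simp add: sum.cartesian_product)
qed

text \<open>
  The monomials in \<open>u m\<close> are separated by cancelling powers of \<open>u m\<close>, which is a nonzerodivisor
  on \<open>Y\<close>, and then restricting to \<open>X\<close>, where \<open>u m\<close> vanishes.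
\<close>

lemma alg_indep_Suc:
  assumes indep: "alg_indep m u X" and XY: "X \<subseteq> Y" and zero: "\<And>x. x \<in> X \<Longrightarrow> u m x = 0"
    and nonzerodiv: "\<And>F. F \<in> R \<Longrightarrow> (\<And>x. x \<in> Y \<Longrightarrow> F x * u m x = 0) \<Longrightarrow> (\<And>x. x \<in> Y \<Longrightarrow> F x = 0)"
    and const: "\<And>a. (\<lambda>_. a) \<in> R"
    and add: "\<And>F G. F \<in> R \<Longrightarrow> G \<in> R \<Longrightarrow> (\<lambda>x. F x + G x) \<in> R"
    and mult: "\<And>F G. F \<in> R \<Longrightarrow> G \<in> R \<Longrightarrow> (\<lambda>x. F x * G x) \<in> R"
    and u: "\<And>i. i \<le> m \<Longrightarrow> u i \<in> R"
  shows "alg_indep (Suc m) u Y"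
proof -
  have sum: "(\<lambda>x. \<Sum>a\<in>A. F a x) \<in> R" if "finite A" "\<And>a. a \<in> A \<Longrightarrow> F a \<in> R" for A and F :: "'c \<Rightarrow> _"
    using that by (induction) (auto intro: const add)
  have prod: "(\<lambda>x. \<Prod>a\<in>A. F a x) \<in> R" if "finite A" "\<And>a. a \<in> A \<Longrightarrow> F a \<in> R" for A and F :: "'c \<Rightarrow> _"
    using that by (induction) (auto intro: const mult)
  have power: "(\<lambda>x. F x ^ k) \<in> R" if "F \<in> R" for F k
    by (induction k) (auto intro: const mult that)
  have cancel: "F x = 0" if "F \<in> R" "\<And>x. x \<in> Y \<Longrightarrow> F x * u m x ^ k = 0" "x \<in> Y" for F k x
    using that
  proof (induction k arbitrary: F x)
    case (Suc k)
    have "F x * u m x = 0" if "x \<in> Y" for x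
      using Suc.IH[of "\<lambda>x. F x * u m x"] Suc.prems that mult[OF Suc.prems(1) u[of m]]
      by (simp add: mult.assoc)
    then show ?case
      using nonzerodiv[OF Suc.prems(1)] Suc.prems(3) by blast
  qed auto
  show ?thesis
    unfolding alg_indep_def
  proof (intro allI impI)
    fix N c
    assume "\<forall>x\<in>Y. (\<Sum>\<gamma>\<in>PiE {..<Suc m} (\<lambda>_. {..N}). c \<gamma> * (\<Prod>i<Suc m. u i x ^ \<gamma> i)) = 0"
    define Q where "Q k x = (\<Sum>\<delta>\<in>PiE {..<m} (\<lambda>_. {..N}). c (\<delta>(m := k)) * (\<Prod>i<m. u i x ^ \<delta> i))" for k x
    have eq: "(\<Sum>k\<le>N. Q k x * u m x ^ k) = 0" if "x \<in> Y" for x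
    proof -
      have "(\<Sum>k\<le>N. Q k x * u m x ^ k) =
          (\<Sum>\<gamma>\<in>PiE {..<Suc m} (\<lambda>_. {..N}). c \<gamma> * (\<Prod>i<Suc m. u i x ^ \<gamma> i))"
        unfolding sum_PiE_lessThan_Suc Q_def sum_distrib_right
        by (intro sum.cong refl) (simp add: mult.assoc)
      then show ?thesis
        using \<open>\<forall>x\<in>Y. _\<close> that by simp
    qed
    have QR: "Q k \<in> R" for k
      unfolding Q_def by (intro sum mult prod power const u finite_PiE) auto
    have coeff: "\<forall>\<delta>\<in>PiE {..<m} (\<lambda>_. {..N}). c (\<delta>(m := k)) = 0" if "k \<le> N" for k
      using that
    proof (induction k rule: less_induct)
      case (less k)
      have Q0: "Q j x = 0" if "j < k" for j x
        unfolding Q_def using less.IH[OF that] less.prems that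
        by (intro sum.neutral ballI) (simp del: fun_upd_apply)
      \<comment> \<open>The coefficients below \<open>k\<close> vanish, so the relation is
        \<open>F\<close> times the \<open>k\<close>-th power of \<open>u m\<close>. On
        \<open>X\<close>, where \<open>u m\<close> is zero, \<open>F\<close> reduces to
        \<open>Q k\<close>.\<close>
      define F where "F x = (\<Sum>j\<in>{k..N}. Q j x * u m x ^ (j - k))" for x
      have "F \<in> R"
        unfolding F_def by (intro sum mult power u QR) auto
      moreover have "F x * u m x ^ k = 0" if "x \<in> Y" for x
      proof -
        have "F x * u m x ^ k = (\<Sum>j\<in>{k..N}. Q j x * u m x ^ j)"
          unfolding F_def sum_distrib_right
          by (intro sum.cong refl) (simp add: mult.assoc flip: power_add)
        also have "\<dots> = (\<Sum>j\<le>N. Q j x * u m x ^ j)"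
          by (intro sum.mono_neutral_left) (auto simp: Q0)
        finally show ?thesis
          using eq that by simp
      qed
      ultimately have F0: "F x = 0" if "x \<in> Y" for x
        using cancel that by blast
      have "Q k x = 0" if "x \<in> X" for x
      proof -
        have "F x = (\<Sum>j\<in>{k..N}. if j = k then Q k x else 0)"
          unfolding F_def using zero[OF that] by (intro sum.cong refl) auto
        then show ?thesis
          using F0 XY that less.prems by auto
      qed
      then show ?case
        using alg_indepD[OF indep, where N = N and c = "\<lambda>\<delta>. c (\<delta>(m := k))"] unfolding Q_def by blast
    qed
    show "\<forall>\<gamma>\<in>PiE {..<Suc m} (\<lambda>_. {..N}). c \<gamma> = 0"
      unfolding lessThan_Suc PiE_insert_eq using coeff by auto
  qed
qed

text \<open>A polynomial that vanishes on a real box has zero coefficients: with all but the last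
  variable fixed, it is a univariate polynomial with infinitely many roots, and its coefficients are
  treated by induction.\<close>

lemma alg_indep_box:
  assumes "0 < \<epsilon>" and "\<And>w::nat \<Rightarrow> real. (\<And>i. \<bar>w i\<bar> < \<epsilon>) \<Longrightarrow> \<exists>x\<in>X. \<forall>i<m. u i x = complex_of_real (w i)"
  shows "alg_indep m u X"
proof -
  have main: "\<forall>\<gamma>\<in>PiE {..<k} (\<lambda>_. {..N}). c \<gamma> = 0"
    if "\<And>w::nat \<Rightarrow> real. (\<And>i. \<bar>w i\<bar> < \<epsilon>) \<Longrightarrow>
          (\<Sum>\<gamma>\<in>PiE {..<k} (\<lambda>_. {..N}). c \<gamma> * (\<Prod>i<k. complex_of_real (w i) ^ \<gamma> i)) = 0" for k N c
    using that
  proof (induction k arbitrary: c)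
    case 0
    show ?case using 0[of "\<lambda>_. 0"] \<open>0 < \<epsilon>\<close> by simp
  next
    case (Suc k)
    have "\<forall>\<delta>\<in>PiE {..<k} (\<lambda>_. {..N}). c (\<delta>(k := j)) = 0" if "j \<le> N" for j
    proof (rule Suc.IH)
      fix w :: "nat \<Rightarrow> real" assume w: "\<And>i. \<bar>w i\<bar> < \<epsilon>"
      define q where "q j = (\<Sum>\<delta>\<in>PiE {..<k} (\<lambda>_. {..N}). c (\<delta>(k := j)) * (\<Prod>i<k. complex_of_real (w i) ^ \<delta> i))" for j
      have "(\<Sum>j\<le>N. q j * z ^ j) = 0" if z: "z \<in> complex_of_real ` {0<..<\<epsilon>}" for z
      proof -
        obtain s where s: "0 < s" "s < \<epsilon>" "z = complex_of_real s"
          using z by auto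
        define w' where "w' = w(k := s)"
        have w': "\<bar>w' i\<bar> < \<epsilon>" for i
          using w s by (auto simp: w'_def)
        have "(\<Sum>j\<le>N. q j * z ^ j) =
            (\<Sum>\<gamma>\<in>PiE {..<Suc k} (\<lambda>_. {..N}). c \<gamma> * (\<Prod>i<Suc k. complex_of_real (w' i) ^ \<gamma> i))"
          unfolding sum_PiE_lessThan_Suc q_def sum_distrib_right
          by (intro sum.cong refl) (simp add: mult.assoc w'_def s)
        then show ?thesis
          using Suc.prems[of w'] w' by simp
      qed
      then have "complex_of_real ` {0<..<\<epsilon>} \<subseteq> {z. (\<Sum>j\<le>N. q j * z ^ j) = 0}"
        by blast
      moreover have "infinite (complex_of_real ` {0<..<\<epsilon>})"
        using \<open>0 < \<epsilon>\<close> by (simp add: finite_image_iff inj_on_def)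
      ultimately have "infinite {z. (\<Sum>j\<le>N. q j * z ^ j) = 0}"
        using infinite_super by blast
      then have "\<forall>j\<le>N. q j = 0"
        using polyfun_finite_roots[of q N] by blast
      then show "(\<Sum>\<delta>\<in>PiE {..<k} (\<lambda>_. {..N}). c (\<delta>(k := j)) * (\<Prod>i<k. complex_of_real (w i) ^ \<delta> i)) = 0"
        using that unfolding q_def by blast
    qed
    then show ?case
      unfolding lessThan_Suc PiE_insert_eq by auto
  qed
  show ?thesis
    unfolding alg_indep_def
  proof (intro allI impI)
    fix N c
    assume H: "\<forall>x\<in>X. (\<Sum>\<gamma>\<in>PiE {..<m} (\<lambda>_. {..N}). c \<gamma> * (\<Prod>i<m. u i x ^ \<gamma> i)) = 0"
    show "\<forall>\<gamma>\<in>PiE {..<m} (\<lambda>_. {..N}). c \<gamma> = 0"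
    proof (rule main)
      fix w :: "nat \<Rightarrow> real" assume "\<And>i. \<bar>w i\<bar> < \<epsilon>"
      then obtain x where x: "x \<in> X" "\<forall>i<m. u i x = complex_of_real (w i)"
        using assms(2) by blast
      then show "(\<Sum>\<gamma>\<in>PiE {..<m} (\<lambda>_. {..N}). c \<gamma> * (\<Prod>i<m. complex_of_real (w i) ^ \<gamma> i)) = 0"
        using H[rule_format, OF x(1)] by simp
    qed
  qed
qed

section \<open>Linear algebra and the counting of monomials\<close>

lemma exists_nontrivial_solution:
  fixes M :: "'a \<Rightarrow> 'b \<Rightarrow> 'c::field"
  assumes "finite B" "finite A" "card B < card A"
  shows "\<exists>c. (\<exists>a\<in>A. c a \<noteq> 0) \<and> (\<forall>b\<in>B. (\<Sum>a\<in>A. c a * M a b) = 0)"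
  using assms
proof (induction B arbitrary: A M rule: finite_induct)
  case empty
  then obtain a where "a \<in> A"
    by fastforce
  then show ?case
    by (intro exI[of _ "\<lambda>_. 1"]) auto
next
  case (insert b B)
  show ?case
  proof (cases "\<forall>a\<in>A. M a b = 0")
    case True
    moreover have "card B < card A"
      using insert.prems insert.hyps by simp
    ultimately show ?thesis
      using insert.IH[of A M] insert.prems by auto
  next
    case False
    then obtain a0 where a0: "a0 \<in> A" "M a0 b \<noteq> 0"
      by blast
    \<comment> \<open>Gaussian elimination: multiples of equation \<open>b\<close> with pivot
      \<open>a0\<close> are subtracted from the other equations, which removes the unknown
      \<open>c a0\<close>. Its value is recovered below as \<open>- s\<close>.\<close>
    define M' where "M' a b' = M a b' - M a b / M a0 b * M a0 b'" for a b'
    have "card B < card (A - {a0})"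
      using insert a0 by simp
    with insert.IH[of "A - {a0}" M'] insert.prems
    obtain c a1 where c: "a1 \<in> A - {a0}" "c a1 \<noteq> 0" "\<forall>b'\<in>B. (\<Sum>a\<in>A - {a0}. c a * M' a b') = 0"
      by auto
    define s where "s = (\<Sum>a\<in>A - {a0}. c a * M a b) / M a0 b"
    define c' where "c' = c(a0 := - s)"
    have split: "(\<Sum>a\<in>A. c' a * M a b') = (\<Sum>a\<in>A - {a0}. c a * M a b') - s * M a0 b'" for b'
    proof -
      have "(\<Sum>a\<in>A. c' a * M a b') = c' a0 * M a0 b' + (\<Sum>a\<in>A - {a0}. c' a * M a b')"
        by (rule sum.remove) (use insert a0 in auto)
      also have "(\<Sum>a\<in>A - {a0}. c' a * M a b') = (\<Sum>a\<in>A - {a0}. c a * M a b')"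
        by (intro sum.cong) (auto simp: c'_def)
      finally show ?thesis
        by (simp add: c'_def)
    qed
    have "(\<Sum>a\<in>A. c' a * M a b) = 0"
      unfolding split s_def using a0 by simp
    moreover have "(\<Sum>a\<in>A. c' a * M a b') = 0" if "b' \<in> B" for b'
    proof -
      have "0 = (\<Sum>a\<in>A - {a0}. c a * M' a b')"
        using c(3) that by simp
      also have "\<dots> = (\<Sum>a\<in>A - {a0}. c a * M a b') - s * M a0 b'"
        unfolding M'_def s_def
        by (simp add: algebra_simps sum_subtractf sum_distrib_left sum_divide_distrib)
      finally show ?thesis
        unfolding split by simp
    qed
    moreover have "c' a1 \<noteq> 0" "a1 \<in> A"
      using c by (auto simp: c'_def)
    ultimately show ?thesis
      by (intro exI[of _ c']) auto
  qed
qed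

text \<open>Each exponent is bounded separately, instead of the total degree, so that the number of
  monomials is exactly a power of \<open>D + 1\<close>.\<close>

definition exponents :: "nat \<Rightarrow> ('n \<Rightarrow> nat) set" where
  "exponents D = {\<beta>. \<forall>i. \<beta> i \<le> D}"

lemma exponents_conv_PiE: "exponents D = PiE UNIV (\<lambda>_. {..D})"
  by (auto simp: exponents_def PiE_def extensional_def)

lemma finite_exponents: "finite (exponents D :: ('n::finite \<Rightarrow> nat) set)"
  unfolding exponents_conv_PiE by (intro finite_PiE) auto

lemma card_exponents: "card (exponents D :: ('n::finite \<Rightarrow> nat) set) = (D + 1) ^ CARD('n)"
  unfolding exponents_conv_PiE by (simp add: card_PiE)

definition cmonom :: "('n \<Rightarrow> nat) \<Rightarrow> real ^ 'n::finite \<Rightarrow> complex" where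
  "cmonom \<beta> x = (\<Prod>i\<in>UNIV. complex_of_real (x $ i) ^ \<beta> i)"

lemma cmonom_unit: "cmonom (\<lambda>j. if j = i then 1 else 0) x = complex_of_real (x $ i)"
proof -
  have "cmonom (\<lambda>j. if j = i then 1 else 0) x = (\<Prod>j\<in>UNIV. if j = i then complex_of_real (x $ j) else 1)"
    unfolding cmonom_def by (intro prod.cong) auto
  then show ?thesis
    by simp
qed

text \<open>Consists of functions and not of formal polynomials: what the count uses is the spanning
  family of \<open>(D + 1) ^ CARD('n)\<close> monomials.\<close>

definition poly_space :: "nat \<Rightarrow> (real ^ 'n \<Rightarrow> complex) set" where
  "poly_space D = {F. \<exists>c. \<forall>x. F x = (\<Sum>\<beta>\<in>exponents D. c \<beta> * cmonom \<beta> x)}"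

lemma poly_spaceE:
  assumes "F \<in> poly_space D"
  obtains c where "F = (\<lambda>x. \<Sum>\<beta>\<in>exponents D. c \<beta> * cmonom \<beta> x)"
  using assms unfolding poly_space_def fun_eq_iff by blast

lemma cmonom_in_poly_space:
  assumes "\<beta> \<in> exponents D" shows "cmonom \<beta> \<in> poly_space D"
  unfolding poly_space_def
  by (intro CollectI exI[of _ "\<lambda>\<alpha>. if \<alpha> = \<beta> then 1 else 0"])
     (use assms in \<open>simp add: if_distrib[of "\<lambda>a. a * _"] finite_exponents cong: if_cong\<close>)

lemma poly_space_add:
  "F \<in> poly_space D \<Longrightarrow> G \<in> poly_space D \<Longrightarrow> (\<lambda>x. F x + G x) \<in> poly_space D"
  unfolding poly_space_def mem_Collect_eq
  by (elim exE, rename_tac c d, rule_tac x = "\<lambda>\<beta>. c \<beta> + d \<beta>" in exI)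
     (simp add: algebra_simps sum.distrib)

lemma poly_space_cmult: "F \<in> poly_space D \<Longrightarrow> (\<lambda>x. a * F x) \<in> poly_space D"
  unfolding poly_space_def mem_Collect_eq
  by (elim exE, rename_tac c, rule_tac x = "\<lambda>\<beta>. a * c \<beta>" in exI)
     (simp add: algebra_simps sum_distrib_left)

lemma poly_space_0: "(\<lambda>_. 0) \<in> poly_space D"
  unfolding poly_space_def mem_Collect_eq by (rule exI[of _ "\<lambda>_. 0"]) simp

lemma poly_space_sum:
  "finite A \<Longrightarrow> (\<And>a. a \<in> A \<Longrightarrow> F a \<in> poly_space D) \<Longrightarrow> (\<lambda>x. \<Sum>a\<in>A. F a x) \<in> poly_space D"
  by (induction rule: finite_induct) (auto intro: poly_space_0 poly_space_add)

lemma poly_space_mono: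
  assumes "F \<in> poly_space D" "D \<le> E" shows "F \<in> poly_space E"
proof -
  obtain c where "F = (\<lambda>x. \<Sum>\<beta>\<in>exponents D. c \<beta> * cmonom \<beta> x)"
    using assms(1) by (rule poly_spaceE)
  moreover have "exponents D \<subseteq> exponents E"
    using assms(2) by (auto simp: exponents_def intro: order_trans)
  ultimately show ?thesis
    by (auto intro!: poly_space_sum poly_space_cmult cmonom_in_poly_space finite_exponents)
qed

lemma poly_space_mult:
  assumes "F \<in> poly_space D" "G \<in> poly_space E" shows "(\<lambda>x. F x * G x) \<in> poly_space (D + E)"
proof -
  obtain c where F: "F = (\<lambda>x. \<Sum>\<beta>\<in>exponents D. c \<beta> * cmonom \<beta> x)"
    using assms(1) by (rule poly_spaceE)
  obtain d where G: "G = (\<lambda>x. \<Sum>\<beta>\<in>exponents E. d \<beta> * cmonom \<beta> x)"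
    using assms(2) by (rule poly_spaceE)
  have "F x * G x = (\<Sum>\<beta>\<in>exponents D. \<Sum>\<alpha>\<in>exponents E. c \<beta> * d \<alpha> * cmonom (\<lambda>i. \<beta> i + \<alpha> i) x)" for x
    unfolding F G sum_product
    by (intro sum.cong refl) (simp add: cmonom_def power_add prod.distrib mult_ac)
  moreover have "(\<lambda>i. \<beta> i + \<alpha> i) \<in> exponents (D + E)"
    if "\<beta> \<in> exponents D" "\<alpha> \<in> exponents E" for \<alpha> \<beta> :: "'a \<Rightarrow> nat"
    using that by (simp add: exponents_def add_mono)
  ultimately show ?thesis
    by (auto intro!: poly_space_sum poly_space_cmult cmonom_in_poly_space finite_exponents)
qed

lemma poly_space_const: "(\<lambda>_. a) \<in> poly_space D"
proof -
  have "(\<lambda>x. a * cmonom (\<lambda>_. 0) x) \<in> poly_space D"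
    by (intro poly_space_cmult cmonom_in_poly_space) (simp add: exponents_def)
  then show ?thesis
    by (simp add: cmonom_def)
qed

lemma poly_space_power: "F \<in> poly_space D \<Longrightarrow> (\<lambda>x. F x ^ k) \<in> poly_space (k * D)"
  by (induction k) (auto simp: poly_space_const intro: poly_space_mult)

lemma poly_space_monomial:
  assumes "\<And>i. i < m \<Longrightarrow> u i \<in> poly_space D" "\<And>i. i < m \<Longrightarrow> \<gamma> i \<le> N"
  shows "(\<lambda>x. \<Prod>i<m. u i x ^ \<gamma> i) \<in> poly_space (m * N * D)"
  using assms
proof (induction m)
  case (Suc m)
  have "(\<lambda>x. u m x ^ \<gamma> m) \<in> poly_space (N * D)"
    using Suc.prems by (intro poly_space_mono[OF poly_space_power[of _ D]] mult_le_mono) auto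
  then have "(\<lambda>x. (\<Prod>i<m. u i x ^ \<gamma> i) * u m x ^ \<gamma> m) \<in> poly_space (m * N * D + N * D)"
    using Suc by (intro poly_space_mult) auto
  then show ?case
    by (simp add: algebra_simps)
qed (simp add: poly_space_const)

text \<open>
  There are more than \<open>N ^ m\<close> monomials of degree at most \<open>N\<close> in each \<open>u i\<close>, but they lie in a space
  whose dimension grows like \<open>N ^ CARD('n)\<close>.
\<close>

lemma not_alg_indep_if_too_many:
  fixes u :: "nat \<Rightarrow> real ^ 'n \<Rightarrow> complex"
  assumes "CARD('n) < m" "\<And>i. i < m \<Longrightarrow> \<exists>D. u i \<in> poly_space D"
  shows "\<not> alg_indep m u UNIV"
proof
  assume indep: "alg_indep m u UNIV"
  obtain D' where D': "\<And>i. i < m \<Longrightarrow> u i \<in> poly_space (D' i)"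
    using assms(2) by metis
  define D where "D = (\<Sum>i<m. D' i)"
  have uD: "u i \<in> poly_space D" if "i < m" for i
    by (rule poly_space_mono[OF D'[OF that]]) (use that in \<open>auto simp: D_def intro: member_le_sum\<close>)
  define p where "p = CARD('n)"
  \<comment> \<open>With this choice \<open>N\<close> itself is the constant factor in the estimate
    \<open>card B \<le> (m * D + 1) ^ p * (N + 1) ^ p\<close>. The right-hand side is then below
    \<open>(N + 1) ^ Suc p\<close>, hence below the number of exponent vectors.\<close>
  define N where "N = (m * D + 1) ^ p"
  define A where "A = PiE {..<m} (\<lambda>_. {..N})"
  define B where "B = (exponents (m * N * D) :: ('n \<Rightarrow> nat) set)"
  have fin: "finite A" "finite B"
    by (auto simp: A_def B_def finite_exponents intro: finite_PiE)
  have "card B = (m * N * D + 1) ^ p"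
    by (simp add: B_def card_exponents p_def)
  also have "\<dots> \<le> ((m * D + 1) * (N + 1)) ^ p"
    by (intro power_mono) (auto simp: algebra_simps)
  also have "\<dots> = N * (N + 1) ^ p"
    by (simp only: N_def power_mult_distrib)
  also have "\<dots> < (N + 1) ^ Suc p"
    by simp
  also have "\<dots> \<le> (N + 1) ^ m"
    using assms(1) by (intro power_increasing) (auto simp: p_def)
  also have "\<dots> = card A"
    by (simp add: A_def card_PiE)
  finally have card: "card B < card A" .
  have "\<exists>M. \<forall>x. (\<Prod>i<m. u i x ^ \<gamma> i) = (\<Sum>\<beta>\<in>B. M \<beta> * cmonom \<beta> x)" if "\<gamma> \<in> A" for \<gamma>
  proof -
    have "(\<lambda>x. \<Prod>i<m. u i x ^ \<gamma> i) \<in> poly_space (m * N * D)"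
      by (intro poly_space_monomial uD) (use that in \<open>auto simp: A_def PiE_iff\<close>)
    then show ?thesis
      by (simp add: poly_space_def B_def)
  qed
  then obtain M where M: "\<And>\<gamma> x. \<gamma> \<in> A \<Longrightarrow> (\<Prod>i<m. u i x ^ \<gamma> i) = (\<Sum>\<beta>\<in>B. M \<gamma> \<beta> * cmonom \<beta> x)"
    by metis
  obtain c \<gamma>0 where c: "\<gamma>0 \<in> A" "c \<gamma>0 \<noteq> 0" "\<And>\<beta>. \<beta> \<in> B \<Longrightarrow> (\<Sum>\<gamma>\<in>A. c \<gamma> * M \<gamma> \<beta>) = 0"
    using exists_nontrivial_solution[OF fin(2,1) card, of M] by blast
  have "(\<Sum>\<gamma>\<in>A. c \<gamma> * (\<Prod>i<m. u i x ^ \<gamma> i)) = 0" for x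
  proof -
    have "(\<Sum>\<gamma>\<in>A. c \<gamma> * (\<Prod>i<m. u i x ^ \<gamma> i)) = (\<Sum>\<gamma>\<in>A. \<Sum>\<beta>\<in>B. c \<gamma> * (M \<gamma> \<beta> * cmonom \<beta> x))"
      by (simp add: M sum_distrib_left)
    also have "\<dots> = (\<Sum>\<beta>\<in>B. (\<Sum>\<gamma>\<in>A. c \<gamma> * M \<gamma> \<beta>) * cmonom \<beta> x)"
      by (subst sum.swap) (simp add: sum_distrib_right mult.assoc)
    finally show ?thesis
      by (simp add: c(3))
  qed
  then have "c \<gamma>0 = 0"
    using alg_indepD[OF indep, where N = N and c = c and \<gamma> = \<gamma>0] c(1) unfolding A_def by blast
  with c(2) show False ..
qed

lemma real_polynomial_in_poly_space:
  fixes f :: "real ^ 'n \<Rightarrow> real"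
  assumes "real_polynomial_function f"
  shows "\<exists>D. (\<lambda>x. complex_of_real (f x)) \<in> poly_space D"
  using assms
proof induction
  case (linear f)
  then interpret bounded_linear f .
  have "complex_of_real (f x) = (\<Sum>i\<in>UNIV. of_real (f (axis i 1)) * cmonom (\<lambda>j. if j = i then 1 else 0) x)" for x
  proof -
    have "f x = f (\<Sum>i\<in>UNIV. x $ i *\<^sub>R axis i 1)"
      using basis_expansion[of x] by (simp add: scalar_mult_eq_scaleR)
    then have "f x = (\<Sum>i\<in>UNIV. f (axis i 1) * x $ i)"
      by (simp add: sum scaleR mult.commute)
    then show ?thesis
      by (simp add: cmonom_unit)
  qed
  then have eq: "(\<lambda>x. complex_of_real (f x)) =
      (\<lambda>x. \<Sum>i\<in>UNIV. of_real (f (axis i 1)) * cmonom (\<lambda>j. if j = i then 1 else 0) x)"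
    by (rule ext)
  have "(\<lambda>x. complex_of_real (f x)) \<in> poly_space 1"
    unfolding eq by (intro poly_space_sum poly_space_cmult cmonom_in_poly_space) (auto simp: exponents_def)
  then show ?case ..
next
  case (const c)
  show ?case using poly_space_const by blast
next
  case (add f g)
  then obtain D E where "(\<lambda>x. complex_of_real (f x)) \<in> poly_space D" "(\<lambda>x. complex_of_real (g x)) \<in> poly_space E"
    by blast
  then have "(\<lambda>x. complex_of_real (f x) + complex_of_real (g x)) \<in> poly_space (max D E)"
    by (intro poly_space_add) (auto intro: poly_space_mono)
  then show ?case
    by auto
next
  case (mult f g)
  then obtain D E where "(\<lambda>x. complex_of_real (f x)) \<in> poly_space D" "(\<lambda>x. complex_of_real (g x)) \<in> poly_space E"
    by blast
  then have "(\<lambda>x. complex_of_real (f x) * complex_of_real (g x)) \<in> poly_space (D + E)"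
    by (rule poly_space_mult)
  then show ?case
    by auto
qed

text \<open>Split into real and imaginary parts because primality of \<open>V\<close> and the
  calculus of gradients are available for real polynomials.\<close>

definition complex_polynomial :: "('a::real_normed_vector \<Rightarrow> complex) \<Rightarrow> bool" where
  "complex_polynomial F \<longleftrightarrow>
     real_polynomial_function (\<lambda>x. Re (F x)) \<and> real_polynomial_function (\<lambda>x. Im (F x))"

lemma complex_polynomial_of_real:
  "real_polynomial_function f \<Longrightarrow> complex_polynomial (\<lambda>x. complex_of_real (f x))"
  by (simp add: complex_polynomial_def real_polynomial_function.intros(2))

lemma complex_polynomial_const: "complex_polynomial (\<lambda>_. a)"
  by (simp add: complex_polynomial_def real_polynomial_function.intros(2))

lemma complex_polynomial_add:
  "complex_polynomial F \<Longrightarrow> complex_polynomial G \<Longrightarrow> complex_polynomial (\<lambda>x. F x + G x)"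
  by (simp add: complex_polynomial_def real_polynomial_function.intros(3))

lemma complex_polynomial_mult:
  "complex_polynomial F \<Longrightarrow> complex_polynomial G \<Longrightarrow> complex_polynomial (\<lambda>x. F x * G x)"
  by (simp add: complex_polynomial_def real_polynomial_function.intros(3,4) real_polynomial_function_diff)

lemma complex_polynomial_sum:
  "finite A \<Longrightarrow> (\<And>a. a \<in> A \<Longrightarrow> complex_polynomial (F a)) \<Longrightarrow> complex_polynomial (\<lambda>x. \<Sum>a\<in>A. F a x)"
  by (induction rule: finite_induct) (auto intro: complex_polynomial_const complex_polynomial_add)

lemma complex_polynomial_prod:
  "finite A \<Longrightarrow> (\<And>a. a \<in> A \<Longrightarrow> complex_polynomial (F a)) \<Longrightarrow> complex_polynomial (\<lambda>x. \<Prod>a\<in>A. F a x)"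
  by (induction rule: finite_induct) (auto intro: complex_polynomial_const complex_polynomial_mult)

lemma complex_polynomial_power: "complex_polynomial F \<Longrightarrow> complex_polynomial (\<lambda>x. F x ^ k)"
  by (induction k) (auto intro: complex_polynomial_const complex_polynomial_mult)

lemma continuous_on_complex_polynomial:
  assumes "complex_polynomial F" shows "continuous_on S F"
proof -
  have "continuous_on S (\<lambda>x. complex_of_real (Re (F x)) + \<i> * complex_of_real (Im (F x)))"
    using assms unfolding complex_polynomial_def
    by (intro continuous_on_add continuous_on_mult continuous_on_const continuous_on_of_real)
      (simp_all add: continuous_on_polymonial_function real_polynomial_function_eq)
  then show ?thesis
    by (simp flip: complex_eq)
qed

lemma complex_polynomial_in_poly_space:
  fixes F :: "real ^ 'n \<Rightarrow> complex"
  assumes "complex_polynomial F"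
  shows "\<exists>D. F \<in> poly_space D"
proof -
  obtain D E where "(\<lambda>x. complex_of_real (Re (F x))) \<in> poly_space D"
    "(\<lambda>x. complex_of_real (Im (F x))) \<in> poly_space E"
    using assms real_polynomial_in_poly_space unfolding complex_polynomial_def by metis
  then have "(\<lambda>x. complex_of_real (Re (F x)) + \<i> * complex_of_real (Im (F x))) \<in> poly_space (max D E)"
    by (intro poly_space_add poly_space_cmult) (auto intro: poly_space_mono)
  then show ?thesis
    by (auto simp flip: complex_eq)
qed

section \<open>Gradients, linear differential equations and local inverses\<close>

definition grad :: "(real ^ 'n \<Rightarrow> real) \<Rightarrow> real ^ 'n \<Rightarrow> real ^ 'n" where
  "grad f x = (\<chi> i. frechet_derivative f (at x) (axis i 1))"

lemma grad_eqI:
  fixes f :: "real ^ 'n \<Rightarrow> real"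
  assumes "(f has_derivative (\<lambda>v. g \<bullet> v)) (at x)"
  shows "grad f x = g"
proof -
  have "frechet_derivative f (at x) = (\<lambda>v. g \<bullet> v)"
    using frechet_derivative_at[OF assms] by simp
  then show ?thesis
    by (simp add: grad_def vec_eq_iff inner_axis)
qed

text \<open>Both conclusions go through the induction together. That the components are polynomials
  is what makes minors of Jacobian matrices polynomials, to which primality and the generators of
  the ideal apply.\<close>

lemma real_polynomial_gradient_exists:
  fixes f :: "real ^ 'n \<Rightarrow> real"
  assumes "real_polynomial_function f"
  shows "\<exists>g. (\<forall>i. real_polynomial_function (\<lambda>x. g x $ i)) \<and>
             (\<forall>x. (f has_derivative (\<lambda>v. g x \<bullet> v)) (at x))"
  using assms
proof induction
  case (linear f)
  then interpret bounded_linear f .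
  have "f v = (\<chi> i. f (axis i 1)) \<bullet> v" for v
  proof -
    have "f v = f (\<Sum>i\<in>UNIV. v $ i *\<^sub>R axis i 1)"
      using basis_expansion[of v] by (simp add: scalar_mult_eq_scaleR)
    then show ?thesis
      by (simp add: sum scaleR inner_vec_def mult.commute)
  qed
  then have "f = (\<lambda>v. (\<chi> i. f (axis i 1)) \<bullet> v)"
    by (rule ext)
  then have "(f has_derivative (\<lambda>v. (\<chi> i. f (axis i 1)) \<bullet> v)) (at x)" for x
    using has_derivative[OF has_derivative_ident, of "at x"] by simp
  then show ?case
    by (intro exI[of _ "\<lambda>_. \<chi> i. f (axis i 1)"]) auto
next
  case (const c)
  show ?case
    by (intro exI[of _ "\<lambda>_. 0"]) auto
next
  case (add f1 f2)
  then obtain g1 g2 where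
    g: "\<forall>i. real_polynomial_function (\<lambda>x. g1 x $ i)" "\<forall>x. (f1 has_derivative (\<lambda>v. g1 x \<bullet> v)) (at x)"
       "\<forall>i. real_polynomial_function (\<lambda>x. g2 x $ i)" "\<forall>x. (f2 has_derivative (\<lambda>v. g2 x \<bullet> v)) (at x)"
    by blast
  then show ?case
    by (intro exI[of _ "\<lambda>x. g1 x + g2 x"]) (auto simp: inner_add_left intro!: has_derivative_add)
next
  case (mult f1 f2)
  then obtain g1 g2 where
    g: "\<forall>i. real_polynomial_function (\<lambda>x. g1 x $ i)" "\<forall>x. (f1 has_derivative (\<lambda>v. g1 x \<bullet> v)) (at x)"
       "\<forall>i. real_polynomial_function (\<lambda>x. g2 x $ i)" "\<forall>x. (f2 has_derivative (\<lambda>v. g2 x \<bullet> v)) (at x)"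
    by blast
  have "((\<lambda>x. f1 x * f2 x) has_derivative (\<lambda>v. (f1 x *\<^sub>R g2 x + f2 x *\<^sub>R g1 x) \<bullet> v)) (at x)" for x
  proof -
    have "((\<lambda>x. f1 x * f2 x) has_derivative (\<lambda>v. f1 x * (g2 x \<bullet> v) + (g1 x \<bullet> v) * f2 x)) (at x)"
      using g by (intro has_derivative_mult) auto
    then show ?thesis
      by (simp add: inner_add_left mult.commute)
  qed
  moreover have "real_polynomial_function (\<lambda>x. (f1 x *\<^sub>R g2 x + f2 x *\<^sub>R g1 x) $ i)" for i
    using g mult.hyps by (simp add: real_polynomial_function.intros(3,4))
  ultimately show ?case
    by (intro exI[of _ "\<lambda>x. f1 x *\<^sub>R g2 x + f2 x *\<^sub>R g1 x"]) auto
qed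

lemma has_derivative_grad:
  fixes f :: "real ^ 'n \<Rightarrow> real"
  assumes "real_polynomial_function f"
  shows "(f has_derivative (\<lambda>v. grad f x \<bullet> v)) (at x)"
  using real_polynomial_gradient_exists[OF assms] grad_eqI by metis

lemma real_polynomial_grad_component:
  fixes f :: "real ^ 'n \<Rightarrow> real"
  assumes "real_polynomial_function f"
  shows "real_polynomial_function (\<lambda>x. grad f x $ i)"
proof -
  obtain g where g: "\<forall>i. real_polynomial_function (\<lambda>x. g x $ i)"
    "\<forall>x. (f has_derivative (\<lambda>v. g x \<bullet> v)) (at x)"
    using real_polynomial_gradient_exists[OF assms] by blast
  then have "grad f = g"
    using grad_eqI by blast
  with g show ?thesis
    by simp
qed

lemma continuous_on_real_polynomial:
  "real_polynomial_function f \<Longrightarrow> continuous_on S f"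
  by (simp add: continuous_on_polymonial_function real_polynomial_function_eq)

lemma grad_add:
  "real_polynomial_function f \<Longrightarrow> real_polynomial_function g \<Longrightarrow>
    grad (\<lambda>x. f x + g x) x = grad f x + grad g x"
  by (rule grad_eqI) (auto simp: inner_add_left intro!: has_derivative_add has_derivative_grad)

lemma grad_cmult: "real_polynomial_function f \<Longrightarrow> grad (\<lambda>x. a * f x) x = a *\<^sub>R grad f x"
  by (rule grad_eqI) (auto intro!: has_derivative_mult_right has_derivative_grad)

lemma real_polynomial_affine: "real_polynomial_function (\<lambda>x. b \<bullet> x + a)"
  by (intro real_polynomial_function.intros bounded_linear_inner_right)

lemma grad_affine: "grad (\<lambda>x. b \<bullet> x + a) x = b"
  by (rule grad_eqI) (auto intro!: derivative_eq_intros)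

lemma real_polynomial_det:
  fixes A :: "'a::real_normed_vector \<Rightarrow> real ^ 'n ^ 'n"
  assumes "\<And>i j. real_polynomial_function (\<lambda>x. A x $ i $ j)"
  shows "real_polynomial_function (\<lambda>x. det (A x))"
  unfolding det_def
  by (intro real_polynomial_function_sum real_polynomial_function.intros(2,4) real_polynomial_function_prod
      assms) (auto simp: finite_permutations)

text \<open>Gronwall's inequality for the sum of squares of the solution.\<close>

lemma linear_ode_unique_zero:
  fixes q :: "'k \<Rightarrow> real \<Rightarrow> real"
  assumes "finite K"
    and deriv: "\<And>k t. k \<in> K \<Longrightarrow> t \<in> {0..1} \<Longrightarrow>
      (q k has_real_derivative (\<Sum>h\<in>K. m k h t * q h t)) (at t)"
    and cont: "\<And>k h. k \<in> K \<Longrightarrow> h \<in> K \<Longrightarrow> continuous_on {0..1} (m k h)"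
    and init: "\<And>k. k \<in> K \<Longrightarrow> q k 0 = 0"
    and "k \<in> K" "t \<in> {0..1}"
  shows "q k t = 0"
proof -
  have "\<exists>B. \<forall>s\<in>{0..1}. \<bar>m k h s\<bar> \<le> B" if "k \<in> K" "h \<in> K" for k h
    using compact_imp_bounded[OF compact_continuous_image[OF cont[OF that]]]
    by (auto simp: bounded_iff)
  then obtain B where B: "\<And>k h s. k \<in> K \<Longrightarrow> h \<in> K \<Longrightarrow> s \<in> {0..1} \<Longrightarrow> \<bar>m k h s\<bar> \<le> B k h"
    by metis
  define C where "C = (\<Sum>k\<in>K. \<Sum>h\<in>K. B k h)"
  have B0: "0 \<le> B k h" if "k \<in> K" "h \<in> K" for k h
    using B[OF that, of 0] by auto
  have C: "\<bar>m k h s\<bar> \<le> C" if "k \<in> K" "h \<in> K" "s \<in> {0..1}" for k h s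
  proof -
    have "\<bar>m k h s\<bar> \<le> B k h"
      by (rule B[OF that])
    also have "\<dots> \<le> (\<Sum>h\<in>K. B k h)"
      using that B0 \<open>finite K\<close> by (intro member_le_sum) auto
    also have "\<dots> \<le> C"
      unfolding C_def using that B0 \<open>finite K\<close>
      by (intro member_le_sum[of k K "\<lambda>k. \<Sum>h\<in>K. B k h"] sum_nonneg) auto
    finally show ?thesis .
  qed
  have C0: "0 \<le> C"
    unfolding C_def by (intro sum_nonneg B0)
  define u where "u s = (\<Sum>k\<in>K. (q k s)\<^sup>2)" for s
  \<comment> \<open>In the estimate of this derivative each pair \<open>k\<close>, \<open>h\<close>
    contributes at most \<open>C * ((q k s)\<^sup>2 + (q h s)\<^sup>2)\<close>; summing over all
    pairs counts every square \<open>2 * card K\<close> times, whence the constant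
    \<open>L\<close>.\<close>
  define u' where "u' s = (\<Sum>k\<in>K. 2 * q k s * (\<Sum>h\<in>K. m k h s * q h s))" for s
  define L where "L = 2 * C * card K"
  have u': "(u has_real_derivative u' s) (at s)" if "s \<in> {0..1}" for s
    unfolding u_def u'_def
    by (auto intro!: derivative_eq_intros deriv that sum.cong simp: power2_eq_square)
  have u'_le: "u' s \<le> L * u s" if "s \<in> {0..1}" for s
  proof -
    have "u' s = (\<Sum>k\<in>K. \<Sum>h\<in>K. 2 * q k s * (m k h s * q h s))"
      by (simp add: u'_def sum_distrib_left)
    also have "\<dots> \<le> (\<Sum>k\<in>K. \<Sum>h\<in>K. C * ((q k s)\<^sup>2 + (q h s)\<^sup>2))"
    proof (intro sum_mono)
      fix k h assume kh: "k \<in> K" "h \<in> K"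
      have "2 * q k s * (m k h s * q h s) \<le> \<bar>2 * q k s * (m k h s * q h s)\<bar>"
        by (rule abs_ge_self)
      also have "\<dots> = \<bar>m k h s\<bar> * (2 * \<bar>q k s\<bar> * \<bar>q h s\<bar>)"
        by (simp add: abs_mult mult_ac)
      also have "\<dots> \<le> C * ((q k s)\<^sup>2 + (q h s)\<^sup>2)"
        using C[OF kh that] C0 sum_squares_bound[of "\<bar>q k s\<bar>" "\<bar>q h s\<bar>"]
        by (intro mult_mono) auto
      finally show "2 * q k s * (m k h s * q h s) \<le> C * ((q k s)\<^sup>2 + (q h s)\<^sup>2)" .
    qed
    also have "\<dots> = L * u s"
      by (simp add: L_def u_def sum.distrib algebra_simps flip: sum_distrib_left)
    finally show ?thesis .
  qed
  define v where "v s = u s * exp (- L * s)" for s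
  have v': "(v has_real_derivative (u' s - L * u s) * exp (- L * s)) (at s)" if "s \<in> {0..1}" for s
    unfolding v_def by (rule derivative_eq_intros u' that refl)+ (simp add: algebra_simps)
  have "v t \<le> v 0"
  proof (rule DERIV_nonpos_imp_decreasing_open[where f = v and a = 0 and b = t])
    show "continuous_on {0..t} v"
      using \<open>t \<in> {0..1}\<close>
      by (intro continuous_at_imp_continuous_on ballI DERIV_isCont[OF v']) auto
    show "\<exists>y. (v has_real_derivative y) (at x) \<and> y \<le> 0" if "0 < x" "x < t" for x
      using v'[of x] u'_le[of x] that \<open>t \<in> {0..1}\<close>
      by (intro exI[of _ "(u' x - L * u x) * exp (- L * x)"]) (auto simp: mult_nonpos_nonneg)
  qed (use \<open>t \<in> {0..1}\<close> in auto)
  also have "v 0 = 0"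
    by (simp add: v_def u_def init)
  finally have "u t \<le> 0"
    by (simp add: v_def mult_le_0_iff)
  then have "u t = 0"
    by (intro antisym) (simp_all add: u_def sum_nonneg)
  then show ?thesis
    using \<open>finite K\<close> \<open>k \<in> K\<close> by (simp add: u_def sum_nonneg_eq_0_iff)
qed

section \<open>Frames of row vectors and Cramer's rule\<close>

lemma row_vec_lambda: "row i (\<chi> i. r i) = r i"
  by (simp add: row_def vec_eq_iff)

lemma independent_rows_det_nonzero:
  fixes r :: "'n \<Rightarrow> real ^ 'n"
  assumes "inj r" "independent (range r)"
  shows "det (\<chi> i. r i) \<noteq> 0"
proof -
  have "\<forall>i. c i = 0" if "(\<Sum>i\<in>UNIV. c i *s r i) = 0" for c
  proof -
    have "(\<Sum>v\<in>range r. c (the_inv r v) *\<^sub>R v) = 0"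
      using that by (simp add: sum.reindex[OF assms(1)] the_inv_f_f[OF assms(1)] scalar_mult_eq_scaleR)
    then have "\<forall>v\<in>range r. c (the_inv r v) = 0"
      using assms(2) unfolding independent_explicit
      by (elim conjE allE[of _ "\<lambda>v. c (the_inv r v)"]) simp
    then show ?thesis
      by (simp add: the_inv_f_f[OF assms(1)])
  qed
  then have "\<exists>B. (\<chi> i. r i) ** B = mat 1"
    unfolding matrix_right_invertible_independent_rows row_vec_lambda by blast
  then show ?thesis
    using invertible_det_nz invertible_right_inverse by blast
qed

lemma det_nonzero_independent_rows:
  fixes r :: "'n \<Rightarrow> real ^ 'n"
  assumes "det (\<chi> i. r i) \<noteq> 0"
  shows "inj r" "independent (range r)"
proof -
  show "inj r"
    using assms det_identical_rows[of _ _ "\<chi> i. r i"] by (auto simp: inj_def row_vec_lambda)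
  have "rows (\<chi> i. r i) = range r"
    by (auto simp: rows_def row_vec_lambda)
  then show "independent (range r)"
    using assms det_dependent_rows[of "\<chi> i. r i"] by (auto simp: dependent_vec_eq)
qed

text \<open>A basis of \<open>S\<close> is completed to a basis of the whole space and enumerated by
  the coordinate type, so that it forms the rows of a square matrix. \<open>J\<close> marks the rows
  taken from \<open>S\<close>.\<close>

lemma extend_to_frame:
  fixes S :: "(real ^ 'n) set"
  obtains r J where "card J = dim S" "\<And>i. i \<in> J \<Longrightarrow> r i \<in> S" "det (\<chi> i::'n. r i) \<noteq> 0"
proof -
  obtain B where B: "B \<subseteq> S" "independent B" "card B = dim S"
    by (rule basis_exists)
  obtain C where C: "B \<subseteq> C" "independent C" "UNIV \<subseteq> span C"
    by (rule maximal_independent_subset_extend[OF subset_UNIV B(2)])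
  have "card C = CARD('n)"
    using C(2,3) dim_eq_card[of C UNIV] by (simp add: top.extremum_unique)
  then obtain r where r: "bij_betw r (UNIV :: 'n set) C"
    using finite_same_card_bij[of "UNIV :: 'n set" C] independent_imp_finite[OF C(2)] by auto
  have inj: "inj r" and range: "range r = C"
    using r by (auto simp: bij_betw_def)
  have "card (r -` B) = card B"
    using C(1) range by (intro card_vimage_inj inj) auto
  then show ?thesis
    using B independent_rows_det_nonzero[OF inj] C(2) range
    by (intro that[of "r -` B" r]) auto
qed

text \<open>Cramer's rule for the coefficients of \<open>g\<close> in the basis \<open>r\<close>.
  When all the vectors are gradients of polynomials, the coefficients become quotients of
  polynomials.\<close>

lemma inner_eq_sum_det_replace_row:
  fixes r :: "'n \<Rightarrow> real ^ 'n"
  assumes "det (\<chi> i. r i) \<noteq> 0"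
  shows "g \<bullet> v = (\<Sum>l\<in>UNIV. (r l \<bullet> v) * (det (\<chi> i. if i = l then g else r i) / det (\<chi> i. r i)))"
proof -
  define A :: "real ^ 'n ^ 'n" where "A = (\<chi> i. r i)"
  have A: "det A \<noteq> 0" "\<And>i. row i A = r i"
    using assms by (simp_all add: A_def row_vec_lambda)
  obtain B where B: "A ** B = mat 1" "B ** A = mat 1"
    using A(1) unfolding invertible_det_nz[symmetric] invertible_def by blast
  define \<kappa> where "\<kappa> = transpose B *v g"
  have "transpose A *v \<kappa> = g"
    by (simp add: \<kappa>_def vector_matrix_mul_assoc B)
  then have g: "g = (\<Sum>i\<in>UNIV. \<kappa> $ i *s r i)"
    unfolding matrix_mult_sum by (simp add: A)
  have \<kappa>: "det (\<chi> i. if i = l then g else r i) = \<kappa> $ l * det A" for l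
    using cramer_lemma_transpose[of l \<kappa> A] unfolding A g[symmetric] .
  have "g \<bullet> v = (\<Sum>i\<in>UNIV. \<kappa> $ i * (r i \<bullet> v))"
    by (subst g) (simp add: inner_sum_left scalar_mult_eq_scaleR)
  then show ?thesis
    using A(1) by (simp add: \<kappa> A_def[symmetric] mult.commute)
qed

section \<open>Jacobian matrices and local inverses\<close>

definition jac :: "('n \<Rightarrow> real ^ 'n \<Rightarrow> real) \<Rightarrow> real ^ 'n \<Rightarrow> real ^ 'n ^ 'n" where
  "jac \<phi> x = (\<chi> i. grad (\<phi> i) x)"

lemma jac_mult_component: "(jac \<phi> x *v v) $ i = grad (\<phi> i) x \<bullet> v"
  by (simp add: jac_def matrix_vector_mul_component)

lemma real_polynomial_jac_det:
  assumes "\<And>i. real_polynomial_function (\<phi> i)"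
  shows "real_polynomial_function (\<lambda>x. det (jac \<phi> x))"
  by (intro real_polynomial_det) (simp add: jac_def assms real_polynomial_grad_component)

text \<open>The inverse function theorem. The statements about the derivative hold on all of
  \<open>W\<close>, since rays inside \<open>W\<close> are followed later.\<close>

lemma polynomial_map_local_inverse:
  fixes \<phi> :: "'n \<Rightarrow> real ^ 'n \<Rightarrow> real"
  assumes poly: "\<And>i. real_polynomial_function (\<phi> i)"
    and det: "det (jac \<phi> x) \<noteq> 0"
  obtains U W \<psi> \<psi>' where "open U" "x \<in> U" "open W" "(\<chi> i. \<phi> i x) \<in> W"
    "homeomorphism U W (\<lambda>y. \<chi> i. \<phi> i y) \<psi>"
    "\<And>w. w \<in> W \<Longrightarrow> det (jac \<phi> (\<psi> w)) \<noteq> 0"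
    "\<And>w. w \<in> W \<Longrightarrow> (\<psi> has_derivative \<psi>' w) (at w)"
    "\<And>w v. w \<in> W \<Longrightarrow> jac \<phi> (\<psi> w) *v \<psi>' w v = v"
proof -
  define \<Phi> where "\<Phi> = (\<lambda>y. \<chi> i. \<phi> i y)"
  define \<Phi>' where "\<Phi>' y = Blinfun ((*v) (jac \<phi> y))" for y
  have [simp]: "blinfun_apply (\<Phi>' y) = (*v) (jac \<phi> y)" for y
    unfolding \<Phi>'_def by (intro bounded_linear_Blinfun_apply matrix_vector_mul_bounded_linear)
  have deriv: "(\<Phi> has_derivative blinfun_apply (\<Phi>' y)) (at y)" for y
  proof -
    have "((\<lambda>y. \<chi> i. \<phi> i y) has_derivative (\<lambda>v. \<chi> i. grad (\<phi> i) y \<bullet> v)) (at y)"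
      unfolding has_derivative_componentwise_within[of "\<lambda>y. \<chi> i. \<phi> i y"]
      by (auto simp: Basis_vec_def inner_axis intro: has_derivative_grad poly)
    moreover have "(\<lambda>v. \<chi> i. grad (\<phi> i) y \<bullet> v) = (*v) (jac \<phi> y)"
      by (intro ext) (simp add: vec_eq_iff jac_mult_component)
    ultimately show ?thesis
      by (simp add: \<Phi>_def)
  qed
  have cont: "continuous_on UNIV \<Phi>'"
  proof (rule continuous_on_blinfun_componentwise)
    fix v :: "real ^ 'n"
    have "jac \<phi> y *v v = (\<chi> i. \<Sum>j\<in>UNIV. grad (\<phi> i) y $ j * v $ j)" for y
      by (simp add: vec_eq_iff jac_mult_component inner_vec_def)
    then show "continuous_on UNIV (\<lambda>y. blinfun_apply (\<Phi>' y) v)"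
      by simp (intro continuous_on_vec_lambda continuous_on_sum continuous_on_mult continuous_on_const
          continuous_on_real_polynomial real_polynomial_grad_component poly)
  qed
  obtain B where B: "B ** jac \<phi> x = mat 1"
    using det unfolding invertible_det_nz[symmetric] invertible_def by blast
  define invf where "invf = Blinfun ((*v) B)"
  have [simp]: "blinfun_apply invf = (*v) B"
    unfolding invf_def by (intro bounded_linear_Blinfun_apply matrix_vector_mul_bounded_linear)
  have "invf o\<^sub>L \<Phi>' x = id_blinfun"
    by (intro blinfun_eqI) (simp add: matrix_vector_mul_assoc B)
  from inverse_function_theorem[OF open_UNIV deriv cont UNIV_I this]
  obtain U W \<psi> \<psi>' where UW: "open U" "x \<in> U" "open W" "\<Phi> x \<in> W" "homeomorphism U W \<Phi> \<psi>"
    and \<psi>: "\<And>w. w \<in> W \<Longrightarrow> (\<psi> has_derivative (\<psi>' w)) (at w)"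
    "\<And>w. w \<in> W \<Longrightarrow> \<psi>' w = inv (blinfun_apply (\<Phi>' (\<psi> w)))"
    "\<And>w. w \<in> W \<Longrightarrow> bij (blinfun_apply (\<Phi>' (\<psi> w)))"
    by metis
  have "det (jac \<phi> (\<psi> w)) \<noteq> 0" if "w \<in> W" for w
    using \<psi>(3)[OF that] by (simp add: invertible_eq_bij flip: invertible_det_nz)
  moreover have "jac \<phi> (\<psi> w) *v \<psi>' w v = v" if "w \<in> W" for w v
    using \<psi>(2,3)[OF that] by (simp add: bij_is_surj surj_f_inv_f)
  ultimately show ?thesis
    using UW \<psi>(1) unfolding \<Phi>_def by (intro that[of U W \<psi> \<psi>'])
qed

section \<open>Regular points of a real zero set\<close>

lemma has_real_derivative_along_ray:
  fixes f :: "real ^ 'n \<Rightarrow> real"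
  assumes "real_polynomial_function f" "(\<psi> has_derivative \<psi>') (at (t *\<^sub>R w))"
  shows "((\<lambda>t. f (\<psi> (t *\<^sub>R w))) has_real_derivative grad f (\<psi> (t *\<^sub>R w)) \<bullet> \<psi>' w) (at t)"
proof -
  have "((\<lambda>t. t *\<^sub>R w) has_derivative (\<lambda>s. s *\<^sub>R w)) (at t)"
    by (intro derivative_eq_intros) auto
  from has_derivative_compose[OF this assms(2)]
  have "((\<lambda>t. \<psi> (t *\<^sub>R w)) has_derivative (\<lambda>s. \<psi>' (s *\<^sub>R w))) (at t)" .
  from has_derivative_compose[OF this has_derivative_grad[OF assms(1)]]
  have "((\<lambda>t. f (\<psi> (t *\<^sub>R w))) has_derivative (\<lambda>s. grad f (\<psi> (t *\<^sub>R w)) \<bullet> \<psi>' (s *\<^sub>R w))) (at t)" .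
  moreover have "\<psi>' (s *\<^sub>R w) = s *\<^sub>R \<psi>' w" for s
    by (rule linear_scale[OF has_derivative_linear[OF assms(2)]])
  ultimately show ?thesis
    by (simp add: has_field_derivative_def mult.commute[of _ "_ \<bullet> _"])
qed

text \<open>The real form of an irreducible variety: \<open>gen\<close> says that the \<gamma>
  generate the ideal of real polynomials vanishing on \<open>V\<close>, and \<open>prime\<close>
  that this ideal is prime.\<close>

locale zero_locus =
  fixes V :: "(real ^ 'n) set" and K :: "'k set" and \<gamma> :: "'k \<Rightarrow> real ^ 'n \<Rightarrow> real"
  assumes nonempty: "V \<noteq> {}"
    and finite_K: "finite K"
    and poly_\<gamma>: "\<And>k. k \<in> K \<Longrightarrow> real_polynomial_function (\<gamma> k)"
    and V_eq: "V = {x. \<forall>k\<in>K. \<gamma> k x = 0}"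
    and gen: "\<And>f. real_polynomial_function f \<Longrightarrow> (\<And>x. x \<in> V \<Longrightarrow> f x = 0) \<Longrightarrow>
      \<exists>a. (\<forall>k\<in>K. real_polynomial_function (a k)) \<and> (\<forall>x. f x = (\<Sum>k\<in>K. a k x * \<gamma> k x))"
    and prime: "\<And>f g. real_polynomial_function f \<Longrightarrow> real_polynomial_function g \<Longrightarrow>
      (\<And>x. x \<in> V \<Longrightarrow> f x * g x = 0) \<Longrightarrow> (\<forall>x\<in>V. f x = 0) \<or> (\<forall>x\<in>V. g x = 0)"
begin

definition vanishing :: "(real ^ 'n \<Rightarrow> real) set" where
  "vanishing = {f. real_polynomial_function f \<and> (\<forall>x\<in>V. f x = 0)}"

definition conormal :: "real ^ 'n \<Rightarrow> (real ^ 'n) set" where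
  "conormal x = {grad f x | f. f \<in> vanishing}"

definition tangent :: "real ^ 'n \<Rightarrow> (real ^ 'n) set" where
  "tangent x = {v. \<forall>f\<in>vanishing. grad f x \<bullet> v = 0}"

text \<open>The maximum is taken over the real points of \<open>V\<close> and real vanishing
  polynomials, so that it is attained at a point around which real charts exist.\<close>

definition codim :: nat where
  "codim = Max ((\<lambda>x. dim (conormal x)) ` V)"

definition regular :: "real ^ 'n \<Rightarrow> bool" where
  "regular x \<longleftrightarrow> x \<in> V \<and> dim (conormal x) = codim"

lemma \<gamma>_vanishing: "k \<in> K \<Longrightarrow> \<gamma> k \<in> vanishing"
  using poly_\<gamma> unfolding vanishing_def by (auto simp: V_eq[THEN eqset_imp_iff])

lemma subspace_conormal: "subspace (conormal x)"
proof (rule subspaceI)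
  have "(\<lambda>_. 0) \<in> vanishing"
    by (simp add: vanishing_def real_polynomial_function.intros(2))
  moreover have "grad (\<lambda>_. 0) x = 0"
    by (rule grad_eqI) simp
  ultimately show "0 \<in> conormal x"
    by (force simp: conormal_def)
next
  fix a b assume "a \<in> conormal x" "b \<in> conormal x"
  then obtain f g where fg: "f \<in> vanishing" "g \<in> vanishing" "a = grad f x" "b = grad g x"
    by (auto simp: conormal_def)
  then have "(\<lambda>x. f x + g x) \<in> vanishing"
    by (auto simp: vanishing_def intro: real_polynomial_function.intros(3))
  moreover have "a + b = grad (\<lambda>x. f x + g x) x"
    using fg by (simp add: grad_add vanishing_def)
  ultimately show "a + b \<in> conormal x"
    unfolding conormal_def by blast
next
  fix c a assume "a \<in> conormal x"
  then obtain f where f: "f \<in> vanishing" "a = grad f x"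
    by (auto simp: conormal_def)
  then have "(\<lambda>x. c * f x) \<in> vanishing"
    by (auto simp: vanishing_def intro: real_polynomial_function.intros)
  moreover have "c *\<^sub>R a = grad (\<lambda>x. c * f x) x"
    using f by (simp add: grad_cmult vanishing_def)
  ultimately show "c *\<^sub>R a \<in> conormal x"
    unfolding conormal_def by blast
qed

lemma finite_dim_conormal: "finite ((\<lambda>x. dim (conormal x)) ` V)"
  by (rule finite_subset[of _ "{..CARD('n)}"]) (use dim_subset_UNIV_cart_gen in \<open>auto simp: dim_subset_UNIV_cart\<close>)

lemma dim_conormal_le: "x \<in> V \<Longrightarrow> dim (conormal x) \<le> codim"
  unfolding codim_def by (intro Max_ge finite_dim_conormal) auto

lemma exists_regular: "\<exists>x. regular x"
proof -
  have "codim \<in> (\<lambda>x. dim (conormal x)) ` V"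
    unfolding codim_def by (intro Max_in finite_dim_conormal) (use nonempty in auto)
  then show ?thesis
    by (auto simp: regular_def)
qed

lemma dim_tangent: "regular x \<Longrightarrow> dim (tangent x) + codim = CARD('n)"
proof -
  assume "regular x"
  have "tangent x = {y \<in> UNIV. \<forall>z\<in>conormal x. orthogonal z y}"
    by (auto simp: tangent_def conormal_def orthogonal_def)
  then have "dim (tangent x) + dim (conormal x) = dim (UNIV :: (real ^ 'n) set)"
    using dim_subspace_orthogonal_to_vectors[OF subspace_conormal subspace_UNIV subset_UNIV, of x] by simp
  then show ?thesis
    using \<open>regular x\<close> by (simp add: regular_def)
qed

text \<open>Coordinates adapted to \<open>V\<close>: those in \<open>J\<close> are vanishing
  polynomials whose gradients form a basis of the conormal space, and the others are affine
  functions completing them, normalized to be zero at \<open>x\<close>.\<close>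

lemma frame:
  assumes "regular x"
  obtains J \<phi> where "card J = codim" "\<And>i::'n. real_polynomial_function (\<phi> i)"
    "\<And>i. i \<in> J \<Longrightarrow> \<phi> i \<in> vanishing" "\<And>i. \<phi> i x = 0" "det (jac \<phi> x) \<noteq> 0"
proof -
  obtain r J where r: "card J = dim (conormal x)" "\<And>i::'n. i \<in> J \<Longrightarrow> r i \<in> conormal x"
    "det (\<chi> i. r i) \<noteq> 0"
    by (rule extend_to_frame[of "conormal x"]) (rule that; assumption)
  have "\<forall>i\<in>J. \<exists>f. f \<in> vanishing \<and> r i = grad f x"
    using r(2) unfolding conormal_def by blast
  then obtain f where f: "\<forall>i\<in>J. f i \<in> vanishing \<and> r i = grad (f i) x"
    by metis
  define \<phi> where "\<phi> i = (if i \<in> J then f i else (\<lambda>y. r i \<bullet> y + - (r i \<bullet> x)))" for i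
  have "grad (\<phi> i) x = r i" for i
    using f by (simp add: \<phi>_def grad_affine del: add_uminus_conv_diff)
  then have "jac \<phi> x = (\<chi> i. r i)"
    by (simp add: jac_def)
  moreover have "real_polynomial_function (\<phi> i)" for i
    using f real_polynomial_affine[of "r i" "- (r i \<bullet> x)"] unfolding \<phi>_def vanishing_def by simp
  moreover have "\<phi> i x = 0" for i
    using f \<open>regular x\<close> by (auto simp: \<phi>_def vanishing_def regular_def)
  moreover have "\<phi> i \<in> vanishing" if "i \<in> J" for i
    using f that by (simp add: \<phi>_def)
  ultimately show ?thesis
    using r \<open>regular x\<close> by (intro that[of J \<phi>]) (auto simp: regular_def)
qed

text \<open>Otherwise the rows in \<open>J\<close> and the row \<open>l\<close> would be
  \<open>codim + 1\<close> independent conormal vectors at a point of \<open>V\<close>, against the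
  maximality of \<open>codim\<close>.\<close>

lemma det_replace_row_eq_0:
  assumes "y \<in> V" "card J = codim" "\<And>i::'n. i \<in> J \<Longrightarrow> \<phi> i \<in> vanishing" "g \<in> vanishing" "l \<notin> J"
  shows "det (\<chi> i. if i = l then grad g y else grad (\<phi> i) y) = 0"
proof (rule ccontr)
  define r where "r i = (if i = l then grad g y else grad (\<phi> i) y)" for i
  assume "det (\<chi> i. if i = l then grad g y else grad (\<phi> i) y) \<noteq> 0"
  then have r: "inj r" "independent (range r)"
    using det_nonzero_independent_rows[of r] by (simp_all add: r_def)
  have "inj_on r (insert l J)"
    by (rule inj_on_subset[OF r(1)]) auto
  then have "card (r ` insert l J) = codim + 1"
    using assms by (simp add: card_image del: image_insert)
  moreover have "independent (r ` insert l J)"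
    by (rule independent_mono[OF r(2)]) auto
  moreover have "r ` insert l J \<subseteq> conormal y"
    using assms by (auto simp: r_def conormal_def)
  ultimately have "codim + 1 \<le> dim (conormal y)"
    using independent_card_le_dim by metis
  then show False
    using dim_conormal_le[OF \<open>y \<in> V\<close>] by simp
qed

text \<open>By Cramer's rule the gradient of a vanishing polynomial is a combination of the rows in
  \<open>J\<close> alone, because its coefficients at the other rows are minors that vanish on
  \<open>V\<close>.\<close>

lemma tangentI:
  assumes "y \<in> V" "card J = codim" "\<And>i::'n. i \<in> J \<Longrightarrow> \<phi> i \<in> vanishing"
    and "det (jac \<phi> y) \<noteq> 0" "\<And>i. i \<in> J \<Longrightarrow> grad (\<phi> i) y \<bullet> v = 0"
  shows "v \<in> tangent y"
  unfolding tangent_def mem_Collect_eq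
proof
  fix g assume g: "g \<in> vanishing"
  have "(grad (\<phi> l) y \<bullet> v) * (det (\<chi> i. if i = l then grad g y else grad (\<phi> i) y) / det (jac \<phi> y)) = 0" for l
    by (cases "l \<in> J") (simp_all add: assms(5) det_replace_row_eq_0[OF assms(1-3) g])
  moreover have "grad g y \<bullet> v = (\<Sum>l\<in>UNIV. (grad (\<phi> l) y \<bullet> v) *
      (det (\<chi> i. if i = l then grad g y else grad (\<phi> i) y) / det (jac \<phi> y)))"
    using inner_eq_sum_det_replace_row[of "\<lambda>i. grad (\<phi> i) y" "grad g y" v] assms(4)
    unfolding jac_def .
  ultimately show "grad g y \<bullet> v = 0"
    by (simp only: sum.neutral_const)
qed

text \<open>Regularity is certified by one polynomial, \<open>det (jac \<phi>)\<close>, being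
  nonzero. It is therefore an open condition on \<open>V\<close>, and primality applies to the
  exceptional set.\<close>

lemma regularI:
  assumes "y \<in> V" "card J = codim" "\<And>i::'n. i \<in> J \<Longrightarrow> \<phi> i \<in> vanishing" "det (jac \<phi> y) \<noteq> 0"
  shows "regular y"
proof -
  define r where "r i = grad (\<phi> i) y" for i
  have r: "inj r" "independent (range r)"
    using det_nonzero_independent_rows[of r] assms(4) by (simp_all add: r_def jac_def)
  have "inj_on r J"
    by (rule inj_on_subset[OF r(1)]) auto
  then have "card (r ` J) = codim"
    using assms by (simp add: card_image)
  moreover have "independent (r ` J)"
    by (rule independent_mono[OF r(2)]) auto
  moreover have "r ` J \<subseteq> conormal y"
    using assms by (auto simp: r_def conormal_def)
  ultimately have "codim \<le> dim (conormal y)"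
    using independent_card_le_dim by metis
  then show ?thesis
    using dim_conormal_le[OF \<open>y \<in> V\<close>] assms(1) by (simp add: regular_def)
qed

text \<open>Primality is applied to the real and to the imaginary part of \<open>F\<close>
  separately.\<close>

lemma complex_nonzerodivisor:
  assumes "complex_polynomial F" "real_polynomial_function g" "g \<notin> vanishing"
    and "\<And>x. x \<in> V \<Longrightarrow> F x * complex_of_real (g x) = 0" and "x \<in> V"
  shows "F x = 0"
proof -
  have "(\<forall>x\<in>V. Re (F x) = 0) \<or> (\<forall>x\<in>V. g x = 0)" "(\<forall>x\<in>V. Im (F x) = 0) \<or> (\<forall>x\<in>V. g x = 0)"
    using assms(1,2,4) by (intro prime; force simp: complex_polynomial_def complex_eq_iff)+
  then show ?thesis
    using assms(2,3,5) by (auto simp: vanishing_def complex_eq_iff)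
qed

text \<open>
  Adjoining one by one to \<open>h\<close> the functions \<open>\<phi> i\<close> that cut out \<open>V\<close> near a regular point yields an
  algebraically independent family on \<open>real ^ 'n\<close>.
\<close>

lemma alg_indep_le:
  assumes indep: "alg_indep m h V" and poly: "\<And>i. i < m \<Longrightarrow> complex_polynomial (h i)"
  shows "m + codim \<le> CARD('n)"
proof -
  obtain x where x: "regular x"
    using exists_regular by blast
  obtain J \<phi> where J: "card J = codim" and \<phi>: "\<And>i::'n. real_polynomial_function (\<phi> i)"
    "\<And>i. i \<in> J \<Longrightarrow> \<phi> i \<in> vanishing" and det: "det (jac \<phi> x) \<noteq> 0"
    using frame[OF x] by metis
  obtain e where e: "bij_betw e {..<codim} J"
    using ex_bij_betw_nat_finite[of J] J by (auto simp: atLeast0LessThan)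
  define u where "u i = (if i < m then h i else (\<lambda>y. complex_of_real (\<phi> (e (i - m)) y)))" for i
  \<comment> \<open>\<open>Y k\<close> drops the first \<open>k\<close> equations:
    \<open>Y 0\<close> contains the part of \<open>V\<close> where the determinant is nonzero, and
    \<open>Y codim\<close> is an open set. Each dropped equation becomes a new independent
    function.\<close>
  define Y where "Y k = {y. det (jac \<phi> y) \<noteq> 0 \<and> (\<forall>j. k \<le> j \<and> j < codim \<longrightarrow> \<phi> (e j) y = 0)}" for k
  have u_poly: "complex_polynomial (u i)" if "i \<le> m + codim" for i
    using poly \<phi> by (auto simp: u_def intro: complex_polynomial_of_real)
  have "alg_indep (m + k) u (Y k)" if "k \<le> codim" for k
    using that
  proof (induction k)
    case 0
    \<comment> \<open>Restricting to the points with nonzero determinant loses nothing, as the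
      determinant is a nonzerodivisor on \<open>V\<close>.\<close>
    have "alg_indep m h {y \<in> V. det (jac \<phi> y) \<noteq> 0}"
      unfolding alg_indep_def
    proof (intro allI impI)
      fix N c
      let ?F = "\<lambda>x. \<Sum>\<gamma>\<in>PiE {..<m} (\<lambda>_. {..N}). c \<gamma> * (\<Prod>i<m. h i x ^ \<gamma> i)"
      assume H: "\<forall>x\<in>{y \<in> V. det (jac \<phi> y) \<noteq> 0}. ?F x = 0"
      have "complex_polynomial ?F"
        by (intro complex_polynomial_sum complex_polynomial_mult complex_polynomial_const
            complex_polynomial_prod complex_polynomial_power poly finite_PiE) auto
      moreover have "(\<lambda>y. det (jac \<phi> y)) \<notin> vanishing"
        using det x by (auto simp: vanishing_def regular_def)
      ultimately have "?F y = 0" if "y \<in> V" for y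
        by (rule complex_nonzerodivisor[OF _ real_polynomial_jac_det[OF \<phi>(1)]]) (use H that in auto)
      then show "\<forall>\<gamma>\<in>PiE {..<m} (\<lambda>_. {..N}). c \<gamma> = 0"
        using indep unfolding alg_indep_def by blast
    qed
    moreover have "{y \<in> V. det (jac \<phi> y) \<noteq> 0} \<subseteq> Y 0"
      using \<phi>(2) e unfolding Y_def vanishing_def bij_betw_def by fastforce
    ultimately have "alg_indep m h (Y 0)"
      by (rule alg_indep_mono)
    moreover have "alg_indep m u (Y 0) \<longleftrightarrow> alg_indep m h (Y 0)"
      by (rule alg_indep_cong) (simp add: u_def)
    ultimately show ?case
      by simp
  next
    case (Suc k)
    have "alg_indep (Suc (m + k)) u (Y (Suc k))"
    \<comment> \<open>Continuous functions serve as the ring, because cancellation on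
      \<open>Y (Suc k)\<close> is a density argument: every point is a limit of points of
      \<open>Y (Suc k)\<close> at which the new function is nonzero.\<close>
    proof (rule alg_indep_Suc[where X = "Y k" and R = "{F. continuous_on UNIV F}"])
      show "alg_indep (m + k) u (Y k)"
        using Suc by simp
      show "Y k \<subseteq> Y (Suc k)"
        by (auto simp: Y_def)
      show "u (m + k) y = 0" if "y \<in> Y k" for y
        using that Suc.prems by (auto simp: Y_def u_def)
      show "u i \<in> {F. continuous_on UNIV F}" if "i \<le> m + k" for i
        using continuous_on_complex_polynomial[OF u_poly[of i]] that Suc.prems by simp
      show "F y = 0" if F: "F \<in> {F. continuous_on UNIV F}"
        and zero: "\<And>y. y \<in> Y (Suc k) \<Longrightarrow> F y * u (m + k) y = 0" and y: "y \<in> Y (Suc k)" for F y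
      proof -
        have "det (jac \<phi> y) \<noteq> 0"
          using y by (simp add: Y_def)
        then obtain U W \<psi> where *: "open U" "y \<in> U" "open W" "(\<chi> i. \<phi> i y) \<in> W"
          "homeomorphism U W (\<lambda>y. \<chi> i. \<phi> i y) \<psi>"
          "\<And>w. w \<in> W \<Longrightarrow> det (jac \<phi> (\<psi> w)) \<noteq> 0"
          apply (rule polynomial_map_local_inverse[OF \<phi>(1)])
          subgoal premises prems for U W \<psi> \<psi>'
            by (rule that[of U W \<psi>]) (fact prems)+
          done
        define w0 where "w0 = (\<chi> i. \<phi> i y)"
        \<comment> \<open>In the coordinates \<phi> this line changes only the value of
          \<open>\<phi> (e k)\<close>, which \<open>Y (Suc k)\<close> leaves free. That value
          becomes \<open>\<phi> (e k) y + t\<close>, which is nonzero for all small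
          \<open>t \<noteq> 0\<close>.\<close>
        define w where "w t = w0 + t *\<^sub>R axis (e k) (1::real)" for t
        have "((\<lambda>t. w0 + t *\<^sub>R axis (e k) (1::real)) \<longlongrightarrow> w0 + 0 *\<^sub>R axis (e k) 1) (at 0)"
          by (intro tendsto_intros)
        then have w_lim: "(w \<longlongrightarrow> w0) (at 0)"
          by (simp add: w_def[abs_def])
        have evW: "\<forall>\<^sub>F t in at 0. w t \<in> W"
          using w_lim *(3,4) unfolding w0_def by (rule topological_tendstoD)
        have "continuous_on W \<psi>"
          using *(5) by (simp add: homeomorphism_def)
        then have "isCont \<psi> w0"
          using *(3,4) by (simp add: continuous_on_eq_continuous_at w0_def)
        then have "((\<lambda>t. \<psi> (w t)) \<longlongrightarrow> \<psi> w0) (at 0)"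
          using w_lim by (rule isCont_tendsto_compose)
        moreover have "\<psi> w0 = y"
          using *(2,5) by (simp add: homeomorphism_def w0_def)
        ultimately have "((\<lambda>t. F (\<psi> (w t))) \<longlongrightarrow> F y) (at 0)"
          using F by (auto simp: continuous_on_eq_continuous_at intro: isCont_tendsto_compose)
        moreover have "\<forall>\<^sub>F t in at 0. F (\<psi> (w t)) = 0"
        proof -
          have small: "\<forall>\<^sub>F t in at (0::real). t \<noteq> - \<phi> (e k) y"
          proof (cases "\<phi> (e k) y = 0")
            case True
            then show ?thesis
              by (auto simp: eventually_at_filter)
          next
            case False
            show ?thesis
              by (rule eventually_neq_at_within)
          qed
          from evW small show ?thesis
          proof eventually_elim
            case (elim t)
            have "(\<chi> i. \<phi> i (\<psi> (w t))) = w t"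
              using *(5) elim by (simp add: homeomorphism_def)
            then have "\<phi> i (\<psi> (w t)) = w t $ i" for i
              by (metis vec_lambda_beta)
            moreover have "w t $ i = \<phi> i y + (if i = e k then t else 0)" for i
              by (simp add: w_def w0_def axis_def)
            ultimately have \<phi>w: "\<phi> i (\<psi> (w t)) = \<phi> i y + (if i = e k then t else 0)" for i
              by simp
            have "\<phi> (e j) (\<psi> (w t)) = 0" if "Suc k \<le> j" "j < codim" for j
            proof -
              have "e j \<noteq> e k"
                using e that Suc.prems unfolding bij_betw_def inj_on_def by force
              then show ?thesis
                using y that by (simp add: \<phi>w Y_def)
            qed
            then have "\<psi> (w t) \<in> Y (Suc k)"
              using *(6)[OF elim(1)] by (simp add: Y_def)
            moreover have "u (m + k) (\<psi> (w t)) \<noteq> 0"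
              using elim(2) by (simp add: u_def \<phi>w add_eq_0_iff2 del: of_real_add)
            ultimately show ?case
              using zero by fastforce
          qed
        qed
        ultimately show ?thesis
          by (metis tendsto_eventually tendsto_unique trivial_limit_at)
      qed
    qed (auto intro!: continuous_intros)
    then show ?case
      by simp
  qed
  from alg_indep_mono[OF this[of codim] subset_UNIV] have "alg_indep (m + codim) u UNIV"
    by simp
  then show ?thesis
    using not_alg_indep_if_too_many[of "m + codim" u] complex_polynomial_in_poly_space[OF u_poly]
    by (meson less_imp_le not_le)
qed

text \<open>
  For \<open>g\<close> in the ideal, the derivatives of \<open>g\<close> along \<open>{\<phi> i = 0 | i \<in> J}\<close> are, up to the unit
  \<open>det (jac \<phi>)\<close>, minors of the Jacobian that vanish on \<open>V\<close>, hence combinations of the generators.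
  So the generators solve a homogeneous linear differential equation along \<open>{\<phi> i = 0 | i \<in> J}\<close>.
\<close>

lemma generators_vanish_on_slice:
  fixes \<psi> :: "real ^ 'n \<Rightarrow> real ^ 'n"
  assumes J: "card J = codim" and \<phi>: "\<And>i. real_polynomial_function (\<phi> i)"
    "\<And>i. i \<in> J \<Longrightarrow> \<phi> i \<in> vanishing"
    and \<psi>: "\<And>t. t \<in> {0..1} \<Longrightarrow> det (jac \<phi> (\<psi> (t *\<^sub>R w))) \<noteq> 0"
    "\<And>t. t \<in> {0..1} \<Longrightarrow> (\<psi> has_derivative \<psi>' t) (at (t *\<^sub>R w))"
    "\<And>t. t \<in> {0..1} \<Longrightarrow> jac \<phi> (\<psi> (t *\<^sub>R w)) *v \<psi>' t w = w"
    and w: "\<And>i. i \<in> J \<Longrightarrow> w $ i = 0" and "\<psi> 0 \<in> V"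
  shows "\<psi> w \<in> V"
proof -
  define D where "D l k y = det (\<chi> i. if i = l then grad (\<gamma> k) y else grad (\<phi> i) y)" for l k y
  have "\<exists>a. (\<forall>h\<in>K. real_polynomial_function (a h)) \<and> (\<forall>x. D l k x = (\<Sum>h\<in>K. a h x * \<gamma> h x))"
    if "l \<notin> J" "k \<in> K" for l k
  proof (rule gen)
    show "real_polynomial_function (D l k)"
      unfolding D_def
    proof (rule real_polynomial_det)
      show "real_polynomial_function (\<lambda>y. (\<chi> i. if i = l then grad (\<gamma> k) y else grad (\<phi> i) y) $ i $ j)" for i j
        by (cases "i = l") (simp_all add: real_polynomial_grad_component \<phi> poly_\<gamma> that)
    qed
    show "D l k x = 0" if "x \<in> V" for x
      unfolding D_def
      by (rule det_replace_row_eq_0[OF that J \<phi>(2) \<gamma>_vanishing]) (use \<open>k \<in> K\<close> \<open>l \<notin> J\<close> in auto)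
  qed
  then obtain a where a: "\<And>l k h. l \<notin> J \<Longrightarrow> k \<in> K \<Longrightarrow> h \<in> K \<Longrightarrow> real_polynomial_function (a l k h)"
    "\<And>l k x. l \<notin> J \<Longrightarrow> k \<in> K \<Longrightarrow> D l k x = (\<Sum>h\<in>K. a l k h x * \<gamma> h x)"
    by metis
  define y where "y t = \<psi> (t *\<^sub>R w)" for t
  define m where "m k h t = (\<Sum>l\<in>-J. w $ l * a l k h (y t) / det (jac \<phi> (y t)))" for k h t
  have y_cont: "continuous_on {0..1} y"
  proof -
    have "isCont y t" if "t \<in> {0..1}" for t
    proof -
      have "((\<lambda>t. t *\<^sub>R w) has_derivative (\<lambda>s. s *\<^sub>R w)) (at t)"
        by (intro derivative_eq_intros) auto
      from has_derivative_compose[OF this \<psi>(2)[OF that]] show ?thesis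
        unfolding y_def by (rule has_derivative_continuous)
    qed
    then show ?thesis
      by (simp add: continuous_at_imp_continuous_on)
  qed
  have poly_cont: "continuous_on {0..1} (\<lambda>t. f (y t))" if "real_polynomial_function f" for f
    by (rule continuous_on_compose2[OF continuous_on_real_polynomial[OF that, of UNIV] y_cont]) auto
  have "\<gamma> k (y 1) = 0" if "k \<in> K" for k
  proof (rule linear_ode_unique_zero[OF finite_K, where m = m and q = "\<lambda>k t. \<gamma> k (y t)"])
    show "continuous_on {0..1} (m k h)" if "k \<in> K" "h \<in> K" for k h
      unfolding m_def
      by (intro continuous_on_sum continuous_on_divide continuous_on_mult continuous_on_const
          poly_cont[OF real_polynomial_jac_det[OF \<phi>(1)]] poly_cont[OF a(1)])
         (use that \<psi>(1) in \<open>auto simp: y_def\<close>)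
    show "((\<lambda>t. \<gamma> k (y t)) has_real_derivative (\<Sum>h\<in>K. m k h t * \<gamma> h (y t))) (at t)"
      if "k \<in> K" "t \<in> {0..1}" for k t
    proof -
      have "grad (\<phi> l) (y t) \<bullet> \<psi>' t w = w $ l" for l
        using \<psi>(3)[OF that(2)] by (simp add: y_def flip: jac_mult_component)
      moreover have "det (jac \<phi> (y t)) \<noteq> 0"
        using \<psi>(1)[OF that(2)] by (simp add: y_def)
      ultimately have "grad (\<gamma> k) (y t) \<bullet> \<psi>' t w = (\<Sum>l\<in>UNIV. w $ l * (D l k (y t) / det (jac \<phi> (y t))))"
        using inner_eq_sum_det_replace_row[of "\<lambda>i. grad (\<phi> i) (y t)" "grad (\<gamma> k) (y t)" "\<psi>' t w"]
        by (simp add: D_def jac_def)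
      \<comment> \<open>The components of \<open>w\<close> in \<open>J\<close> are zero, so that
        precisely the minors known to vanish on \<open>V\<close> remain.\<close>
      also have "\<dots> = (\<Sum>l\<in>-J. w $ l * (D l k (y t) / det (jac \<phi> (y t))))"
        by (intro sum.mono_neutral_right) (auto simp: w)
      also have "\<dots> = (\<Sum>l\<in>-J. \<Sum>h\<in>K. w $ l * a l k h (y t) / det (jac \<phi> (y t)) * \<gamma> h (y t))"
        using that by (intro sum.cong refl) (simp add: a(2) sum_distrib_left sum_divide_distrib mult.assoc)
      also have "\<dots> = (\<Sum>h\<in>K. m k h t * \<gamma> h (y t))"
        by (subst sum.swap) (simp add: m_def sum_distrib_right)
      finally show ?thesis
        using has_real_derivative_along_ray[OF poly_\<gamma>[OF that(1)] \<psi>(2)[OF that(2)]]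
        by (simp add: y_def)
    qed
    show "\<gamma> k (y 0) = 0" if "k \<in> K" for k
      using \<gamma>_vanishing[OF that] \<open>\<psi> 0 \<in> V\<close> by (simp add: y_def vanishing_def)
  qed (use that in auto)
  then show ?thesis
    by (simp add: V_eq[THEN eqset_imp_iff] y_def)
qed

text \<open>Near a regular point \<open>V\<close> is exactly the slice where the coordinates in
  \<open>J\<close> vanish: these coordinates vanish on \<open>V\<close>, and conversely the
  generators vanish along every ray in the slice that starts at \<open>x\<close>. The set
  \<open>S\<close> lets a user confine the chart.\<close>

lemma chart:
  assumes "regular x" "open S" "x \<in> S"
  obtains J \<phi> \<psi> \<psi>' \<epsilon> N where "card J = codim" "0 < \<epsilon>" "open N" "x \<in> N" "\<psi> 0 = x"
    "\<And>i::'n. real_polynomial_function (\<phi> i)"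
    "\<And>w. norm w < \<epsilon> \<Longrightarrow> (\<psi> has_derivative \<psi>' w) (at w)"
    "\<And>w i. norm w < \<epsilon> \<Longrightarrow> \<phi> i (\<psi> w) = w $ i"
    "\<And>w. norm w < \<epsilon> \<Longrightarrow> (\<And>i. i \<in> J \<Longrightarrow> w $ i = 0) \<Longrightarrow> regular (\<psi> w) \<and> \<psi> w \<in> S"
    "\<And>w v. norm w < \<epsilon> \<Longrightarrow> (\<And>i. i \<in> J \<Longrightarrow> w $ i = 0) \<Longrightarrow> (\<And>i. i \<in> J \<Longrightarrow> v $ i = 0) \<Longrightarrow>
      \<psi>' w v \<in> tangent (\<psi> w)"
    "\<And>v. v \<in> tangent x \<Longrightarrow> \<exists>w. (\<forall>i\<in>J. w $ i = 0) \<and> \<psi>' 0 w = v"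
    "\<And>y. y \<in> V \<Longrightarrow> y \<in> N \<Longrightarrow> \<exists>w. norm w < \<epsilon> \<and> (\<forall>i\<in>J. w $ i = 0) \<and> \<psi> w = y"
proof -
  obtain J \<phi> where J: "card J = codim" and \<phi>: "\<And>i::'n. real_polynomial_function (\<phi> i)"
    "\<And>i. i \<in> J \<Longrightarrow> \<phi> i \<in> vanishing" "\<And>i. \<phi> i x = 0" and det: "det (jac \<phi> x) \<noteq> 0"
    by (rule frame[OF assms(1)]) (rule that; assumption)
  define \<Phi> where "\<Phi> y = (\<chi> i. \<phi> i y)" for y
  obtain U W \<psi> \<psi>' where UW: "open U" "x \<in> U" "open W" "\<Phi> x \<in> W" "homeomorphism U W \<Phi> \<psi>"
    and \<psi>: "\<And>w. w \<in> W \<Longrightarrow> det (jac \<phi> (\<psi> w)) \<noteq> 0"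
    "\<And>w. w \<in> W \<Longrightarrow> (\<psi> has_derivative \<psi>' w) (at w)"
    "\<And>w v. w \<in> W \<Longrightarrow> jac \<phi> (\<psi> w) *v \<psi>' w v = v"
    unfolding \<Phi>_def
    apply (rule polynomial_map_local_inverse[OF \<phi>(1) det])
    subgoal premises prems for U W \<psi> \<psi>'
      by (rule that[of U W \<psi> \<psi>'], unfold \<Phi>_def) (fact prems)+
    done
  have \<Phi>x: "\<Phi> x = 0"
    using \<phi>(3) by (simp add: \<Phi>_def vec_eq_iff)
  have \<psi>\<Phi>: "\<psi> (\<Phi> y) = y" if "y \<in> U" for y
    using UW(5) that by (simp add: homeomorphism_def)
  have \<Phi>\<psi>: "\<Phi> (\<psi> w) = w" if "w \<in> W" for w
    using UW(5) that by (simp add: homeomorphism_def)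
  have \<psi>0: "\<psi> 0 = x"
    using \<psi>\<Phi>[OF UW(2)] \<Phi>x by simp
  have "open (W \<inter> \<psi> -` S)"
    using UW(3,5) \<open>open S\<close> continuous_open_preimage[of W \<psi> S] by (simp add: homeomorphism_def)
  moreover have "0 \<in> W \<inter> \<psi> -` S"
    using UW(4) \<Phi>x \<psi>0 \<open>x \<in> S\<close> by simp
  \<comment> \<open>A ball contains with each point \<open>w\<close> the whole ray from 0 to
    \<open>w\<close>, along which the differential equation is solved.\<close>
  ultimately obtain \<epsilon> where \<epsilon>: "0 < \<epsilon>" "ball 0 \<epsilon> \<subseteq> W \<inter> \<psi> -` S"
    using openE by blast
  have inW: "w \<in> W" "\<psi> w \<in> S" if "norm w < \<epsilon>" for w
    using \<epsilon>(2) that by (auto simp: subset_iff)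
  have inV: "\<psi> w \<in> V" if "norm w < \<epsilon>" "\<And>i. i \<in> J \<Longrightarrow> w $ i = 0" for w
  proof (rule generators_vanish_on_slice[OF J \<phi>(1,2), where \<psi> = \<psi> and w = w and \<psi>' = "\<lambda>t. \<psi>' (t *\<^sub>R w)"])
    have "t *\<^sub>R w \<in> W" if "t \<in> {0..1}" for t
    proof -
      have "norm (t *\<^sub>R w) \<le> norm w"
        using that by (auto intro: mult_left_le_one_le)
      then show ?thesis
        using inW(1) \<open>norm w < \<epsilon>\<close> by simp
    qed
    then show "det (jac \<phi> (\<psi> (t *\<^sub>R w))) \<noteq> 0" "(\<psi> has_derivative \<psi>' (t *\<^sub>R w)) (at (t *\<^sub>R w))"
      "jac \<phi> (\<psi> (t *\<^sub>R w)) *v \<psi>' (t *\<^sub>R w) w = w" if "t \<in> {0..1}" for t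
      using \<psi> that by blast+
  qed (use that assms(1) \<psi>0 in \<open>auto simp: regular_def\<close>)
  have \<Phi>_cont: "continuous_on UNIV \<Phi>"
    unfolding \<Phi>_def by (intro continuous_on_vec_lambda continuous_on_real_polynomial \<phi>(1))
  define N where "N = U \<inter> {y. norm (\<Phi> y) < \<epsilon>}"
  show ?thesis
  proof (rule that[of J \<epsilon> N \<psi> \<phi> \<psi>'])
    show "open N"
      unfolding N_def by (intro open_Int UW(1) open_Collect_less continuous_on_norm \<Phi>_cont) auto
    show "x \<in> N"
      using UW(2) \<Phi>x \<epsilon>(1) by (simp add: N_def)
    show "\<phi> i (\<psi> w) = w $ i" if "norm w < \<epsilon>" for w i
      using \<Phi>\<psi>[OF inW(1)[OF that]] by (metis \<Phi>_def vec_lambda_beta)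
    show "regular (\<psi> w) \<and> \<psi> w \<in> S" if "norm w < \<epsilon>" "\<And>i. i \<in> J \<Longrightarrow> w $ i = 0" for w
      using regularI[OF inV[OF that] J \<phi>(2) \<psi>(1)[OF inW(1)]] inW(2) that(1) by blast
    show "\<psi>' w v \<in> tangent (\<psi> w)"
      if "norm w < \<epsilon>" "\<And>i. i \<in> J \<Longrightarrow> w $ i = 0" "\<And>i. i \<in> J \<Longrightarrow> v $ i = 0" for w v
    proof (rule tangentI[OF inV[OF that(1,2)] J \<phi>(2) \<psi>(1)[OF inW(1)[OF that(1)]]])
      show "grad (\<phi> i) (\<psi> w) \<bullet> \<psi>' w v = 0" if "i \<in> J" for i
        using \<psi>(3)[OF inW(1)[OF \<open>norm w < \<epsilon>\<close>], of v] \<open>\<And>i. i \<in> J \<Longrightarrow> v $ i = 0\<close>[OF that]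
        by (simp flip: jac_mult_component)
    qed
    show "\<exists>w. (\<forall>i\<in>J. w $ i = 0) \<and> \<psi>' 0 w = v" if "v \<in> tangent x" for v
    proof (intro exI conjI)
      show "\<forall>i\<in>J. (jac \<phi> x *v v) $ i = 0"
        using that \<phi>(2) by (auto simp: jac_mult_component tangent_def)
      have "jac \<phi> x *v \<psi>' 0 (jac \<phi> x *v v) = jac \<phi> x *v v"
        using \<psi>(3)[of 0] inW(1)[of 0] \<epsilon>(1) by (simp add: \<psi>0)
      then show "\<psi>' 0 (jac \<phi> x *v v) = v"
        using det by (metis inj_matrix_vector_mult injD invertible_det_nz)
    qed
    show "\<exists>w. norm w < \<epsilon> \<and> (\<forall>i\<in>J. w $ i = 0) \<and> \<psi> w = y" if "y \<in> V" "y \<in> N" for y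
      using that \<phi>(2) \<psi>\<Phi>[of y] by (intro exI[of _ "\<Phi> y"]) (auto simp: N_def \<Phi>_def vanishing_def)
  qed (use J \<epsilon> \<phi> \<psi> \<psi>0 inW in auto)
qed

text \<open>Primality alone does not exclude a polynomial that vanishes on an open piece of
  \<open>V\<close> only; the bound on independent functions does. The
  \<open>CARD('n) - codim\<close> free coordinates of a chart fill a box, and \<open>g\<close> would
  be one function too many.\<close>

lemma identity_theorem:
  assumes "regular x" "open S" "x \<in> S" and g: "real_polynomial_function g"
    and zero: "\<And>y. y \<in> V \<Longrightarrow> y \<in> S \<Longrightarrow> g y = 0"
  shows "g \<in> vanishing"
proof (rule ccontr)
  assume "g \<notin> vanishing"
  obtain J \<phi> \<psi> \<psi>' \<epsilon> N where J: "card J = codim" and \<epsilon>: "0 < \<epsilon>"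
    and \<phi>: "\<And>i::'n. real_polynomial_function (\<phi> i)"
    and \<psi>: "\<And>w i. norm w < \<epsilon> \<Longrightarrow> \<phi> i (\<psi> w) = w $ i"
    "\<And>w. norm w < \<epsilon> \<Longrightarrow> (\<And>i. i \<in> J \<Longrightarrow> w $ i = 0) \<Longrightarrow> regular (\<psi> w) \<and> \<psi> w \<in> S"
    apply (rule chart[OF assms(1-3)])
    subgoal premises prems for J \<phi> \<psi> \<psi>' \<epsilon> N
      by (rule that[of J \<epsilon> \<phi> \<psi>]) (fact prems)+
    done
  define m where "m = CARD('n) - codim"
  have "card (- J) = m"
    using J by (simp add: m_def Compl_eq_Diff_UNIV card_Diff_subset)
  then obtain e where e: "bij_betw e {..<m} (- J)"
    using ex_bij_betw_nat_finite[of "- J"] by (auto simp: atLeast0LessThan)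
  define u where "u i = (if i < m then (\<lambda>y. complex_of_real (\<phi> (e i) y)) else (\<lambda>y. complex_of_real (g y)))" for i
  have poly: "complex_polynomial (u i)" for i
    by (simp add: u_def complex_polynomial_of_real \<phi> g)
  have "alg_indep m u (V \<inter> S)"
  proof (rule alg_indep_box)
    show "0 < \<epsilon> / CARD('n)"
      using \<epsilon> by simp
    fix r :: "nat \<Rightarrow> real"
    assume r: "\<And>i. \<bar>r i\<bar> < \<epsilon> / CARD('n)"
    \<comment> \<open>The prescribed values are put on the coordinates outside \<open>J\<close>.
      Their bound \<open>\<epsilon> / CARD('n)\<close> keeps the sum of the absolute values of all
      coordinates, hence the norm, below \<open>\<epsilon>\<close>.\<close>
    define w :: "real ^ 'n" where "w = (\<chi> l. if l \<in> J then 0 else r (inv_into {..<m} e l))"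
    have "norm w \<le> (\<Sum>l\<in>UNIV. \<bar>w $ l\<bar>)"
      by (rule norm_le_l1_cart)
    also have "\<dots> < (\<Sum>l\<in>(UNIV::'n set). \<epsilon> / CARD('n))"
      using r \<epsilon> by (intro sum_strict_mono) (auto simp: w_def)
    also have "\<dots> = \<epsilon>"
      by simp
    finally have w: "norm w < \<epsilon>" .
    have "\<psi> w \<in> V \<inter> S"
      using \<psi>(2)[OF w] by (simp add: w_def regular_def)
    moreover have "u i (\<psi> w) = complex_of_real (r i)" if "i < m" for i
    proof -
      have "e i \<notin> J" "inv_into {..<m} e (e i) = i"
        using e that by (auto simp: bij_betw_def inv_into_f_f)
      then show ?thesis
        using that \<psi>(1)[OF w] by (simp add: u_def w_def)
    qed
    ultimately show "\<exists>x\<in>V \<inter> S. \<forall>i<m. u i x = complex_of_real (r i)"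
      by blast
  qed
  then have "alg_indep (Suc m) u V"
  proof (rule alg_indep_Suc[where R = "{F. complex_polynomial F}"])
    show "u m y = 0" if "y \<in> V \<inter> S" for y
      using zero that by (simp add: u_def)
    show "F y = 0" if "F \<in> {F. complex_polynomial F}" "\<And>y. y \<in> V \<Longrightarrow> F y * u m y = 0" "y \<in> V" for F y
      using complex_nonzerodivisor[OF _ g \<open>g \<notin> vanishing\<close>] that by (simp add: u_def)
  qed (auto intro: poly complex_polynomial_const complex_polynomial_add complex_polynomial_mult)
  then have "Suc m + codim \<le> CARD('n)"
    by (rule alg_indep_le) (rule poly)
  then show False
    by (simp add: m_def)
qed

text \<open>The hypothesis says that the quotient of the two affine functions has derivative zero
  along \<open>V\<close>. It is thus constant on the rays of a chart at \<open>x\<close>, and the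
  identity theorem carries the resulting affine equation over to all of \<open>V\<close>.\<close>

lemma constant_ratio:
  assumes "regular x" "open S" "x \<in> S" "a2 \<bullet> x + b2 \<noteq> 0"
    and deriv: "\<And>y v. regular y \<Longrightarrow> y \<in> S \<Longrightarrow> v \<in> tangent y \<Longrightarrow>
      (a1 \<bullet> y + b1) * (a2 \<bullet> v) = (a2 \<bullet> y + b2) * (a1 \<bullet> v)"
  shows "\<exists>q. \<forall>y\<in>V. a1 \<bullet> y + b1 = q * (a2 \<bullet> y + b2)"
proof -
  define S' where "S' = S \<inter> {y. a2 \<bullet> y + b2 \<noteq> 0}"
  have "open S'"
    unfolding S'_def by (intro open_Int assms(2) open_Collect_neq continuous_intros)
  moreover have "x \<in> S'"
    using assms by (simp add: S'_def)
  ultimately obtain \<epsilon> N and \<psi> :: "real ^ 'n \<Rightarrow> real ^ 'n" and \<psi>' J where \<epsilon>: "0 < \<epsilon>" and N: "open N" "x \<in> N"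
    and \<psi>0: "\<psi> 0 = x" and \<psi>: "\<And>w. norm w < \<epsilon> \<Longrightarrow> (\<psi> has_derivative \<psi>' w) (at w)"
    "\<And>w. norm w < \<epsilon> \<Longrightarrow> (\<And>i. i \<in> J \<Longrightarrow> w $ i = 0) \<Longrightarrow> regular (\<psi> w) \<and> \<psi> w \<in> S'"
    "\<And>w v. norm w < \<epsilon> \<Longrightarrow> (\<And>i. i \<in> J \<Longrightarrow> w $ i = 0) \<Longrightarrow> (\<And>i. i \<in> J \<Longrightarrow> v $ i = 0) \<Longrightarrow>
      \<psi>' w v \<in> tangent (\<psi> w)"
    "\<And>y. y \<in> V \<Longrightarrow> y \<in> N \<Longrightarrow> \<exists>w. norm w < \<epsilon> \<and> (\<forall>i\<in>J. w $ i = 0) \<and> \<psi> w = y"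
    apply (rule chart[OF assms(1)])
    subgoal premises prems for J \<phi> \<psi> \<psi>' \<epsilon> N
      by (rule that[of \<epsilon> N \<psi> \<psi>' J]) (fact prems)+
    done
  define q where "q = (a1 \<bullet> x + b1) / (a2 \<bullet> x + b2)"
  define g where "g y = (a1 - q *\<^sub>R a2) \<bullet> y + (b1 - q * b2)" for y
  have g_eq: "g y = (a1 \<bullet> y + b1) - q * (a2 \<bullet> y + b2)" for y
    by (simp add: g_def inner_diff_left algebra_simps)
  have "g \<in> vanishing"
  proof (rule identity_theorem[OF assms(1) N])
    show "real_polynomial_function g"
      unfolding g_def by (rule real_polynomial_affine)
    fix y assume "y \<in> V" "y \<in> N"
    then obtain w where w: "norm w < \<epsilon>" "\<And>i. i \<in> J \<Longrightarrow> w $ i = 0" "\<psi> w = y"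
      using \<psi>(4) by blast
    define r where "r t = (a1 \<bullet> \<psi> (t *\<^sub>R w) + b1) / (a2 \<bullet> \<psi> (t *\<^sub>R w) + b2)" for t
    have r': "(r has_real_derivative 0) (at t)" if "t \<in> {0..1}" for t
    proof -
      have "norm (t *\<^sub>R w) \<le> norm w"
        using that by (auto intro: mult_left_le_one_le)
      then have tw: "norm (t *\<^sub>R w) < \<epsilon>" "\<And>i. i \<in> J \<Longrightarrow> (t *\<^sub>R w) $ i = 0"
        using w by simp_all
      let ?y = "\<psi> (t *\<^sub>R w)" and ?v = "\<psi>' (t *\<^sub>R w) w"
      have y: "regular ?y" "?y \<in> S" "a2 \<bullet> ?y + b2 \<noteq> 0" and v: "?v \<in> tangent ?y"
        using \<psi>(2)[OF tw] \<psi>(3)[OF tw w(2)] by (auto simp: S'_def)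
      have *: "((\<lambda>t. a1 \<bullet> \<psi> (t *\<^sub>R w) + b1) has_real_derivative a1 \<bullet> ?v) (at t)"
        "((\<lambda>t. a2 \<bullet> \<psi> (t *\<^sub>R w) + b2) has_real_derivative a2 \<bullet> ?v) (at t)"
        using has_real_derivative_along_ray[OF real_polynomial_affine \<psi>(1)[OF tw(1)]]
        by (simp_all add: grad_affine)
      show ?thesis
        unfolding r_def using DERIV_divide[OF * y(3)] deriv[OF y(1,2) v] by (simp add: mult.commute)
    qed
    have r_cont: "isCont r t" if "t \<in> {0..1}" for t
      using r'[OF that] by (rule DERIV_isCont)
    have "r 1 = r 0"
      by (rule DERIV_isconst_end[where f = r and a = 0 and b = 1]) (use r' r_cont in \<open>auto intro!: continuous_at_imp_continuous_on\<close>)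
    then have "(a1 \<bullet> y + b1) / (a2 \<bullet> y + b2) = q"
      using w(3) by (simp add: r_def q_def \<psi>0)
    moreover have "a2 \<bullet> y + b2 \<noteq> 0"
      using \<psi>(2)[OF w(1,2)] w(3) by (auto simp: S'_def)
    ultimately show "g y = 0"
      by (simp add: g_eq divide_eq_eq)
  qed
  then show ?thesis
    by (auto simp: vanishing_def g_eq intro!: exI[of _ q])
qed

end

section \<open>Supporting hyperplanes\<close>

context zero_locus
begin

lemma vanishing_prod:
  assumes "finite A" "\<And>a. a \<in> A \<Longrightarrow> real_polynomial_function (f a)"
    and "\<And>x. x \<in> V \<Longrightarrow> (\<Prod>a\<in>A. f a x) = 0"
  shows "\<exists>a\<in>A. f a \<in> vanishing"
  using assms
proof (induction rule: finite_induct)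
  case empty
  then show ?case
    using nonempty by auto
next
  case (insert a A)
  have "(\<forall>x\<in>V. f a x = 0) \<or> (\<forall>x\<in>V. (\<Prod>a\<in>A. f a x) = 0)"
    using insert.hyps insert.prems by (intro prime real_polynomial_function_prod) auto
  then show ?case
    using insert by (auto simp: vanishing_def)
qed

text \<open>Zariski density: the product of \<open>g\<close>, \<open>u\<close> and a determinant
  certifying regularity vanishes on \<open>V\<close>, and primality cancels the last two
  factors.\<close>

lemma regular_dense:
  assumes "real_polynomial_function u" "u \<notin> vanishing" "real_polynomial_function g"
    and "\<And>x. regular x \<Longrightarrow> u x \<noteq> 0 \<Longrightarrow> g x = 0"
  shows "g \<in> vanishing"
proof -
  obtain x where x: "regular x"
    using exists_regular by blast
  obtain J \<phi> where J: "card J = codim" and \<phi>: "\<And>i::'n. real_polynomial_function (\<phi> i)"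
    "\<And>i. i \<in> J \<Longrightarrow> \<phi> i \<in> vanishing" and det: "det (jac \<phi> x) \<noteq> 0"
    using frame[OF x] by metis
  note [intro] = real_polynomial_jac_det[OF \<phi>(1)] assms(1,3) real_polynomial_function.intros(4)
  have "g y * u y * det (jac \<phi> y) = 0" if "y \<in> V" for y
    using regularI[where \<phi> = \<phi>, OF that J \<phi>(2)] assms(4)[of y] by auto
  then have "(\<forall>y\<in>V. g y * u y = 0) \<or> (\<forall>y\<in>V. det (jac \<phi> y) = 0)"
    by (intro prime) auto
  then have "\<forall>y\<in>V. g y * u y = 0"
    using det x by (auto simp: regular_def)
  then have "(\<forall>y\<in>V. g y = 0) \<or> (\<forall>y\<in>V. u y = 0)"
    by (intro prime) auto
  then show ?thesis
    using assms(1-3) by (auto simp: vanishing_def)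
qed

end

text \<open>The polynomial \<open>u\<close> stands in for the subvariety \<open>U\<close>: it will
  vanish on \<open>U\<close> but not on all of \<open>V\<close>, so that the points of
  \<open>V\<close> with \<open>u x \<noteq> 0\<close> lie in \<open>V - U\<close> and inherit its
  supporting halfspaces.\<close>

locale neighborly_zero_locus = zero_locus +
  fixes u :: "real ^ 'a \<Rightarrow> real" and k :: nat
  assumes poly_u: "real_polynomial_function u"
    and u_nonvanishing: "u \<notin> vanishing"
    and nondegenerate: "\<And>a b. a \<noteq> 0 \<Longrightarrow> \<exists>x\<in>V. a \<bullet> x \<noteq> b"
    and neighborly: "\<And>T. T \<subseteq> {x \<in> V. u x \<noteq> 0} \<Longrightarrow> finite T \<Longrightarrow> card T = k \<Longrightarrow>
      \<exists>a b. a \<noteq> 0 \<and> (\<forall>x\<in>V. u x \<noteq> 0 \<longrightarrow> a \<bullet> x \<le> b) \<and> (\<forall>x\<in>T. a \<bullet> x = b)"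
begin

definition good :: "(real ^ 'a) set" where
  "good = {x. regular x \<and> u x \<noteq> 0}"

text \<open>
  Points \<open>x\<close> become \<open>(x, 1)\<close> and directions \<open>v\<close> become \<open>(v, 0)\<close>, so that the affine function
  \<open>a \<bullet> x + b\<close> is the inner product with \<open>(a, b)\<close>.
\<close>

definition homogenized_tangents :: "(real ^ 'a) set \<Rightarrow> ((real ^ 'a) \<times> real) set" where
  "homogenized_tangents T = (\<Union>x\<in>T. insert (x, 1) ((\<lambda>v. (v, 0)) ` tangent x))"

text \<open>By density, the non-degeneracy of \<open>V\<close> passes to the good points.\<close>

lemma affine_nonzero_at_good:
  assumes "a \<noteq> 0 \<or> b \<noteq> 0" shows "\<exists>x\<in>good. a \<bullet> x + b \<noteq> 0"
proof (rule ccontr)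
  assume "\<not> (\<exists>x\<in>good. a \<bullet> x + b \<noteq> 0)"
  then have "(\<lambda>x. a \<bullet> x + b) \<in> vanishing"
    by (intro regular_dense[OF poly_u u_nonvanishing] real_polynomial_affine) (auto simp: good_def)
  then have *: "a \<bullet> x + b = 0" if "x \<in> V" for x
    using that by (simp add: vanishing_def)
  show False
  proof (cases "a = 0")
    case True
    then show ?thesis using * nonempty assms by auto
  next
    case False
    then show ?thesis using nondegenerate[of a "- b"] * by (auto simp: add_eq_0_iff2)
  qed
qed

text \<open>Supplies the points with which smaller sets are filled up to \<open>k\<close> points. If
  there were finitely many, a product of affine functions vanishing at them would vanish on
  \<open>V\<close>, and by primality so would one factor, which puts \<open>V\<close> into a
  hyperplane.\<close>

lemma infinite_good: "infinite good"
proof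
  assume fin: "finite good"
  define e :: "real ^ 'a" where "e = axis undefined 1"
  define f where "f a x = e \<bullet> x + - (e \<bullet> a)" for a x :: "real ^ 'a"
  have poly: "real_polynomial_function (f a)" for a
    unfolding f_def by (rule real_polynomial_affine)
  have "(\<lambda>x. \<Prod>a\<in>good. f a x) \<in> vanishing"
    by (intro regular_dense[OF poly_u u_nonvanishing] real_polynomial_function_prod fin poly)
       (auto simp: f_def good_def[symmetric] fin intro!: prod_zero, auto simp: good_def)
  then obtain a where "f a \<in> vanishing"
    using vanishing_prod[OF fin, of f] poly by (auto simp: vanishing_def)
  moreover have "e \<noteq> 0"
    by (simp add: e_def axis_eq_0_iff)
  ultimately show False
    using nondegenerate[of e "e \<bullet> a"] by (auto simp: vanishing_def f_def)
qed

text \<open>Neighborliness speaks of exactly \<open>k\<close> points, so \<open>T\<close> is first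
  enlarged by further good points. The tangent vectors are annihilated because \<open>a\<close> has
  a local maximum at each point of \<open>T\<close> along every curve in \<open>V\<close>.\<close>

lemma supporting_hyperplane:
  assumes "T \<subseteq> good" "finite T" "card T \<le> k"
  shows "\<exists>a b. a \<noteq> 0 \<and> (\<forall>e\<in>homogenized_tangents T. (a, b) \<bullet> e = 0)"
proof -
  have "infinite (good - T)"
    using infinite_good assms(2) by simp
  then obtain B where B: "finite B" "card B = k - card T" "B \<subseteq> good - T"
    using infinite_arbitrarily_large by blast
  have "card (T \<union> B) = k"
    using assms B by (subst card_Un_disjoint) auto
  moreover have "T \<union> B \<subseteq> {x \<in> V. u x \<noteq> 0}"
    using assms(1) B(3) by (auto simp: good_def regular_def)
  ultimately obtain a b where "a \<noteq> 0" "\<forall>x\<in>V. u x \<noteq> 0 \<longrightarrow> a \<bullet> x \<le> b" "\<forall>x\<in>T \<union> B. a \<bullet> x = b"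
    using neighborly[of "T \<union> B"] assms(2) B(1) by blast
  then have ab: "a \<noteq> 0" "\<And>x. x \<in> V \<Longrightarrow> u x \<noteq> 0 \<Longrightarrow> a \<bullet> x \<le> b" "\<And>x. x \<in> T \<Longrightarrow> a \<bullet> x = b"
    by auto
  have "a \<bullet> v = 0" if x: "x \<in> T" and v: "v \<in> tangent x" for x v
  proof -
    define S where "S = {x. u x \<noteq> 0}"
    have "regular x" "x \<in> S"
      using x assms(1) by (auto simp: good_def S_def)
    moreover have "open S"
      unfolding S_def by (intro open_Collect_neq continuous_on_const continuous_on_real_polynomial poly_u)
    ultimately obtain \<epsilon> and \<psi> :: "real ^ 'a \<Rightarrow> real ^ 'a" and \<psi>' J where \<epsilon>: "0 < \<epsilon>" and \<psi>0: "\<psi> 0 = x"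
      and \<psi>: "\<And>w. norm w < \<epsilon> \<Longrightarrow> (\<psi> has_derivative \<psi>' w) (at w)"
      "\<And>w. norm w < \<epsilon> \<Longrightarrow> (\<And>i. i \<in> J \<Longrightarrow> w $ i = 0) \<Longrightarrow> regular (\<psi> w) \<and> \<psi> w \<in> S"
      "\<And>v. v \<in> tangent x \<Longrightarrow> \<exists>w. (\<forall>i\<in>J. w $ i = 0) \<and> \<psi>' 0 w = v"
      apply (rule_tac chart)
      apply assumption+
      subgoal premises prems for J \<phi> \<psi> \<psi>' \<epsilon> N
        by (rule prems(1)[of \<epsilon> \<psi> \<psi>' J]) (fact prems)+
      done
    obtain w where w: "\<And>i. i \<in> J \<Longrightarrow> w $ i = 0" "\<psi>' 0 w = v"
      using \<psi>(3)[OF v] by blast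
    have deriv: "((\<lambda>t. a \<bullet> \<psi> (t *\<^sub>R w)) has_real_derivative a \<bullet> v) (at 0)"
      using has_real_derivative_along_ray[OF real_polynomial_affine[of a 0], of \<psi> "\<psi>' 0" 0 w] \<psi>(1)[of 0] \<epsilon> w(2)
      by (simp add: grad_affine[of a 0, simplified])
    \<comment> \<open>The curve in the chart with velocity \<open>v\<close> stays in the halfspace
      and touches its boundary at \<open>t = 0\<close>. The summand 1 in the bound keeps the
      denominator positive when \<open>w = 0\<close>.\<close>
    have "a \<bullet> \<psi> (t *\<^sub>R w) \<le> a \<bullet> \<psi> (0 *\<^sub>R w)" if t: "\<bar>0 - t\<bar> < \<epsilon> / (norm w + 1)" for t
    proof -
      have "norm (t *\<^sub>R w) \<le> \<bar>t\<bar> * (norm w + 1)"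
        by (simp add: mult_left_mono)
      also have "\<dots> < \<epsilon>"
        using t by (simp add: less_divide_eq add_nonneg_pos)
      finally have "regular (\<psi> (t *\<^sub>R w)) \<and> \<psi> (t *\<^sub>R w) \<in> S"
        by (rule \<psi>(2)) (simp add: w(1))
      then show ?thesis
        using ab(2,3) x by (simp add: \<psi>0 regular_def S_def)
    qed
    moreover have "0 < \<epsilon> / (norm w + 1)"
      using \<epsilon> by (simp add: add_nonneg_pos)
    ultimately show "a \<bullet> v = 0"
      using DERIV_local_max[OF deriv] by blast
  qed
  then have "\<forall>e\<in>homogenized_tangents T. (a, - b) \<bullet> e = 0"
    using ab(3) by (auto simp: homogenized_tangents_def)
  then show ?thesis
    using ab(1) by blast
qed

lemma orthogonal_span:
  assumes "\<forall>e\<in>A. l \<bullet> e = 0" "e \<in> span A" shows "l \<bullet> e = 0"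
  using assms(2) by (induction rule: span_induct_alt) (use assms(1) in \<open>auto simp: inner_add_right\<close>)

text \<open>If all these determinants were zero, the quotient of the second affine function by the
  first would be constant. Its value at \<open>x\<close> is 0, so the second function would vanish
  on \<open>V\<close>, against non-degeneracy.\<close>

lemma exists_tangent_minor_nonzero:
  assumes a2: "a2 \<noteq> 0" and x: "x \<in> good" "a1 \<bullet> x + b1 \<noteq> 0" "a2 \<bullet> x + b2 = 0"
  shows "\<exists>y\<in>good. \<exists>v\<in>tangent y. (a2 \<bullet> y + b2) * (a1 \<bullet> v) \<noteq> (a1 \<bullet> y + b1) * (a2 \<bullet> v)"
proof (rule ccontr)
  assume neg: "\<not> ?thesis"
  have "open {x. u x \<noteq> 0}"
    by (intro open_Collect_neq continuous_on_const continuous_on_real_polynomial poly_u)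
  then have "\<exists>q. \<forall>y\<in>V. a2 \<bullet> y + b2 = q * (a1 \<bullet> y + b1)"
    using x neg by (intro constant_ratio[of x "{x. u x \<noteq> 0}"]) (auto simp: good_def)
  then obtain q where q: "\<And>y. y \<in> V \<Longrightarrow> a2 \<bullet> y + b2 = q * (a1 \<bullet> y + b1)"
    by blast
  have "x \<in> V"
    using x(1) by (simp add: good_def regular_def)
  with q[OF this] x have "q = 0"
    by simp
  then show False
    using q nondegenerate[OF a2, of "- b2"] by (auto simp: add_eq_0_iff2)
qed

text \<open>The auxiliary point \<open>x\<close>, off the first hyperplane, serves to obtain a
  second functional that is not a multiple of the first; \<open>card T < k\<close> leaves room for
  it. The point actually added is \<open>y\<close>: both functionals annihilate the old span, and
  their determinant on \<open>(y, 1)\<close> and \<open>(v, 0)\<close> is nonzero.\<close>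

lemma homogenized_tangents_grows:
  assumes "T \<subseteq> good" "finite T" "card T < k"
  shows "\<exists>y\<in>good - T. dim (homogenized_tangents T) + 2 \<le> dim (homogenized_tangents (insert y T))"
proof -
  obtain a1 b1 where ab1: "a1 \<noteq> 0" "\<forall>e\<in>homogenized_tangents T. (a1, b1) \<bullet> e = 0"
    using supporting_hyperplane[of T] assms by auto
  obtain x where x: "x \<in> good" "a1 \<bullet> x + b1 \<noteq> 0"
    using affine_nonzero_at_good[of a1 b1] ab1(1) by blast
  have "card (insert x T) \<le> k"
    using assms card_insert_le_m1[of k T x] by (cases k) auto
  then obtain a2 b2 where ab2: "a2 \<noteq> 0" "\<forall>e\<in>homogenized_tangents (insert x T). (a2, b2) \<bullet> e = 0"
    using supporting_hyperplane[of "insert x T"] assms(1,2) x(1) by auto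
  then have "(a2, b2) \<bullet> (x, 1) = 0" and ab2': "\<forall>e\<in>homogenized_tangents T. (a2, b2) \<bullet> e = 0"
    by (auto simp: homogenized_tangents_def simp del: inner_Pair)
  then obtain y v where y: "y \<in> good" and v: "v \<in> tangent y"
    and minor: "(a2 \<bullet> y + b2) * (a1 \<bullet> v) \<noteq> (a1 \<bullet> y + b1) * (a2 \<bullet> v)"
    using exists_tangent_minor_nonzero[OF ab2(1) x, of b2] by auto
  let ?A = "homogenized_tangents T"
  have notin1: "(y, 1) \<notin> span ?A"
  proof
    assume "(y, 1) \<in> span ?A"
    from orthogonal_span[OF ab1(2) this] orthogonal_span[OF ab2' this] minor show False
      by simp
  qed
  have notin2: "(v, 0) \<notin> span (insert (y, 1) ?A)"
  proof
    assume "(v, 0) \<in> span (insert (y, 1) ?A)"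
    then obtain s where s: "(v, 0) - s *\<^sub>R (y, 1) \<in> span ?A"
      by (auto simp: span_breakdown_eq)
    from orthogonal_span[OF ab1(2) s] orthogonal_span[OF ab2' s]
    have "a1 \<bullet> v = s * (a1 \<bullet> y + b1)" "a2 \<bullet> v = s * (a2 \<bullet> y + b2)"
      by (simp_all add: inner_diff_right algebra_simps)
    with minor show False
      by (simp add: mult_ac)
  qed
  have "dim ?A + 2 = dim (insert (v, 0) (insert (y, 1) ?A))"
    using notin1 notin2 by (simp add: dim_insert)
  also have "\<dots> \<le> dim (homogenized_tangents (insert y T))"
    using v by (intro dim_subset) (auto simp: homogenized_tangents_def)
  finally have grow: "dim ?A + 2 \<le> dim (homogenized_tangents (insert y T))" .
  moreover have "y \<notin> T"
    using grow by (auto simp: insert_absorb)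
  ultimately show ?thesis
    using y by blast
qed

lemma dim_homogenized_tangents_singleton:
  "dim (homogenized_tangents {x}) = dim (tangent x) + 1"
proof -
  have "dim ((\<lambda>v. (v, 0::real)) ` tangent x) = dim (tangent x)"
    by (rule dim_image_eq) (auto intro!: linearI inj_onI)
  moreover have "(x, 1) \<notin> span ((\<lambda>v. (v, 0::real)) ` tangent x)"
    using orthogonal_span[of "(\<lambda>v. (v, 0::real)) ` tangent x" "(0, 1)" "(x, 1)"] by auto
  ultimately show ?thesis
    by (simp add: homogenized_tangents_def dim_insert)
qed

text \<open>With p = \<open>CARD('a)\<close>, the span of the homogenized tangent spaces has
  dimension p - codim + 1 for one point, gains at least two with each of the other k - 1 points, and
  stays at most p. Hence p - codim + 1 + 2 (k - 1) \<le> p.\<close>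

theorem codim_bound:
  assumes "1 \<le> k" shows "2 * k \<le> codim + 1"
proof -
  have "\<exists>T. T \<subseteq> good \<and> finite T \<and> card T = j \<and> CARD('a) + 2 * j \<le> dim (homogenized_tangents T) + codim + 1"
    if "1 \<le> j" "j \<le> k" for j
    using that
  proof (induction j rule: nat_induct_at_least)
    case base
    obtain x where x: "x \<in> good"
      using infinite_good by fastforce
    then have "dim (tangent x) + codim = CARD('a)"
      by (intro dim_tangent) (simp add: good_def)
    then show ?case
      using x by (intro exI[of _ "{x}"]) (simp add: dim_homogenized_tangents_singleton)
  next
    case (Suc j)
    then obtain T where T: "T \<subseteq> good" "finite T" "card T = j"
      "CARD('a) + 2 * j \<le> dim (homogenized_tangents T) + codim + 1"
      by auto
    then obtain y where "y \<in> good - T" "dim (homogenized_tangents T) + 2 \<le> dim (homogenized_tangents (insert y T))"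
      using homogenized_tangents_grows[of T] Suc.prems by auto
    then show ?case
      using T by (intro exI[of _ "insert y T"]) auto
  qed
  from this[OF assms] obtain T where T: "T \<subseteq> good" "finite T" "card T = k"
    "CARD('a) + 2 * k \<le> dim (homogenized_tangents T) + codim + 1"
    by auto
  obtain a b where ab: "a \<noteq> 0" "\<forall>e\<in>homogenized_tangents T. (a, b) \<bullet> e = 0"
    using supporting_hyperplane[OF T(1,2)] T(3) by auto
  \<comment> \<open>A nonzero vector orthogonal to the span shows that the span is a proper subspace
    of a space of dimension \<open>CARD('a) + 1\<close>.\<close>
  have "(a, b) \<notin> span (homogenized_tangents T)"
    using orthogonal_span[OF ab(2), of "(a, b)"] ab(1) by (auto simp: zero_prod_def simp del: inner_Pair)
  then have "dim (homogenized_tangents T) + 1 = dim (insert (a, b) (homogenized_tangents T))"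
    by (simp add: dim_insert)
  also have "\<dots> \<le> DIM((real ^ 'a) \<times> real)"
    by (rule dim_subset_UNIV)
  also have "\<dots> = CARD('a) + 1"
    by simp
  finally show ?thesis
    using T(4) by linarith
qed

end

section \<open>Complex polynomials and Hilbert's basis theorem\<close>

definition monom_value :: "('n \<Rightarrow>\<^sub>0 nat) \<Rightarrow> complex ^ 'n \<Rightarrow> complex" where
  "monom_value m z = (\<Prod>i\<in>UNIV. (z $ i) ^ Poly_Mapping.lookup m i)"

abbreviation cvar :: "'n \<Rightarrow> 'n cpoly" where
  "cvar i \<equiv> Poly_Mapping.single (Poly_Mapping.single i 1) 1"

lemma monom_value_add: "monom_value (m + n) z = monom_value m z * monom_value n z"
  by (simp add: monom_value_def lookup_add power_add prod.distrib)

lemma monom_value_0 [simp]: "monom_value 0 z = 1"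
  by (simp add: monom_value_def)

lemma eval_cpoly_superset:
  assumes "finite S" "Poly_Mapping.keys f \<subseteq> S"
  shows "eval_cpoly f z = (\<Sum>m\<in>S. Poly_Mapping.lookup f m * monom_value m z)"
  unfolding eval_cpoly_def monom_value_def[symmetric] using assms
  by (intro sum.mono_neutral_left) (auto simp: in_keys_iff)

lemma eval_cpoly_add [simp]: "eval_cpoly (f + g) z = eval_cpoly f z + eval_cpoly g z"
proof -
  let ?S = "Poly_Mapping.keys f \<union> Poly_Mapping.keys g"
  have "Poly_Mapping.keys (f + g) \<subseteq> ?S"
    by (rule Poly_Mapping.keys_add)
  then show ?thesis
    using eval_cpoly_superset[of ?S f z] eval_cpoly_superset[of ?S g z] eval_cpoly_superset[of ?S "f + g" z]
    by (simp add: lookup_add distrib_right sum.distrib)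
qed

lemma eval_cpoly_0 [simp]: "eval_cpoly 0 z = 0"
  by (simp add: eval_cpoly_def)

lemma eval_cpoly_single: "eval_cpoly (Poly_Mapping.single m a) z = a * monom_value m z"
  using eval_cpoly_superset[of "{m}" "Poly_Mapping.single m a" z] by simp

lemma eval_cpoly_const [simp]: "eval_cpoly (Poly_Mapping.single 0 a) z = a"
  by (simp add: eval_cpoly_single)

lemma eval_cpoly_sum: "eval_cpoly (\<Sum>a\<in>A. f a) z = (\<Sum>a\<in>A. eval_cpoly (f a) z)"
  by (induction A rule: infinite_finite_induct) auto

lemma poly_mapping_eq_sum_single:
  "f = (\<Sum>m\<in>Poly_Mapping.keys f. Poly_Mapping.single m (Poly_Mapping.lookup f m))"
proof (rule poly_mapping_eqI)
  fix k
  show "Poly_Mapping.lookup f k =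
      Poly_Mapping.lookup (\<Sum>m\<in>Poly_Mapping.keys f. Poly_Mapping.single m (Poly_Mapping.lookup f m)) k"
    by (simp add: lookup_sum lookup_single when_def in_keys_iff)
qed

lemma eval_cpoly_mult [simp]: "eval_cpoly (f * g) z = eval_cpoly f z * eval_cpoly g z"
proof -
  have "f * g = (\<Sum>m\<in>Poly_Mapping.keys f. \<Sum>n\<in>Poly_Mapping.keys g.
      Poly_Mapping.single (m + n) (Poly_Mapping.lookup f m * Poly_Mapping.lookup g n))"
    by (subst poly_mapping_eq_sum_single[of f], subst poly_mapping_eq_sum_single[of g])
       (simp add: sum_product mult_single)
  then show ?thesis
    by (simp add: eval_cpoly_sum eval_cpoly_single monom_value_add sum_product mult_ac
        eval_cpoly_def[of f] eval_cpoly_def[of g] monom_value_def[symmetric])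
qed

lemma eval_cpoly_var [simp]: "eval_cpoly (cvar i) z = z $ i"
proof -
  have "monom_value (Poly_Mapping.single i 1) z = (\<Prod>j\<in>UNIV. if j = i then z $ j else 1)"
    unfolding monom_value_def by (intro prod.cong) (auto simp: lookup_single when_def)
  then show ?thesis
    by (simp add: eval_cpoly_single)
qed

lemma complex_polynomial_eval_cpoly: "complex_polynomial (\<lambda>x. eval_cpoly f (complex_point x))"
proof -
  have "complex_polynomial (\<lambda>x. complex_point x $ i)" for i
    unfolding complex_point_def
    by (simp, intro complex_polynomial_of_real real_polynomial_function.intros(1) bounded_linear_vec_nth)
  then show ?thesis
    unfolding eval_cpoly_def
    by (intro complex_polynomial_sum complex_polynomial_mult complex_polynomial_prod
        complex_polynomial_const complex_polynomial_power) auto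
qed

lemma real_polynomial_eq_eval_cpoly:
  fixes f :: "real ^ 'n \<Rightarrow> real"
  assumes "real_polynomial_function f"
  shows "\<exists>q. \<forall>x. eval_cpoly q (complex_point x) = complex_of_real (f x)"
  using assms
proof induction
  case (linear f)
  then interpret bounded_linear f .
  have "f x = (\<Sum>i\<in>UNIV. f (axis i 1) * x $ i)" for x
  proof -
    have "f x = f (\<Sum>i\<in>UNIV. x $ i *\<^sub>R axis i 1)"
      using basis_expansion[of x] by (simp add: scalar_mult_eq_scaleR)
    then show ?thesis
      by (simp add: sum scaleR mult.commute)
  qed
  note lin = this
  have "eval_cpoly (\<Sum>i\<in>UNIV. Poly_Mapping.single 0 (of_real (f (axis i 1))) * cvar i) (complex_point x) =
      complex_of_real (f x)" for x
    by (subst lin[of x]) (simp add: eval_cpoly_sum complex_point_def del: One_nat_def)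
  then show ?case
    by blast
next
  case (const c)
  show ?case
    by (intro exI[of _ "Poly_Mapping.single 0 (complex_of_real c)"]) simp
next
  case (add f g)
  then obtain p q where "\<forall>x. eval_cpoly p (complex_point x) = complex_of_real (f x)"
    "\<forall>x. eval_cpoly q (complex_point x) = complex_of_real (g x)"
    by blast
  then show ?case
    by (intro exI[of _ "p + q"]) simp
next
  case (mult f g)
  then obtain p q where "\<forall>x. eval_cpoly p (complex_point x) = complex_of_real (f x)"
    "\<forall>x. eval_cpoly q (complex_point x) = complex_of_real (g x)"
    by blast
  then show ?case
    by (intro exI[of _ "p * q"]) simp
qed

text \<open>The coefficients are split, not the values: the value of this polynomial is the real
  part of the value of \<open>f\<close> at real points, while at all complex points \<open>f\<close>
  is still recovered from the two parts.\<close>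

definition re_cpoly :: "'n cpoly \<Rightarrow> 'n cpoly" where
  "re_cpoly f = Poly_Mapping.map (\<lambda>c. complex_of_real (Re c)) f"

definition im_cpoly :: "'n cpoly \<Rightarrow> 'n cpoly" where
  "im_cpoly f = Poly_Mapping.map (\<lambda>c. complex_of_real (Im c)) f"

lemma lookup_re_cpoly [simp]: "Poly_Mapping.lookup (re_cpoly f) m = complex_of_real (Re (Poly_Mapping.lookup f m))"
  by (simp add: re_cpoly_def Poly_Mapping.map.rep_eq when_def)

lemma lookup_im_cpoly [simp]: "Poly_Mapping.lookup (im_cpoly f) m = complex_of_real (Im (Poly_Mapping.lookup f m))"
  by (simp add: im_cpoly_def Poly_Mapping.map.rep_eq when_def)

lemma real_coeffs_re_im_cpoly: "real_coeffs (re_cpoly f)" "real_coeffs (im_cpoly f)"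
  by (simp_all add: real_coeffs_def)

lemma eval_re_im_cpoly: "eval_cpoly f z = eval_cpoly (re_cpoly f) z + \<i> * eval_cpoly (im_cpoly f) z"
proof -
  have *: "Poly_Mapping.keys (re_cpoly f) \<subseteq> Poly_Mapping.keys f"
    "Poly_Mapping.keys (im_cpoly f) \<subseteq> Poly_Mapping.keys f"
    by (auto simp: in_keys_iff)
  have "eval_cpoly f z = (\<Sum>m\<in>Poly_Mapping.keys f. (complex_of_real (Re (Poly_Mapping.lookup f m)) +
      \<i> * complex_of_real (Im (Poly_Mapping.lookup f m))) * monom_value m z)"
    by (simp add: eval_cpoly_superset[OF finite_keys subset_refl] flip: complex_eq)
  then show ?thesis
    by (simp add: eval_cpoly_superset[OF finite_keys *(1)] eval_cpoly_superset[OF finite_keys *(2)]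
        sum.distrib sum_distrib_left algebra_simps)
qed

lemma eval_real_coeffs_real:
  assumes "real_coeffs f" shows "eval_cpoly f (complex_point x) \<in> \<real>"
  using assms unfolding eval_cpoly_def real_coeffs_def complex_point_def
  by (intro sum_in_Reals Reals_mult prod_in_Reals Reals_power) auto

lemma eval_re_im_cpoly_real_point:
  "eval_cpoly (re_cpoly f) (complex_point x) = complex_of_real (Re (eval_cpoly f (complex_point x)))"
  "eval_cpoly (im_cpoly f) (complex_point x) = complex_of_real (Im (eval_cpoly f (complex_point x)))"
proof -
  obtain r s where rs: "eval_cpoly (re_cpoly f) (complex_point x) = complex_of_real r"
    "eval_cpoly (im_cpoly f) (complex_point x) = complex_of_real s"
    using eval_real_coeffs_real[OF real_coeffs_re_im_cpoly(1), of f x]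
      eval_real_coeffs_real[OF real_coeffs_re_im_cpoly(2), of f x]
    by (auto elim!: Reals_cases)
  show "eval_cpoly (re_cpoly f) (complex_point x) = complex_of_real (Re (eval_cpoly f (complex_point x)))"
    "eval_cpoly (im_cpoly f) (complex_point x) = complex_of_real (Im (eval_cpoly f (complex_point x)))"
    using rs by (simp_all add: eval_re_im_cpoly[of f])
qed

text \<open>Finite generation in terms of sequences: some term is a combination of earlier ones,
  where \<open>N = 0\<close> means \<open>f 0 = 0\<close>. It is relative to a set so that variables
  can be adjoined inside one fixed ring.\<close>

definition noetherian :: "'a::comm_ring_1 set \<Rightarrow> bool" where
  "noetherian A \<longleftrightarrow> (\<forall>f::nat \<Rightarrow> 'a. range f \<subseteq> A \<longrightarrow>
     (\<exists>N b. range b \<subseteq> A \<and> f N = (\<Sum>i<N. b i * f i)))"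

definition subring :: "'a::comm_ring_1 set \<Rightarrow> bool" where
  "subring A \<longleftrightarrow> 0 \<in> A \<and> 1 \<in> A \<and> (\<forall>a\<in>A. - a \<in> A) \<and>
     (\<forall>a\<in>A. \<forall>b\<in>A. a + b \<in> A) \<and> (\<forall>a\<in>A. \<forall>b\<in>A. a * b \<in> A)"

text \<open>Exponents stay strictly below the index, so level 0 is just zero. As \<open>x\<close>
  may satisfy equations over \<open>A\<close>, an element can have several representations, and its
  degree below is the least possible one.\<close>

primrec polys_below :: "'a::comm_ring_1 set \<Rightarrow> 'a \<Rightarrow> nat \<Rightarrow> 'a set" where
  "polys_below A x 0 = {0}"
| "polys_below A x (Suc n) = {g + a * x ^ n | g a. g \<in> polys_below A x n \<and> a \<in> A}"

definition adjoin :: "'a::comm_ring_1 set \<Rightarrow> 'a \<Rightarrow> 'a set" where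
  "adjoin A x = (\<Union>n. polys_below A x n)"

lemma polys_below_SucI:
  "g \<in> polys_below A x n \<Longrightarrow> a \<in> A \<Longrightarrow> g + a * x ^ n \<in> polys_below A x (Suc n)"
  by auto

context
  fixes A :: "'a::comm_ring_1 set"
  assumes A: "subring A"
begin

lemma subring_closed:
  "0 \<in> A" "1 \<in> A" "a \<in> A \<Longrightarrow> - a \<in> A" "a \<in> A \<Longrightarrow> b \<in> A \<Longrightarrow> a + b \<in> A" "a \<in> A \<Longrightarrow> b \<in> A \<Longrightarrow> a * b \<in> A"
  using A by (auto simp: subring_def)

lemma polys_below_mono: "n \<le> m \<Longrightarrow> polys_below A x n \<subseteq> polys_below A x m"
proof (induction rule: dec_induct)
  case (step m)
  have "polys_below A x m \<subseteq> polys_below A x (Suc m)"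
    using polys_below_SucI[OF _ subring_closed(1), of _ x m] by auto
  with step show ?case
    by blast
qed auto

lemma polys_below_add: "p \<in> polys_below A x n \<Longrightarrow> q \<in> polys_below A x n \<Longrightarrow> p + q \<in> polys_below A x n"
proof (induction n arbitrary: p q)
  case (Suc n)
  then obtain g a h b where "p = g + a * x ^ n" "g \<in> polys_below A x n" "a \<in> A"
    "q = h + b * x ^ n" "h \<in> polys_below A x n" "b \<in> A"
    by auto
  then have "p + q = (g + h) + (a + b) * x ^ n" "g + h \<in> polys_below A x n" "a + b \<in> A"
    using Suc.IH subring_closed(4) by (simp_all add: algebra_simps)
  then show ?case
    by (simp only: polys_below_SucI)
qed simp

lemma polys_below_scale: "p \<in> polys_below A x n \<Longrightarrow> c \<in> A \<Longrightarrow> c * p \<in> polys_below A x n"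
proof (induction n arbitrary: p)
  case (Suc n)
  then obtain g a where "p = g + a * x ^ n" "g \<in> polys_below A x n" "a \<in> A"
    by auto
  then have "c * p = c * g + (c * a) * x ^ n" "c * g \<in> polys_below A x n" "c * a \<in> A"
    using Suc.IH[of g] Suc.prems(2) subring_closed(5) by (simp_all add: distrib_left mult.assoc)
  then show ?case
    by (simp only: polys_below_SucI)
qed simp

lemma polys_below_shift: "p \<in> polys_below A x n \<Longrightarrow> x ^ k * p \<in> polys_below A x (n + k)"
proof (induction n arbitrary: p)
  case 0
  then show ?case
    using polys_below_mono[of 0 k x] by auto
next
  case (Suc n)
  then obtain g a where "p = g + a * x ^ n" "g \<in> polys_below A x n" "a \<in> A"
    by auto
  then have "x ^ k * p = x ^ k * g + a * x ^ (n + k)" "x ^ k * g \<in> polys_below A x (n + k)" "a \<in> A"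
    using Suc.IH by (auto simp: algebra_simps power_add)
  then show ?case
    by (simp only: polys_below_SucI add_Suc)
qed

lemma polys_below_sum:
  "finite I \<Longrightarrow> (\<And>i. i \<in> I \<Longrightarrow> p i \<in> polys_below A x n) \<Longrightarrow> (\<Sum>i\<in>I. p i) \<in> polys_below A x n"
  by (induction rule: finite_induct) (use polys_below_mono[of 0 n x] polys_below_add in auto)

lemma adjoin_add: "p \<in> adjoin A x \<Longrightarrow> q \<in> adjoin A x \<Longrightarrow> p + q \<in> adjoin A x"
proof -
  assume "p \<in> adjoin A x" "q \<in> adjoin A x"
  then obtain n m where "p \<in> polys_below A x n" "q \<in> polys_below A x m"
    by (auto simp: adjoin_def)
  then have "p + q \<in> polys_below A x (max n m)"
    using polys_below_mono[of n "max n m" x] polys_below_mono[of m "max n m" x] polys_below_add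
    by (metis max.cobounded1 max.cobounded2 subsetD)
  then show ?thesis
    by (auto simp: adjoin_def)
qed

lemma adjoin_superset: "A \<subseteq> adjoin A x"
proof
  fix a assume "a \<in> A"
  then have "a \<in> polys_below A x 1"
    by simp
  then show "a \<in> adjoin A x"
    unfolding adjoin_def by blast
qed

lemma adjoin_scale: "p \<in> adjoin A x \<Longrightarrow> c \<in> A \<Longrightarrow> c * p \<in> adjoin A x"
  unfolding adjoin_def by (blast intro: polys_below_scale)

lemma adjoin_shift: "p \<in> adjoin A x \<Longrightarrow> x ^ k * p \<in> adjoin A x"
  unfolding adjoin_def by (blast intro: polys_below_shift)

lemma subring_adjoin: "subring (adjoin A x)"
proof -
  have "p * q \<in> adjoin A x" if "p \<in> polys_below A x n" "q \<in> adjoin A x" for p q n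
    using that
  proof (induction n arbitrary: p)
    case 0
    then show ?case
      using adjoin_superset[of x] A by (auto simp: subring_def)
  next
    case (Suc n)
    then obtain g a where g: "p = g + a * x ^ n" "g \<in> polys_below A x n" "a \<in> A"
      by auto
    then have "p * q = g * q + a * (x ^ n * q)"
      by (simp add: algebra_simps)
    then show ?case
      using Suc g by (auto intro: adjoin_add adjoin_scale adjoin_shift)
  qed
  then have "p * q \<in> adjoin A x" if "p \<in> adjoin A x" "q \<in> adjoin A x" for p q
    using that(1) that(2) unfolding adjoin_def[of A x] by blast
  moreover have "- p \<in> adjoin A x" if "p \<in> adjoin A x" for p
    using adjoin_scale[OF that, of "- 1"] A by (simp add: subring_def)
  ultimately show ?thesis
    using A adjoin_add adjoin_superset[of x] unfolding subring_def by blast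
qed

lemma var_in_adjoin: "x \<in> adjoin A x"
  using adjoin_shift[of 1 x 1] adjoin_superset[of x] A by (auto simp: subring_def)

text \<open>
  Hilbert's basis theorem: if some ideal is not finitely generated, choose successively elements of
  minimal degree outside the ideal generated so far; the relation between their leading
  coefficients yields an element of smaller degree.
\<close>

lemma noetherian_adjoin:
  assumes noeth: "noetherian A"
  shows "noetherian (adjoin A x)"
  unfolding noetherian_def
proof (intro allI impI, rule ccontr)
  fix F :: "nat \<Rightarrow> 'a"
  define B where "B = adjoin A x"
  assume "range F \<subseteq> adjoin A x" and no: "\<not> (\<exists>N b. range b \<subseteq> adjoin A x \<and> F N = (\<Sum>i<N. b i * F i))"
  then have F: "F n \<in> B" for n
    by (auto simp: B_def)
  have B: "0 \<in> B" "1 \<in> B" "\<And>a. a \<in> B \<Longrightarrow> - a \<in> B" "\<And>a b. a \<in> B \<Longrightarrow> b \<in> B \<Longrightarrow> a + b \<in> B"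
    "\<And>a b. a \<in> B \<Longrightarrow> b \<in> B \<Longrightarrow> a * b \<in> B"
    using subring_adjoin[of x] by (auto simp: subring_def B_def)
  define S where "S N = {\<Sum>i<N. b i * F i | b. range b \<subseteq> B}" for N
  have S_I: "(\<Sum>i<N. b i * F i) \<in> S N" if "range b \<subseteq> B" for N b
    unfolding S_def using that by blast
  have notin_S: "F N \<notin> S N" for N
    using no by (auto simp: S_def B_def)
  have S_mono: "S N \<subseteq> S M" if "N \<le> M" for N M
  proof
    fix p assume "p \<in> S N"
    then obtain b where b: "range b \<subseteq> B" "p = (\<Sum>i<N. b i * F i)"
      by (auto simp: S_def)
    have "p = (\<Sum>i<M. (if i < N then b i else 0) * F i)"
      unfolding b(2) using that by (intro sum.mono_neutral_cong_left) auto
    also have "\<dots> \<in> S M"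
      by (rule S_I) (use b(1) B(1) in auto)
    finally show "p \<in> S M" .
  qed
  have S_add: "p + q \<in> S N" if pq: "p \<in> S N" "q \<in> S N" for p q N
  proof -
    obtain b c where "range b \<subseteq> B" "p = (\<Sum>i<N. b i * F i)" "range c \<subseteq> B" "q = (\<Sum>i<N. c i * F i)"
      using pq by (auto simp: S_def)
    then have "p + q = (\<Sum>i<N. (b i + c i) * F i)" "range (\<lambda>i. b i + c i) \<subseteq> B"
      using B(4) by (auto simp: algebra_simps sum.distrib)
    then show ?thesis
      by (simp only: S_I)
  qed
  have S_scale: "a * p \<in> S N" if "a \<in> B" and p: "p \<in> S N" for a p N
  proof -
    obtain b where "range b \<subseteq> B" "p = (\<Sum>i<N. b i * F i)"
      using p by (auto simp: S_def)
    then have "a * p = (\<Sum>i<N. (a * b i) * F i)" "range (\<lambda>i. a * b i) \<subseteq> B"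
      using B(5) \<open>a \<in> B\<close> by (auto simp: algebra_simps sum_distrib_left)
    then show ?thesis
      by (simp only: S_I)
  qed
  have F_in_S: "F N \<in> S (Suc N)" for N
  proof -
    have "F N = (\<Sum>i<Suc N. (if i = N then 1 else 0) * F i)"
      by simp
    also have "\<dots> \<in> S (Suc N)"
      by (rule S_I) (use B in auto)
    finally show ?thesis .
  qed
  \<comment> \<open>The ideal generated by the whole sequence; it is contained in no
    \<open>S N\<close>, because \<open>F N\<close> is missing there.\<close>
  define \<aa> where "\<aa> = (\<Union>N. S N)"
  have \<aa>_add: "p + q \<in> \<aa>" if pq: "p \<in> \<aa>" "q \<in> \<aa>" for p q
  proof -
    obtain N M where "p \<in> S N" "q \<in> S M"
      using pq by (auto simp: \<aa>_def)
    then have "p + q \<in> S (max N M)"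
      using S_mono[of N "max N M"] S_mono[of M "max N M"] by (intro S_add) auto
    then show ?thesis
      by (auto simp: \<aa>_def)
  qed
  have \<aa>_scale: "a * p \<in> \<aa>" if "a \<in> B" "p \<in> \<aa>" for a p
    using S_scale that by (auto simp: \<aa>_def)
  have "S N \<subseteq> B" for N
  proof
    fix p assume "p \<in> S N"
    then obtain b where b: "range b \<subseteq> B" "p = (\<Sum>i<N. b i * F i)"
      by (auto simp: S_def)
    have "(\<Sum>i<M. b i * F i) \<in> B" for M
      by (induction M) (use b(1) in \<open>auto intro!: B F\<close>)
    then show "p \<in> B"
      by (simp add: b(2))
  qed
  then have \<aa>_B: "\<aa> \<subseteq> B"
    by (auto simp: \<aa>_def)
  define deg where "deg p = (LEAST n. p \<in> polys_below A x n)" for p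
  have deg: "p \<in> polys_below A x (deg p)" if "p \<in> B" for p
    unfolding deg_def by (rule LeastI_ex) (use that in \<open>auto simp: B_def adjoin_def\<close>)
  have deg_le: "deg p \<le> n" if "p \<in> polys_below A x n" for p n
    unfolding deg_def by (rule Least_le) (rule that)
  define pick where "pick I = arg_min deg (\<lambda>p. p \<in> \<aa> - I)" for I
  \<comment> \<open>\<open>I n\<close> is the ideal generated by the first \<open>n\<close> choices,
    each of minimal degree outside the ideal of the previous ones.\<close>
  define I where "I = rec_nat {0} (\<lambda>_ J. {g + b * pick J | g b. g \<in> J \<and> b \<in> B})"
  have I0: "I 0 = {0}" and I_Suc: "I (Suc n) = {g + b * pick (I n) | g b. g \<in> I n \<and> b \<in> B}" for n
    by (simp_all add: I_def)
  define f where "f n = pick (I n)" for n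
  \<comment> \<open>Finitely many choices involve only finitely many \<open>F i\<close>, so there is
    always an element left to choose.\<close>
  have I_bound: "\<exists>N. I n \<subseteq> S N" for n
  proof (induction n)
    case 0
    have "(\<Sum>i<0. (\<lambda>_. 0) i * F i) \<in> S 0"
      by (rule S_I) (use B(1) in auto)
    then have "I 0 \<subseteq> S 0"
      by (simp add: I0)
    then show ?case ..
  next
    case (Suc n)
    then obtain N where N: "I n \<subseteq> S N"
      by blast
    have "F N \<in> \<aa> - I n"
      using F_in_S notin_S N by (auto simp: \<aa>_def)
    then have "f n \<in> \<aa>"
      unfolding f_def pick_def using arg_min_natI[of "\<lambda>p. p \<in> \<aa> - I n" "F N" deg] by blast
    then obtain M where "f n \<in> S M"
      by (auto simp: \<aa>_def)
    then have "I (Suc n) \<subseteq> S (max N M)"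
      using N S_mono[of N "max N M"] S_mono[of M "max N M"]
      by (auto simp: I_Suc f_def[symmetric] intro!: S_add S_scale)
    then show ?case
      by blast
  qed
  have f_ex: "\<exists>p. p \<in> \<aa> - I n" for n
  proof -
    obtain N where "I n \<subseteq> S N"
      using I_bound by blast
    then have "F N \<in> \<aa> - I n"
      using F_in_S notin_S by (auto simp: \<aa>_def)
    then show ?thesis
      by blast
  qed
  have f: "f n \<in> \<aa>" "f n \<notin> I n" for n
    using f_ex[of n] arg_min_natI[of "\<lambda>p. p \<in> \<aa> - I n" _ deg] unfolding f_def pick_def by blast+
  have f_min: "deg (f n) \<le> deg p" if "p \<in> \<aa>" "p \<notin> I n" for p n
    using arg_min_nat_le[of "\<lambda>p. p \<in> \<aa> - I n" p deg] that unfolding f_def pick_def by blast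
  have I_mono: "I n \<subseteq> I m" if "n \<le> m" for n m
    using that
  proof (induction rule: dec_induct)
    case (step m)
    have "p = p + 0 * pick (I m)" for p
      by simp
    then have "I m \<subseteq> I (Suc m)"
      using B(1) unfolding I_Suc by blast
    with step show ?case
      by blast
  qed auto
  have I_zero: "0 \<in> I n" for n
    using I_mono[of 0 n] by (simp add: I0)
  have I_add: "p + q \<in> I n" if "p \<in> I n" "q \<in> I n" for p q n
    using that
  proof (induction n arbitrary: p q)
    case (Suc n)
    then obtain g b h c where "g \<in> I n" "b \<in> B" "p = g + b * pick (I n)" "h \<in> I n" "c \<in> B" "q = h + c * pick (I n)"
      unfolding I_Suc by blast
    then have "p + q = (g + h) + (b + c) * pick (I n)" "g + h \<in> I n" "b + c \<in> B"
      using Suc.IH B(4) by (auto simp: algebra_simps)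
    then show ?case
      unfolding I_Suc by blast
  qed (simp add: I0)
  have f_I: "b * f i \<in> I n" if "i < n" "b \<in> B" for b i n
  proof -
    have "b * f i = 0 + b * pick (I i)"
      by (simp add: f_def)
    then have "b * f i \<in> I (Suc i)"
      unfolding I_Suc using I_zero that(2) by blast
    then show ?thesis
      using I_mono[of "Suc i" n] that(1) by auto
  qed
  have deg_mono: "deg (f n) \<le> deg (f m)" if "n \<le> m" for n m
    using f_min[of "f m" n] f[of m] I_mono[OF that] by blast
  \<comment> \<open>The degree is positive because \<open>f n\<close> is nonzero and level 0
    contains only zero; the leading exponent is one less than the degree.\<close>
  have "\<exists>e g a. deg (f n) = Suc e \<and> g \<in> polys_below A x e \<and> a \<in> A \<and> f n = g + a * x ^ e" for n
  proof -
    have fn: "f n \<in> polys_below A x (deg (f n))"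
      using f(1) \<aa>_B deg by blast
    moreover have "f n \<noteq> 0"
      using f(2) I_zero by metis
    ultimately obtain e where "deg (f n) = Suc e"
      by (cases "deg (f n)") auto
    with fn show ?thesis
      by auto
  qed
  then obtain e g a where ega: "\<And>n. deg (f n) = Suc (e n)" "\<And>n. g n \<in> polys_below A x (e n)"
    "\<And>n. a n \<in> A" "\<And>n. f n = g n + a n * x ^ e n"
    by metis
  obtain N b where b: "range b \<subseteq> A" "a N = (\<Sum>i<N. b i * a i)"
    using noeth ega(3) unfolding noetherian_def by blast
  have e_mono: "e i \<le> e N" if "i < N" for i
    using deg_mono[of i N] that by (simp add: ega(1))
  have bx: "b i * x ^ k \<in> B" for i k
    using adjoin_scale[OF adjoin_shift[of 1 x k], of "b i"] b(1) B(2) by (auto simp: B_def)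
  \<comment> \<open>Lifts the relation between the leading coefficients: the powers of
    \<open>x\<close> raise all leading terms to the exponent \<open>e N\<close>, which is possible
    because the degrees increase weakly. Subtracting \<open>h\<close> from \<open>f N\<close>
    cancels the leading term without entering \<open>I N\<close>.\<close>
  define h where "h = (\<Sum>i<N. (b i * x ^ (e N - e i)) * f i)"
  have "h \<in> I N"
    unfolding h_def
  proof -
    have "(\<Sum>i\<in>J. (b i * x ^ (e N - e i)) * f i) \<in> I N" if "finite J" "J \<subseteq> {..<N}" for J
      using that by (induction J rule: finite_induct) (auto simp: I_zero intro!: I_add f_I bx)
    then show "(\<Sum>i<N. (b i * x ^ (e N - e i)) * f i) \<in> I N"
      by blast
  qed
  have "h \<in> \<aa>"
    using \<open>h \<in> I N\<close> I_bound[of N] by (auto simp: \<aa>_def)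
  have "f N - h \<in> \<aa>"
    using \<aa>_add[OF f(1)[of N] \<aa>_scale[OF _ \<open>h \<in> \<aa>\<close>, of "- 1"]] B(2,3) by simp
  moreover have "f N - h \<notin> I N"
    using I_add[of "f N - h" N h] \<open>h \<in> I N\<close> f(2)[of N] by auto
  moreover have "f N - h \<in> polys_below A x (e N)"
  proof -
    have "h = (\<Sum>i<N. b i * (x ^ (e N - e i) * g i)) + (\<Sum>i<N. b i * a i) * x ^ e N"
      unfolding h_def sum_distrib_right sum.distrib[symmetric]
    proof (intro sum.cong refl)
      fix i assume "i \<in> {..<N}"
      then have "x ^ (e N - e i) * x ^ e i = x ^ e N"
        using e_mono[of i] by (simp flip: power_add)
      then have "b i * a i * x ^ e N = b i * x ^ (e N - e i) * (a i * x ^ e i)"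
        by (simp add: mult_ac)
      then show "b i * x ^ (e N - e i) * f i = b i * (x ^ (e N - e i) * g i) + b i * a i * x ^ e N"
        by (simp add: ega(4) algebra_simps)
    qed
    then have "f N - h = g N + (- 1) * (\<Sum>i<N. b i * (x ^ (e N - e i) * g i))"
      by (simp add: ega(4)[of N] b(2))
    moreover have "(\<Sum>i<N. b i * (x ^ (e N - e i) * g i)) \<in> polys_below A x (e N)"
    proof (rule polys_below_sum)
      fix i assume "i \<in> {..<N}"
      then have "x ^ (e N - e i) * g i \<in> polys_below A x (e N)"
        using polys_below_shift[OF ega(2)[of i], of "e N - e i"] e_mono[of i] by simp
      then show "b i * (x ^ (e N - e i) * g i) \<in> polys_below A x (e N)"
        by (rule polys_below_scale) (use b(1) in auto)
    qed simp
    moreover have "- 1 \<in> A"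
      using A by (auto simp: subring_def)
    ultimately show ?thesis
      using ega(2)[of N] by (metis polys_below_add polys_below_scale)
  qed
  ultimately show False
    using f_min[of "f N - h" N] deg_le[of "f N - h" "e N"] ega(1)[of N] by auto
qed

end

text \<open>In a field either \<open>f 0\<close> is zero, the empty combination, or
  \<open>f 1\<close> is a multiple of \<open>f 0\<close>.\<close>

lemma noetherian_constants: "noetherian (range (Poly_Mapping.single 0) :: 'n cpoly set)"
  unfolding noetherian_def
proof (intro allI impI)
  fix f :: "nat \<Rightarrow> 'n cpoly"
  assume "range f \<subseteq> range (Poly_Mapping.single 0)"
  then have "\<forall>n. \<exists>c. f n = Poly_Mapping.single 0 c"
    by blast
  then obtain c where c: "\<And>n. f n = Poly_Mapping.single 0 (c n)"
    by metis
  have "(0 :: 'n cpoly) \<in> range (Poly_Mapping.single 0)"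
    by (rule range_eqI[of _ _ 0]) simp
  note [simp] = this
  show "\<exists>N b. range b \<subseteq> range (Poly_Mapping.single 0) \<and> f N = (\<Sum>i<N. b i * f i)"
  proof (cases "c 0 = 0")
    case True
    then show ?thesis
      by (intro exI[of _ 0] exI[of _ "\<lambda>_. Poly_Mapping.single 0 0"]) (auto simp: c)
  next
    case False
    then show ?thesis
      by (intro exI[of _ 1] exI[of _ "\<lambda>_. Poly_Mapping.single 0 (c 1 / c 0)"]) (auto simp: c mult_single)
  qed
qed

lemma subring_constants: "subring (range (Poly_Mapping.single 0) :: 'n cpoly set)"
  unfolding subring_def
  by (auto simp flip: single_one single_uminus single_add simp: mult_single intro: range_eqI[of _ _ 0])

text \<open>Adjoining the variables one by one to the constants gives a noetherian subring; it
  contains all monomials and is therefore the whole polynomial ring.\<close>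

lemma noetherian_cpoly: "noetherian (UNIV :: 'n::finite cpoly set)"
proof -
  have "\<exists>A :: 'n cpoly set. subring A \<and> noetherian A \<and> range (Poly_Mapping.single 0) \<subseteq> A \<and> cvar ` J \<subseteq> A"
    if "finite J" for J :: "'n set"
    using that
  proof (induction J rule: finite_induct)
    case empty
    then show ?case
      using noetherian_constants subring_constants by blast
  next
    case (insert j J)
    then obtain A :: "'n cpoly set" where "subring A" "noetherian A"
      "range (Poly_Mapping.single 0) \<subseteq> A" "cvar ` J \<subseteq> A"
      by blast
    then have "subring (adjoin A (cvar j))" "noetherian (adjoin A (cvar j))"
      "range (Poly_Mapping.single 0) \<subseteq> adjoin A (cvar j)" "cvar ` insert j J \<subseteq> adjoin A (cvar j)"
      using adjoin_superset[of A "cvar j"] var_in_adjoin[of A "cvar j"]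
      by (auto intro: subring_adjoin noetherian_adjoin)
    then show ?case
      by (intro exI[of _ "adjoin A (cvar j)"] conjI)
  qed
  from this[OF finite_class.finite_UNIV]
  obtain A :: "'n cpoly set" where A: "subring A" "noetherian A"
    "range (Poly_Mapping.single 0) \<subseteq> A" "range cvar \<subseteq> A"
    using finite_UNIV by metis
  have sum: "(\<Sum>i\<in>J. p i) \<in> A" if "finite J" "\<And>i. i \<in> J \<Longrightarrow> p i \<in> A" for J and p :: "'i \<Rightarrow> _"
    using that by (induction rule: finite_induct) (use A(1) in \<open>auto simp: subring_def\<close>)
  have one: "Poly_Mapping.single 0 1 \<in> A"
    using A(3) by blast
  have add: "Poly_Mapping.single (m + n) 1 \<in> A"
    if "Poly_Mapping.single m 1 \<in> A" "Poly_Mapping.single n 1 \<in> A" for m n :: "'n \<Rightarrow>\<^sub>0 nat"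
    using that A(1) mult_single[of m "1::complex" n 1] unfolding subring_def by fastforce
  have "Poly_Mapping.single (Poly_Mapping.single i k) 1 \<in> A" for i k
  proof (induction k)
    case (Suc k)
    then have "Poly_Mapping.single (Poly_Mapping.single i k + Poly_Mapping.single i 1) 1 \<in> A"
      using A(4) by (intro add) auto
    then show ?case
      by (simp flip: single_add)
  qed (use one in simp)
  note single = this
  have "Poly_Mapping.single (\<Sum>i\<in>J. Poly_Mapping.single i (Poly_Mapping.lookup m i)) 1 \<in> A"
    if "finite J" for m :: "'n \<Rightarrow>\<^sub>0 nat" and J
    using that by (induction rule: finite_induct) (use one in \<open>auto intro: add single\<close>)
  then have "Poly_Mapping.single m 1 \<in> A" for m :: "'n \<Rightarrow>\<^sub>0 nat"
    by (subst poly_mapping_eq_sum_single[of m]) simp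
  note single_1 = this
  have "Poly_Mapping.single m c \<in> A" for m :: "'n \<Rightarrow>\<^sub>0 nat" and c
  proof -
    have "Poly_Mapping.single 0 c * Poly_Mapping.single m 1 \<in> A"
      using A(1,3) single_1[of m] unfolding subring_def by blast
    then show ?thesis
      by (simp add: mult_single)
  qed
  note single' = this
  have "f \<in> A" for f
  proof -
    have "(\<Sum>m\<in>Poly_Mapping.keys f. Poly_Mapping.single m (Poly_Mapping.lookup f m)) \<in> A"
      by (intro sum single' finite_keys)
    then show ?thesis
      by (simp only: poly_mapping_eq_sum_single[of f, symmetric])
  qed
  then have "A = UNIV"
    by blast
  with A(2) show ?thesis
    by simp
qed

text \<open>Otherwise one could forever choose a polynomial in \<open>S\<close> that does not vanish
  on the common zeros of the previous choices. But one choice is a combination of earlier ones and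
  vanishes there.\<close>

lemma zero_set_finite:
  fixes S :: "'n::finite cpoly set"
  shows "\<exists>F. finite F \<and> F \<subseteq> S \<and> zero_set F = zero_set S"
proof (rule ccontr)
  assume no: "\<not> ?thesis"
  define pick where "pick F = (SOME f. f \<in> S \<and> (\<exists>z\<in>zero_set F. eval_cpoly f z \<noteq> 0))" for F
  have pick: "pick F \<in> S \<and> (\<exists>z\<in>zero_set F. eval_cpoly (pick F) z \<noteq> 0)" if "finite F" "F \<subseteq> S" for F
    unfolding pick_def
  proof (rule someI_ex)
    have "zero_set S \<subseteq> zero_set F"
      using that by (auto simp: zero_set_def)
    moreover have "zero_set F \<noteq> zero_set S"
      using no that by metis
    ultimately obtain z where "z \<in> zero_set F" "z \<notin> zero_set S"
      by blast
    then show "\<exists>f. f \<in> S \<and> (\<exists>z\<in>zero_set F. eval_cpoly f z \<noteq> 0)"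
      unfolding zero_set_def[of S] by blast
  qed
  define G where "G = rec_nat {} (\<lambda>_ F. insert (pick F) F)"
  have G0: "G 0 = {}" and G_Suc: "G (Suc n) = insert (pick (G n)) (G n)" for n
    by (simp_all add: G_def)
  have G: "finite (G n) \<and> G n \<subseteq> S" for n
    by (induction n) (use pick in \<open>auto simp: G0 G_Suc\<close>)
  obtain N b where b: "pick (G N) = (\<Sum>i<N. b i * pick (G i))"
    using noetherian_cpoly unfolding noetherian_def
    by (metis subset_UNIV)
  have in_G: "pick (G i) \<in> G n" if "i < n" for i n
    using that by (induction n) (auto simp: G_Suc less_Suc_eq)
  obtain z where z: "z \<in> zero_set (G N)" "eval_cpoly (pick (G N)) z \<noteq> 0"
    using pick G by blast
  have "eval_cpoly (pick (G N)) z = (\<Sum>i<N. eval_cpoly (b i) z * eval_cpoly (pick (G i)) z)"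
    by (simp add: b eval_cpoly_sum)
  also have "\<dots> = 0"
    using z(1) in_G by (intro sum.neutral) (auto simp: zero_set_def)
  finally show False
    using z(2) by simp
qed

section \<open>Complexification and real equations\<close>

lemma complexification_superset: "complex_point ` V \<subseteq> complexification V"
  by (auto simp: complexification_def)

lemma complexification_subset:
  "finite F \<Longrightarrow> complex_point ` V \<subseteq> zero_set F \<Longrightarrow> complexification V \<subseteq> zero_set F"
  by (auto simp: complexification_def complex_variety_def)

lemma vanish_on_complexification:
  assumes "\<And>x. x \<in> V \<Longrightarrow> eval_cpoly f (complex_point x) = 0" "z \<in> complexification V"
  shows "eval_cpoly f z = 0"
  using complexification_subset[of "{f}" V] assms by (auto simp: zero_set_def)

text \<open>If a polynomial vanishes at real points, so do the polynomials formed from the real and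
  the imaginary parts of its coefficients. All equations of the complexification can therefore be
  taken real.\<close>

lemma complexification_eq_real_zero_set:
  fixes V :: "(real ^ 'n) set"
  shows "\<exists>F. finite F \<and> (\<forall>f\<in>F. real_coeffs f) \<and> complexification V = zero_set F"
proof -
  define S :: "'n cpoly set" where
    "S = {f. real_coeffs f \<and> (\<forall>x\<in>V. eval_cpoly f (complex_point x) = 0)}"
  obtain F where F: "finite F" "F \<subseteq> S" "zero_set F = zero_set S"
    using zero_set_finite by blast
  have "complexification V \<subseteq> zero_set F"
    using F(1,2) by (intro complexification_subset) (auto simp: zero_set_def S_def)
  moreover have "zero_set S \<subseteq> W" if W: "complex_variety W" "complex_point ` V \<subseteq> W" for W
  proof
    fix z assume z: "z \<in> zero_set S"
    obtain G where G: "W = zero_set G"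
      using W(1) by (auto simp: complex_variety_def)
    have "eval_cpoly g z = 0" if "g \<in> G" for g
    proof -
      have "eval_cpoly g (complex_point x) = 0" if "x \<in> V" for x
        using \<open>complex_point ` V \<subseteq> W\<close> that \<open>g \<in> G\<close> by (auto simp: G zero_set_def)
      then have "re_cpoly g \<in> S" "im_cpoly g \<in> S"
        by (simp_all add: S_def real_coeffs_re_im_cpoly eval_re_im_cpoly_real_point)
      then show ?thesis
        using z by (simp add: eval_re_im_cpoly[of g] zero_set_def)
    qed
    then show "z \<in> W"
      by (simp add: G zero_set_def)
  qed
  then have "zero_set S \<subseteq> complexification V"
    by (auto simp: complexification_def)
  ultimately show ?thesis
    using F by (intro exI[of _ F]) (auto simp: S_def)
qed

text \<open>Arbitrary complex equations suffice: replacing them by real equations of the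
  complexification does not change the real points and yields the minimality that the definition of
  a real variety demands.\<close>

lemma real_varietyI:
  assumes "finite G" "V = {x. complex_point x \<in> zero_set G}"
  shows "real_variety V"
proof -
  obtain F where F: "finite F" "\<forall>f\<in>F. real_coeffs f" "complexification V = zero_set F"
    using complexification_eq_real_zero_set by blast
  have "complexification V \<subseteq> zero_set G"
    using assms by (intro complexification_subset) auto
  then have "V = {x. complex_point x \<in> zero_set F}"
    using complexification_superset[of V] assms(2) F(3) by blast
  then show ?thesis
    unfolding real_variety_def using F by blast
qed

lemma irreducible_real_variety_prime:
  assumes V: "irreducible_real_variety V"
    and poly: "real_polynomial_function f" "real_polynomial_function g"
    and zero: "\<And>x. x \<in> V \<Longrightarrow> f x * g x = 0"
  shows "(\<forall>x\<in>V. f x = 0) \<or> (\<forall>x\<in>V. g x = 0)"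
proof -
  obtain F where F: "finite F" "V = {x. complex_point x \<in> zero_set F}"
    using V unfolding irreducible_real_variety_def real_variety_def by blast
  have var: "real_variety {x \<in> V. h x = 0}" if h: "real_polynomial_function h" for h
  proof -
    obtain q where q: "\<forall>x. eval_cpoly q (complex_point x) = complex_of_real (h x)"
      using real_polynomial_eq_eval_cpoly[OF h] by blast
    show ?thesis
      by (rule real_varietyI[of "insert q F"]) (use F q in \<open>auto simp: zero_set_def\<close>)
  qed
  have "V = {x \<in> V. f x = 0} \<union> {x \<in> V. g x = 0}"
    using zero by auto
  then have "{x \<in> V. f x = 0} = V \<or> {x \<in> V. g x = 0} = V"
    using V var[OF poly(1)] var[OF poly(2)] unfolding irreducible_real_variety_def
    by (smt (verit) mem_Collect_eq psubsetI subsetI)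
  then show ?thesis
    by blast
qed

section \<open>Dimension and the main theorem\<close>

lemma irreducible_complex_variety_prime:
  assumes X: "irreducible_complex_variety X"
    and zero: "\<And>z. z \<in> X \<Longrightarrow> eval_cpoly f z * eval_cpoly g z = 0"
  shows "(\<forall>z\<in>X. eval_cpoly f z = 0) \<or> (\<forall>z\<in>X. eval_cpoly g z = 0)"
proof -
  obtain F where F: "finite F" "X = zero_set F"
    using X unfolding irreducible_complex_variety_def complex_variety_def by blast
  have var: "complex_variety {z \<in> X. eval_cpoly h z = 0}" for h
    unfolding complex_variety_def by (rule exI[of _ "insert h F"]) (use F in \<open>auto simp: zero_set_def\<close>)
  have "X = {z \<in> X. eval_cpoly f z = 0} \<union> {z \<in> X. eval_cpoly g z = 0}"
    using zero by auto
  then have "{z \<in> X. eval_cpoly f z = 0} = X \<or> {z \<in> X. eval_cpoly g z = 0} = X"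
    using X var[of f] var[of g] unfolding irreducible_complex_variety_def
    by (smt (verit) mem_Collect_eq psubsetI subsetI)
  then show ?thesis
    by blast
qed

text \<open>Each strict inclusion provides a polynomial that vanishes on the smaller variety but not
  on the larger one, where it is a nonzerodivisor by irreducibility. So every step of the chain adds
  one independent function.\<close>

lemma chain_alg_indep:
  assumes irred: "\<And>i. i \<le> d \<Longrightarrow> irreducible_complex_variety (X i)"
    and strict: "\<And>i. i < d \<Longrightarrow> X i \<subset> X (Suc i)"
  shows "\<exists>h. alg_indep d (\<lambda>i. eval_cpoly (h i)) (X d)"
proof -
  have "\<exists>f. (\<forall>z\<in>X i. eval_cpoly f z = 0) \<and> (\<exists>z\<in>X (Suc i). eval_cpoly f z \<noteq> 0)" if i: "i < d" for i
  proof -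
    obtain F where F: "X i = zero_set F"
      using irred[of i] i unfolding irreducible_complex_variety_def complex_variety_def by auto
    obtain z where "z \<in> X (Suc i)" "z \<notin> X i"
      using strict[OF i] by blast
    then show ?thesis
      unfolding F zero_set_def by blast
  qed
  then obtain h where h: "\<And>i z. i < d \<Longrightarrow> z \<in> X i \<Longrightarrow> eval_cpoly (h i) z = 0"
    "\<And>i. i < d \<Longrightarrow> \<exists>z\<in>X (Suc i). eval_cpoly (h i) z \<noteq> 0"
    by metis
  have "alg_indep j (\<lambda>i. eval_cpoly (h i)) (X j)" if "j \<le> d" for j
    using that
  proof (induction j)
    case 0
    then show ?case
      using irred[of 0] by (intro alg_indep_0) (auto simp: irreducible_complex_variety_def)
  next
    case (Suc j)
    show ?case
    proof (rule alg_indep_Suc[where X = "X j" and R = "range eval_cpoly"])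
      show "alg_indep j (\<lambda>i. eval_cpoly (h i)) (X j)" "X j \<subseteq> X (Suc j)"
        using Suc strict[of j] by auto
      show "eval_cpoly (h j) z = 0" if "z \<in> X j" for z
        using h(1) that Suc.prems by simp
      show "F z = 0" if F: "F \<in> range eval_cpoly" and zero: "\<And>z. z \<in> X (Suc j) \<Longrightarrow> F z * eval_cpoly (h j) z = 0"
        and z: "z \<in> X (Suc j)" for F z
      proof -
        obtain f where f: "F = eval_cpoly f"
          using F by blast
        have "(\<forall>z\<in>X (Suc j). eval_cpoly f z = 0) \<or> (\<forall>z\<in>X (Suc j). eval_cpoly (h j) z = 0)"
          using zero Suc.prems unfolding f by (intro irreducible_complex_variety_prime irred) auto
        then show ?thesis
          using h(2)[of j] Suc.prems z f by auto
      qed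
      show "(\<lambda>_. a) \<in> range eval_cpoly" for a
        by (rule range_eqI[of _ _ "Poly_Mapping.single 0 a"]) auto
      show "(\<lambda>z. F z + G z) \<in> range eval_cpoly" "(\<lambda>z. F z * G z) \<in> range eval_cpoly"
        if FG: "F \<in> range eval_cpoly" "G \<in> range eval_cpoly" for F G
      proof -
        obtain f g where "F = eval_cpoly f" "G = eval_cpoly g"
          using FG by blast
        then show "(\<lambda>z. F z + G z) \<in> range eval_cpoly" "(\<lambda>z. F z * G z) \<in> range eval_cpoly"
          using range_eqI[of _ eval_cpoly "f + g"] range_eqI[of _ eval_cpoly "f * g"]
          by (simp_all add: fun_eq_iff)
      qed
    qed auto
  qed
  then show ?thesis
    by blast
qed

text \<open>The supremum of the chain lengths is attained. Independence on the top member of the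
  chain passes to \<open>V\<close>, because a polynomial relation on \<open>V\<close> also holds on
  the complexification, which contains that member.\<close>

lemma dimension_alg_indep:
  fixes V :: "(real ^ 'n) set"
  assumes "real_variety_dim V = enat d" "d \<ge> 1"
  shows "\<exists>h. alg_indep d (\<lambda>i x. eval_cpoly (h i) (complex_point x)) V"
proof -
  define L where "L = {n. \<exists>X. (\<forall>i\<le>n. irreducible_complex_variety (X i) \<and> X i \<subseteq> complexification V) \<and>
    (\<forall>i<n. X i \<subset> X (Suc i))}"
  have "{enat n | n. \<exists>X. (\<forall>i\<le>n. irreducible_complex_variety (X i) \<and> X i \<subseteq> complexification V) \<and>
    (\<forall>i<n. X i \<subset> X (Suc i))} = enat ` L"
    by (auto simp: L_def)
  then have Sup: "Sup (enat ` L) = enat d"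
    using assms(1) by (simp add: real_variety_dim_def complex_variety_dim_def)
  \<comment> \<open>The supremum would be 0 for an empty set of lengths and infinite for an infinite
    one; neither is \<open>enat d\<close> with \<open>d \<ge> 1\<close>.\<close>
  then have "L \<noteq> {}" "finite (enat ` L)"
    using assms(2) by (auto simp: Sup_enat_def zero_enat_def split: if_splits)
  then have "Sup (enat ` L) \<in> enat ` L"
    by (simp add: Sup_enat_def Max_in del: finite_imageI)
  then have "d \<in> L"
    unfolding Sup by auto
  then obtain X where X: "\<And>i. i \<le> d \<Longrightarrow> irreducible_complex_variety (X i)" "X d \<subseteq> complexification V"
    "\<And>i. i < d \<Longrightarrow> X i \<subset> X (Suc i)"
    unfolding L_def by blast
  obtain h where h: "alg_indep d (\<lambda>i. eval_cpoly (h i)) (X d)"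
    using chain_alg_indep[of d X] X(1,3) by blast
  have "alg_indep d (\<lambda>i x. eval_cpoly (h i) (complex_point x)) V"
    unfolding alg_indep_def
  proof (intro allI impI)
    fix N :: nat and c
    let ?E = "PiE {..<d} (\<lambda>_. {..N})"
    assume zero: "\<forall>x\<in>V. (\<Sum>\<gamma>\<in>?E. c \<gamma> * (\<Prod>i<d. eval_cpoly (h i) (complex_point x) ^ \<gamma> i)) = 0"
    define p where "p = (\<Sum>\<gamma>\<in>?E. Poly_Mapping.single 0 (c \<gamma>) * (\<Prod>i<d. h i ^ \<gamma> i))"
    have power: "eval_cpoly (f ^ k) z = eval_cpoly f z ^ k" for f :: "'n cpoly" and k z
      by (induction k) (simp_all flip: single_one)
    have prod: "eval_cpoly (\<Prod>i<j. h i ^ \<gamma> i) z = (\<Prod>i<j. eval_cpoly (h i) z ^ \<gamma> i)" for j \<gamma> z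
      by (induction j) (simp_all add: power flip: single_one)
    have p: "eval_cpoly p z = (\<Sum>\<gamma>\<in>?E. c \<gamma> * (\<Prod>i<d. eval_cpoly (h i) z ^ \<gamma> i))" for z
      by (simp add: p_def eval_cpoly_sum prod)
    have "eval_cpoly p z = 0" if "z \<in> X d" for z
      by (rule vanish_on_complexification[of V]) (use zero X(2) that in \<open>auto simp: p\<close>)
    then show "\<forall>\<gamma>\<in>?E. c \<gamma> = 0"
      using h unfolding alg_indep_def p by blast
  qed
  then show ?thesis
    by blast
qed

section \<open>Real generators from complex ones\<close>

lemma generated_ideal_eq_combinations:
  assumes "finite G" "generates_ideal G I"
  shows "I = range (\<lambda>a. \<Sum>g\<in>G. a g * g)"
proof -
  interpret module "(*) :: 'a cpoly \<Rightarrow> 'a cpoly \<Rightarrow> 'a cpoly"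
    by unfold_locales (auto simp: algebra_simps)
  show ?thesis
    using assms span_finite[OF assms(1)] by (simp add: generates_ideal_def)
qed

definition re_im :: "'n cpoly \<times> bool \<Rightarrow> real ^ 'n \<Rightarrow> real" where
  "re_im k x = (if snd k then Re (eval_cpoly (fst k) (complex_point x))
                else Im (eval_cpoly (fst k) (complex_point x)))"

text \<open>The real and imaginary parts of complex generators generate the real vanishing ideal: a
  real polynomial that vanishes on \<open>V\<close> also vanishes on the complexification, so it is
  a complex combination of \<open>G\<close>, of which the real part is taken.\<close>

lemma irreducible_real_variety_zero_locus:
  fixes V :: "(real ^ 'n) set"
  assumes V: "irreducible_real_variety V" "V \<noteq> {}"
    and G: "finite G" "generates_ideal G (vanishing_ideal (complexification V))"
  shows "zero_locus V (G \<times> UNIV) re_im"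
proof
  note ideal = generated_ideal_eq_combinations[OF G]
  have in_ideal: "f \<in> vanishing_ideal (complexification V)"
    if "\<And>x. x \<in> V \<Longrightarrow> eval_cpoly f (complex_point x) = 0" for f
    using vanish_on_complexification[of V f] that by (auto simp: vanishing_ideal_def)
  have ideal_zero: "eval_cpoly f (complex_point x) = 0"
    if "f \<in> vanishing_ideal (complexification V)" "x \<in> V" for f x
    using that complexification_superset[of V] by (auto simp: vanishing_ideal_def)
  have G_ideal: "g \<in> vanishing_ideal (complexification V)" if "g \<in> G" for g
  proof -
    have "g = (\<Sum>h\<in>G. (if h = g then 1 else 0) * h)"
      using G(1) that by (simp add: if_distrib[of "\<lambda>a. a * _"] cong: if_cong)
    then show ?thesis
      unfolding ideal by (rule range_eqI[of _ _ "\<lambda>h. if h = g then 1 else 0"])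
  qed
  obtain F where F: "finite F" "V = {x. complex_point x \<in> zero_set F}"
    using V unfolding irreducible_real_variety_def real_variety_def by blast
  show "V \<noteq> {}" "finite (G \<times> (UNIV :: bool set))"
    using V(2) G(1) by auto
  show "real_polynomial_function (re_im k)" for k :: "'n cpoly \<times> bool"
    using complex_polynomial_eval_cpoly[of "fst k"]
    by (cases "snd k") (simp_all add: re_im_def[abs_def] complex_polynomial_def)
  have "x \<in> V" if x: "\<And>g. g \<in> G \<Longrightarrow> eval_cpoly g (complex_point x) = 0" for x
  proof -
    have "eval_cpoly f (complex_point x) = 0" if f: "f \<in> F" for f
    proof -
      have "f \<in> vanishing_ideal (complexification V)"
        by (rule in_ideal) (use F(2) f in \<open>auto simp: zero_set_def\<close>)
      then obtain a where "f = (\<Sum>g\<in>G. a g * g)"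
        unfolding ideal by blast
      then show ?thesis
        by (simp add: eval_cpoly_sum x)
    qed
    then show ?thesis
      by (simp add: F(2) zero_set_def)
  qed
  moreover have "eval_cpoly g (complex_point x) = 0" if "g \<in> G" "x \<in> V" for g x
    using ideal_zero G_ideal that by blast
  ultimately have "x \<in> V \<longleftrightarrow> (\<forall>g\<in>G. eval_cpoly g (complex_point x) = 0)" for x
    by blast
  moreover have "(\<forall>k\<in>G \<times> UNIV. re_im k x = 0) \<longleftrightarrow> (\<forall>g\<in>G. re_im (g, True) x = 0 \<and> re_im (g, False) x = 0)" for x
    by (simp add: Ball_def split_paired_All all_bool_eq)
  ultimately show "V = {x. \<forall>k\<in>G \<times> UNIV. re_im k x = 0}"
    by (simp add: set_eq_iff re_im_def complex_eq_iff)
  show "\<exists>a. (\<forall>k\<in>G \<times> UNIV. real_polynomial_function (a k)) \<and> (\<forall>x. f x = (\<Sum>k\<in>G \<times> UNIV. a k x * re_im k x))"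
    if f: "real_polynomial_function f" "\<And>x. x \<in> V \<Longrightarrow> f x = 0" for f
  proof -
    obtain q where q: "\<And>x. eval_cpoly q (complex_point x) = complex_of_real (f x)"
      using real_polynomial_eq_eval_cpoly[OF f(1)] by blast
    have "q \<in> vanishing_ideal (complexification V)"
      by (rule in_ideal) (simp add: q f(2))
    then obtain b where b: "q = (\<Sum>g\<in>G. b g * g)"
      unfolding ideal by blast
    \<comment> \<open>The minus sign comes from the real part of a product.\<close>
    define a where "a = (\<lambda>(g, c) x. if c then Re (eval_cpoly (b g) (complex_point x)) else - Im (eval_cpoly (b g) (complex_point x)))"
    have "real_polynomial_function (a k)" for k
      using complex_polynomial_eval_cpoly[of "b (fst k)"]
      by (cases "snd k") (simp_all add: a_def case_prod_unfold complex_polynomial_def real_polynomial_function_minus)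
    moreover have "f x = (\<Sum>k\<in>G \<times> UNIV. a k x * re_im k x)" for x
    proof -
      have "f x = Re (eval_cpoly q (complex_point x))"
        by (simp add: q)
      also have "\<dots> = (\<Sum>g\<in>G. \<Sum>c\<in>UNIV. a (g, c) x * re_im (g, c) x)"
        by (simp add: b eval_cpoly_sum a_def re_im_def UNIV_bool)
      also have "\<dots> = (\<Sum>k\<in>G \<times> UNIV. a k x * re_im k x)"
        by (simp add: sum.cartesian_product case_prod_unfold)
      finally show ?thesis .
    qed
    ultimately show ?thesis
      by blast
  qed
  show "(\<forall>x\<in>V. f x = 0) \<or> (\<forall>x\<in>V. g x = 0)"
    if "real_polynomial_function f" "real_polynomial_function g" "\<And>x. x \<in> V \<Longrightarrow> f x * g x = 0" for f g
    using irreducible_real_variety_prime[OF V(1) that] .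
qed

theorem theorem4p25:
  fixes V U :: "(real ^ 'n) set" and k d :: nat
  assumes "k \<ge> 1" and "d \<ge> 1"
    and "irreducible_real_variety V"
    and "nondegenerate V"
    and "real_variety_dim V = enat d"
    and "\<exists>x. smooth_real_point V x"
    and "real_variety U" and "U \<subset> V"
    and "weakly_neighborly k (V - U)"
  shows "CARD('n) \<ge> 2 * k + d - 1"
proof -
  obtain G where "finite G" "generates_ideal G (vanishing_ideal (complexification V))" "V \<noteq> {}"
    using assms(6) unfolding smooth_real_point_def by blast
  then interpret zero_locus V "G \<times> (UNIV :: bool set)"
    re_im
    using irreducible_real_variety_zero_locus[OF assms(3)] by blast
  obtain h where "alg_indep d (\<lambda>i x. eval_cpoly (h i) (complex_point x)) V"
    using dimension_alg_indep[OF assms(5,2)] by blast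
  then have dim: "d + codim \<le> CARD('n)"
    by (rule alg_indep_le) (rule complex_polynomial_eval_cpoly)
  obtain F where F: "U = {x. complex_point x \<in> zero_set F}"
    using assms(7) unfolding real_variety_def by blast
  obtain y where y: "y \<in> V" "y \<notin> U"
    using assms(8) by blast
  then obtain f where f: "f \<in> F" "eval_cpoly f (complex_point y) \<noteq> 0"
    by (auto simp: F zero_set_def)
  \<comment> \<open>An equation of \<open>U\<close> that is nonzero at \<open>y\<close> has a real
    or an imaginary part that is nonzero there; this one real polynomial takes the place of
    \<open>U\<close>.\<close>
  have "\<exists>u. real_polynomial_function u \<and> u y \<noteq> 0 \<and> (\<forall>x\<in>U. u x = 0)"
  proof -
    have zero: "eval_cpoly f (complex_point x) = 0" if "x \<in> U" for x
      using that f(1) by (simp add: F zero_set_def)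
    have "real_polynomial_function (\<lambda>x. Re (eval_cpoly f (complex_point x)))"
      "real_polynomial_function (\<lambda>x. Im (eval_cpoly f (complex_point x)))"
      using complex_polynomial_eval_cpoly[of f] by (simp_all add: complex_polynomial_def)
    moreover have "Re (eval_cpoly f (complex_point y)) \<noteq> 0 \<or> Im (eval_cpoly f (complex_point y)) \<noteq> 0"
      using f(2) by (simp add: complex_eq_iff)
    ultimately show ?thesis
      using zero by force
  qed
  then obtain u where u: "real_polynomial_function u" "u y \<noteq> 0" "\<And>x. x \<in> U \<Longrightarrow> u x = 0"
    by blast
  interpret neighborly_zero_locus V "G \<times> (UNIV :: bool set)"
    re_im u k
  proof
    show "real_polynomial_function u"
      by (rule u(1))
    show "u \<notin> vanishing"
      using u(2) y(1) by (auto simp: vanishing_def)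
    show "\<exists>x\<in>V. a \<bullet> x \<noteq> b" if "a \<noteq> 0" for a b
      using assms(4) that unfolding nondegenerate_def by blast
    show "\<exists>a b. a \<noteq> 0 \<and> (\<forall>x\<in>V. u x \<noteq> 0 \<longrightarrow> a \<bullet> x \<le> b) \<and> (\<forall>x\<in>T. a \<bullet> x = b)"
      if T: "T \<subseteq> {x \<in> V. u x \<noteq> 0}" "finite T" "card T = k" for T
    proof -
      have "T \<subseteq> V - U"
        using T(1) u(3) by blast
      then obtain H where "closed_halfspace H" "V - U \<subseteq> H" "T \<subseteq> frontier H"
        using assms(9) T(2,3) unfolding weakly_neighborly_def by blast
      then obtain a b where ab: "a \<noteq> 0" "V - U \<subseteq> {x. a \<bullet> x \<le> b}" "T \<subseteq> frontier {x. a \<bullet> x \<le> b}"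
        unfolding closed_halfspace_def by blast
      then have "T \<subseteq> {x. a \<bullet> x = b}"
        by (simp add: frontier_halfspace_le)
      moreover have "a \<bullet> x \<le> b" if "x \<in> V" "u x \<noteq> 0" for x
        using ab(2) u(3) that by blast
      ultimately show ?thesis
        using ab(1) by blast
    qed
  qed
  \<comment> \<open>Adding \<open>2 * k \<le> codim + 1\<close> and
    \<open>d + codim \<le> CARD('n)\<close> eliminates \<open>codim\<close>.\<close>
  show ?thesis
    using codim_bound[OF assms(1)] dim by linarith
qed

end
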